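(* Let $A,B,C\in\mathbb{R}$ with $A>0$, $B\leq 0$ and $B^2-4AC<0$, and consider the metric $$g=(Ay^2+By+C)\,dx^2+dy^2 .$$ Let $y_0>0$ be arbitrary and let $(u_0,v_0):\mathbb{R}\to\mathbb{R}^2$ be initial data prescribed on $\{y=y_0\}$, i.e. $(u,v)|_{y=y_0}=(u_0,v_0)$, where $u=-M/L$ and $v=\gamma/L$ in terms of the components $(L,M,N)$ of the normalised second fundamental form. Assume that $u_0\pm v_0$ are bounded on $\mathbb{R}$ and $$\inf_{\mathbb{R}}(u_0+v_0)>0,\qquad \sup_{\mathbb{R}}(u_0-v_0)<0.$$ Then there exists an $L^\infty$ weak solution $(L,M,N)$ to the Gauss--Codazzi equations of $g$ in the strip $\Omega=\mathbb{R}\times[y_0,-B/(2A)]$, with this initial data. Moreover, restricted to the domain $\Omega$, $g$ admits a $C^{1,1}$ isometric immersion into $\mathbb{R}^3$ with its Euclidean metric.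
   Context: For a surface with Riemannian metric $g$ in coordinates $(x,y)=(x_1,x_2)$, second fundamental form $(h_{ij})$, Levi-Civita Christoffel symbols $\Gamma^i_{jk}$ and Gauss curvature $\kappa<0$, set $L=h_{11}/\sqrt{\det g}$, $M=h_{12}/\sqrt{\det g}$, $N=h_{22}/\sqrt{\det g}$ and $\gamma=\sqrt{-\kappa}$. The Gauss--Codazzi equations for the unknowns $(L,M,N)$ are $$LN-M^2=\kappa,$$ $$M_x-L_y=\Gamma^2_{22}L-2\Gamma^2_{12}M+\Gamma^2_{11}N,\qquad N_x-M_y=-\Gamma^1_{22}L+2\Gamma^1_{12}M-\Gamma^1_{11}N.$$ For a metric $E(y)\,dx^2+dy^2$ one has $\Gamma^2_{11}=-E_y/2$, $\Gamma^1_{12}=E_y/(2E)$, all other Christoffel symbols (up to symmetry in the lower indices) zero, and $\kappa=-\frac{E_{yy}}{2E}+\frac{E_y^2}{4E^2}$. An $L^\infty$ weak solution is a triple of $L^\infty$ functions satisfying the Gauss equation almost everywhere and the Codazzi equations in the sense of distributions; the system is regarded as a Cauchy problem with $y$ as the evolution variable and data at $y=y_0$. The variables $u,v$ satisfy $(L,M,N)=\gamma\,\bigl(1/v,\,-u/v,\,(u^2-v^2)/v\bigr)$. An isometric immersion is an immersion $f$ such that the pullback under $f$ of the Euclidean metric is $g$; $C^{1,1}$ is identified with $W^{2,\infty}$ (locally). The strip is understood to be nondegenerate, i.e. $y_0<-B/(2A)$. *)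

theory Defs
  imports "HOL-Analysis.Analysis"
begin

text \<open>Points of the parameter plane are pairs \<open>(x, y)\<close>; tensor indices range over the type \<open>2\<close>,
  whose two elements are written \<open>1\<close> (for \<open>x\<close>) and \<open>2\<close> (for \<open>y\<close>).\<close>

definition coord_vec :: "2 \<Rightarrow> real \<times> real" where
  "coord_vec i = (if i = 1 then (1, 0) else (0, 1))"

definition pd :: "2 \<Rightarrow> (real \<times> real \<Rightarrow> real) \<Rightarrow> real \<times> real \<Rightarrow> real" where
  "pd i f p = deriv (\<lambda>t. f (p + t *\<^sub>R coord_vec i)) 0"


subsection \<open>Metrics, Christoffel symbols and Gauss curvature in coordinates\<close>

type_synonym metric = "real \<times> real \<Rightarrow> real^2^2"

text \<open>\<open>christoffel g i j k\<close> is $\Gamma^i_{jk}$.\<close>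

definition christoffel :: "metric \<Rightarrow> 2 \<Rightarrow> 2 \<Rightarrow> 2 \<Rightarrow> real \<times> real \<Rightarrow> real" where
  "christoffel g i j k p =
     (\<Sum>l\<in>UNIV. matrix_inv (g p) $ i $ l *
        (pd j (\<lambda>q. g q $ l $ k) p + pd k (\<lambda>q. g q $ l $ j) p - pd l (\<lambda>q. g q $ j $ k) p)) / 2"

text \<open>\<open>riemann g l k i j\<close> is the $l$-th component of $R(\partial_i, \partial_j)\partial_k$, where
  $R(X,Y) = \nabla_X\nabla_Y - \nabla_Y\nabla_X - \nabla_{[X,Y]}$.\<close>

definition riemann :: "metric \<Rightarrow> 2 \<Rightarrow> 2 \<Rightarrow> 2 \<Rightarrow> 2 \<Rightarrow> real \<times> real \<Rightarrow> real" where
  "riemann g l k i j p =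
     pd i (christoffel g l j k) p - pd j (christoffel g l i k) p
     + (\<Sum>m\<in>UNIV. christoffel g l i m p * christoffel g m j k p
                - christoffel g l j m p * christoffel g m i k p)"

definition gauss_curvature :: "metric \<Rightarrow> real \<times> real \<Rightarrow> real" where
  "gauss_curvature g p = (\<Sum>l\<in>UNIV. g p $ 1 $ l * riemann g l 2 1 2 p) / det (g p)"

definition gam :: "metric \<Rightarrow> real \<times> real \<Rightarrow> real" where
  "gam g p = sqrt (- gauss_curvature g p)"

definition warped_metric :: "(real \<Rightarrow> real) \<Rightarrow> metric" where
  "warped_metric E p = vector [vector [E (snd p), 0], vector [0, 1]]"

definition strip :: "real \<Rightarrow> real \<Rightarrow> (real \<times> real) set" where
  "strip y0 y1 = UNIV \<times> {y0..y1}"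


subsection \<open>Weak solutions of the Cauchy problem for the Gauss--Codazzi equations\<close>

primrec Ck :: "nat \<Rightarrow> (real \<times> real \<Rightarrow> real) \<Rightarrow> bool" where
  "Ck 0 f \<longleftrightarrow> continuous_on UNIV f"
| "Ck (Suc k) f \<longleftrightarrow> (\<forall>p. f differentiable (at p)) \<and> (\<forall>i. Ck k (pd i f))"

text \<open>The support may meet the initial line \<open>y = y0\<close> of the strip, but stays away from \<open>y = y1\<close>.\<close>

definition test_function :: "real \<Rightarrow> (real \<times> real \<Rightarrow> real) \<Rightarrow> bool" where
  "test_function y1 \<phi> \<longleftrightarrow>
     (\<forall>k. Ck k \<phi>) \<and> (\<exists>K. compact K \<and> K \<subseteq> UNIV \<times> {..<y1} \<and> (\<forall>p. p \<notin> K \<longrightarrow> \<phi> p = 0))"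

definition Linfty_on :: "(real \<times> real) set \<Rightarrow> (real \<times> real \<Rightarrow> real) \<Rightarrow> bool" where
  "Linfty_on S f \<longleftrightarrow>
     f \<in> borel_measurable (lebesgue_on S) \<and> (\<exists>K. AE p in lebesgue_on S. \<bar>f p\<bar> \<le> K)"

text \<open>Here \<open>L0\<close>, \<open>M0\<close> are the values of \<open>L\<close>, \<open>M\<close> on \<open>y = y0\<close>. They enter through the boundary terms
  produced by integrating $\phi L_y$ and $\phi M_y$ by parts over the strip. No datum is
  imposed on \<open>N\<close>, whose \<open>y\<close>-derivative does not occur in the system.\<close>

definition gauss_codazzi_weak_solution ::
  "metric \<Rightarrow> real \<Rightarrow> real \<Rightarrow> (real \<Rightarrow> real) \<Rightarrow> (real \<Rightarrow> real) \<Rightarrow>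
   (real \<times> real \<Rightarrow> real) \<Rightarrow> (real \<times> real \<Rightarrow> real) \<Rightarrow> (real \<times> real \<Rightarrow> real) \<Rightarrow> bool" where
  "gauss_codazzi_weak_solution g y0 y1 L0 M0 L M N \<longleftrightarrow>
     Linfty_on (strip y0 y1) L \<and> Linfty_on (strip y0 y1) M \<and> Linfty_on (strip y0 y1) N \<and>
     (AE p in lebesgue_on (strip y0 y1). L p * N p - (M p)\<^sup>2 = gauss_curvature g p) \<and>
     (\<forall>\<phi>. test_function y1 \<phi> \<longrightarrow>
        (LINT p|lebesgue_on (strip y0 y1). L p * pd 2 \<phi> p - M p * pd 1 \<phi> p)
          + (LINT x|lebesgue. L0 x * \<phi> (x, y0))
        = (LINT p|lebesgue_on (strip y0 y1).
             (christoffel g 2 2 2 p * L p - 2 * christoffel g 2 1 2 p * M p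
               + christoffel g 2 1 1 p * N p) * \<phi> p)) \<and>
     (\<forall>\<phi>. test_function y1 \<phi> \<longrightarrow>
        (LINT p|lebesgue_on (strip y0 y1). M p * pd 2 \<phi> p - N p * pd 1 \<phi> p)
          + (LINT x|lebesgue. M0 x * \<phi> (x, y0))
        = (LINT p|lebesgue_on (strip y0 y1).
             (- christoffel g 1 2 2 p * L p + 2 * christoffel g 1 1 2 p * M p
               - christoffel g 1 1 1 p * N p) * \<phi> p))"

text \<open>Data \<open>(u0, v0)\<close> for \<open>u = -M/L\<close>, \<open>v = \<gamma>/L\<close>, i.e. $L = \gamma/v$, $M = -\gamma u/v$. The condition
  that \<open>L\<close> is nonzero almost everywhere is what makes \<open>u\<close> and \<open>v\<close> meaningful for the solution.\<close>

definition gauss_codazzi_weak_solution_uv ::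
  "metric \<Rightarrow> real \<Rightarrow> real \<Rightarrow> (real \<Rightarrow> real) \<Rightarrow> (real \<Rightarrow> real) \<Rightarrow>
   (real \<times> real \<Rightarrow> real) \<Rightarrow> (real \<times> real \<Rightarrow> real) \<Rightarrow> (real \<times> real \<Rightarrow> real) \<Rightarrow> bool" where
  "gauss_codazzi_weak_solution_uv g y0 y1 u0 v0 L M N \<longleftrightarrow>
     (AE p in lebesgue_on (strip y0 y1). L p \<noteq> 0) \<and>
     gauss_codazzi_weak_solution g y0 y1
       (\<lambda>x. gam g (x, y0) / v0 x) (\<lambda>x. - gam g (x, y0) * u0 x / v0 x) L M N"


subsection \<open>Isometric immersions of class $C^{1,1}$\<close>

text \<open>Derivatives are taken relative to \<open>S\<close>, so that they are one-sided at boundary points of a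
  closed strip; $C^{1,1}$ is local: the derivative is Lipschitz on compact subsets of \<open>S\<close>.\<close>

definition C11_isometric_immersion ::
  "metric \<Rightarrow> (real \<times> real) set \<Rightarrow> (real \<times> real \<Rightarrow> real^3) \<Rightarrow> bool" where
  "C11_isometric_immersion g S f \<longleftrightarrow>
     (\<exists>f' :: real \<times> real \<Rightarrow> (real \<times> real) \<Rightarrow>\<^sub>L (real^3).
        (\<forall>p\<in>S. (f has_derivative blinfun_apply (f' p)) (at p within S)) \<and>
        (\<forall>K. compact K \<and> K \<subseteq> S \<longrightarrow> (\<exists>c. c-lipschitz_on K f')) \<and>
        (\<forall>p\<in>S. inj (blinfun_apply (f' p))) \<and>
        (\<forall>p\<in>S. \<forall>i j. f' p (coord_vec i) \<bullet> f' p (coord_vec j) = g p $ i $ j))"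


subsection \<open>The metric $E(y)\,dx^2 + dy^2$\<close>

lemma pd_1_snd [simp]: "pd 1 (\<lambda>q. h (snd q)) p = 0"
  by (simp add: pd_def coord_vec_def)

lemma pd_2_snd:
  assumes "(h has_real_derivative d) (at (snd p))"
  shows "pd 2 (\<lambda>q. h (snd q)) p = d"
proof -
  have "((\<lambda>t. h (snd p + t)) has_real_derivative d) (at 0)"
    using assms DERIV_shift[of h d 0 "snd p"] by (simp add: add.commute)
  then show ?thesis by (simp add: pd_def coord_vec_def DERIV_imp_deriv)
qed

lemma pd_const [simp]: "pd i (\<lambda>q. c) p = 0"
  by (simp add: pd_def)

lemma warped_metric_nth [simp]:
  "warped_metric E p $ 1 $ 1 = E (snd p)" "warped_metric E p $ 1 $ 2 = 0"
  "warped_metric E p $ 2 $ 1 = 0" "warped_metric E p $ 2 $ 2 = 1"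
  by (simp_all add: warped_metric_def)

lemma det_warped_metric [simp]: "det (warped_metric E p) = E (snd p)"
  by (simp add: det_2)

lemma matrix_inv_warped_metric:
  assumes "E (snd p) \<noteq> 0"
  shows "matrix_inv (warped_metric E p) = vector [vector [1 / E (snd p), 0], vector [0, 1]]"
    (is "_ = ?X")
proof -
  let ?G = "warped_metric E p"
  have GX: "?G ** ?X = mat 1" and XG: "?X ** ?G = mat 1"
    using assms by (simp_all add: vec_eq_iff forall_2 matrix_matrix_mult_def sum_2 mat_def)
  then have "?G ** matrix_inv ?G = mat 1"
    using XG someI[of "\<lambda>Y. ?G ** Y = mat 1 \<and> Y ** ?G = mat 1" ?X] GX
    by (simp add: matrix_inv_def)
  then show ?thesis
    using matrix_mul_assoc[of ?X ?G "matrix_inv ?G"] XG by simp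
qed

lemma christoffel_warped_metric:
  assumes "E (snd p) \<noteq> 0" "(E has_real_derivative E' (snd p)) (at (snd p))"
  shows "christoffel (warped_metric E) 1 1 1 p = 0"
    "christoffel (warped_metric E) 1 1 2 p = E' (snd p) / (2 * E (snd p))"
    "christoffel (warped_metric E) 1 2 1 p = E' (snd p) / (2 * E (snd p))"
    "christoffel (warped_metric E) 1 2 2 p = 0"
    "christoffel (warped_metric E) 2 1 1 p = - E' (snd p) / 2"
    "christoffel (warped_metric E) 2 1 2 p = 0"
    "christoffel (warped_metric E) 2 2 1 p = 0"
    "christoffel (warped_metric E) 2 2 2 p = 0"
  using assms
  by (simp_all add: christoffel_def matrix_inv_warped_metric sum_2 pd_2_snd[OF assms(2)])

lemma gauss_curvature_warped_metric:
  assumes nz: "\<And>y. E y \<noteq> 0"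
    and E': "\<And>y. (E has_real_derivative E' y) (at y)"
    and E'': "\<And>y. (E' has_real_derivative E'' y) (at y)"
  shows "gauss_curvature (warped_metric E) p =
    - E'' (snd p) / (2 * E (snd p)) + (E' (snd p))\<^sup>2 / (4 * (E (snd p))\<^sup>2)"
proof -
  note ch = christoffel_warped_metric[of E _ E', OF nz E']
  have 12: "christoffel (warped_metric E) 1 1 2 = (\<lambda>q. E' (snd q) / (2 * E (snd q)))"
    and 22: "christoffel (warped_metric E) 1 2 2 = (\<lambda>q. 0)"
    by (simp_all add: fun_eq_iff ch)
  have "((\<lambda>y. E' y / (2 * E y)) has_real_derivative
      (E'' y * (2 * E y) - E' y * (2 * E' y)) / (2 * E y * (2 * E y))) (at y)" for y
    by (auto intro!: derivative_eq_intros E' E'' simp: nz)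
  from pd_2_snd[OF this]
  have D: "pd 2 (christoffel (warped_metric E) 1 1 2) p =
      (E'' (snd p) * (2 * E (snd p)) - E' (snd p) * (2 * E' (snd p)))
        / (2 * E (snd p) * (2 * E (snd p)))"
    by (simp add: 12)
  show ?thesis
    using nz[of "snd p"] unfolding gauss_curvature_def riemann_def sum_2 det_warped_metric
    by (simp add: 22 ch D power2_eq_square)
       (simp add: left_diff_distrib diff_divide_distrib minus_diff_eq mult.assoc[symmetric])
qed

end

theory Submission
  imports Defs
begin

text \<open>Put \<open>W = E (u + v) > 0\<close>, \<open>Z = E (u - v) < 0\<close> and \<open>dt = dy / E\<close>. For a quadratic \<open>E\<close> the
  function \<open>E \<gamma>\<close> is constant, and the Gauss--Codazzi system becomes the linearly degenerate system
  \<open>W\<^sub>t + Z W\<^sub>x = b W\<^sup>2 Z\<close>, \<open>Z\<^sub>t + W Z\<^sub>x = b W Z\<^sup>2\<close> with \<open>b = - E\<^sub>y / (2 E) \<ge> 0\<close>. It has characteristic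
  coordinates \<open>\<alpha>, \<beta>\<close> with \<open>x = \<alpha> + \<beta>\<close>, \<open>1 / W = t\<^sub>\<alpha>\<close>, \<open>1 / Z = t\<^sub>\<beta>\<close>, in which it reduces to the single
  semilinear wave equation \<open>t\<^sub>\<alpha>\<^sub>\<beta> = - b(t)\<close>. This is solved by Picard iteration. Since \<open>b \<ge> 0\<close> up to
  \<open>y = - B / (2 A)\<close>, the signs \<open>t\<^sub>\<alpha> > 0 > t\<^sub>\<beta>\<close> persist, so \<open>(\<alpha>, \<beta>) \<mapsto> (x, t)\<close> stays bi-Lipschitz and
  carries the solution back to the strip. The characteristics are labelled by their feet \<open>\<xi>, \<eta>\<close> on the
  initial line, where \<open>p = d\<alpha>/d\<xi>\<close>, \<open>q = d\<beta>/d\<eta>\<close>, \<open>r = 1 / (W - Z)\<close>, \<open>P = t\<^sub>\<xi>\<close>, \<open>Q = - t\<^sub>\<eta>\<close>. The weak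
  equations and the change of variables all come from integrating derivatives along the
  characteristics.

  The immersion is an explicit surface of revolution, unrelated to the weak solution.\<close>

subsection \<open>Primitives of bounded Borel functions\<close>

text \<open>The data are merely bounded and measurable, so \<open>X\<close> and \<open>T\<close>
  have no pointwise derivatives in general: \<open>p\<close>, \<open>q\<close>, \<open>P\<close>,
  \<open>Q\<close> occur only as densities of primitives along lines of constant \<eta> or \<xi>,
  and every differential identity is used in integrated form.

  The wave equation appears because W is carried with speed Z: on \<alpha> = const the
  \<beta>-derivative is (d/dt + Z d/dx) / Z, so the equation for W says that the \<beta>-derivative
  of 1/W is -b; the equation for Z gives the same condition. On the initial line dx = d\<alpha> +
  d\<beta> and 0 = dt = d\<alpha>/W + d\<beta>/Z, hence p = W/(W - Z), q = -Z/(W - Z), p + q = 1,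
  and t_\<xi> = -t_\<eta> = 1/(W - Z) = r. The hypotheses on the initial data bound p, q, r above
  and away from 0.

  Integrating b \<ge> 0 from the diagonal shows that P and Q only grow away from it. This excludes
  blow-up of W = p/P and Z = -q/Q and keeps the characteristic coordinates nondegenerate.\<close>

lemma continuous_bounded_on_compact:
  fixes f :: "'a::metric_space \<Rightarrow> real"
  assumes "continuous_on UNIV f" "compact K"
  shows "\<exists>B. \<forall>x\<in>K. \<bar>f x\<bar> \<le> B"
  using compact_imp_bounded[OF compact_continuous_image[OF continuous_on_subset[OF assms(1)] assms(2)]]
  by (auto simp: bounded_iff)

lemma set_integrable_bounded_Icc:
  fixes f :: "real \<Rightarrow> 'a::euclidean_space"
  assumes [measurable]: "f \<in> borel_measurable borel"
    and b: "\<And>s. a \<le> s \<Longrightarrow> s \<le> b \<Longrightarrow> norm (f s) \<le> C"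
  shows "set_integrable lborel {a..b} f"
  unfolding set_integrable_def
proof (rule integrableI_bounded_set_indicator[where B=C])
  show "emeasure lborel {a..b} < \<infinity>"
    by (cases "a \<le> b") auto
qed (auto intro!: AE_I2 b simp: indicator_def)

lemma set_integrable_const_Icc [simp]: "set_integrable lborel {a..b::real} (\<lambda>_. C::real)"
  by (rule set_integrable_bounded_Icc[where C="\<bar>C\<bar>"]) auto

lemma norm_set_integral_Icc_le:
  fixes f :: "real \<Rightarrow> 'a::euclidean_space"
  assumes [measurable]: "f \<in> borel_measurable borel"
    and b: "\<And>s. a \<le> s \<Longrightarrow> s \<le> b \<Longrightarrow> norm (f s) \<le> C" and "a \<le> b"
  shows "norm (LINT s:{a..b}|lborel. f s) \<le> C * (b - a)"
proof -
  have "set_integrable lborel {a..b} f"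
    by (rule set_integrable_bounded_Icc) (use assms in auto)
  then have "norm (LINT s:{a..b}|lborel. f s) \<le> (LINT s:{a..b}|lborel. C)"
    unfolding set_lebesgue_integral_def set_integrable_def
    by (rule Bochner_Integration.integral_norm_bound_integral)
      (use set_integrable_const_Icc[of a b C, unfolded set_integrable_def] in \<open>auto simp: indicator_def b\<close>)
  also have "\<dots> = C * (b - a)"
    using \<open>a \<le> b\<close> by (simp add: set_lebesgue_integral_def)
  finally show ?thesis .
qed

lemma set_integral_Icc_ge:
  fixes f :: "real \<Rightarrow> real"
  assumes "set_integrable lborel {a..b} f"
    and b: "\<And>s. a \<le> s \<Longrightarrow> s \<le> b \<Longrightarrow> C \<le> f s" and "a \<le> b"
  shows "C * (b - a) \<le> (LINT s:{a..b}|lborel. f s)"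
proof -
  have "C * (b - a) = (LINT s:{a..b}|lborel. C)"
    using \<open>a \<le> b\<close> by (simp add: set_lebesgue_integral_def)
  also have "\<dots> \<le> (LINT s:{a..b}|lborel. f s)"
    by (rule set_integral_mono) (use assms in auto)
  finally show ?thesis .
qed

lemma set_integral_Icc_combine:
  fixes f :: "real \<Rightarrow> 'a::euclidean_space"
  assumes "f \<in> borel_measurable borel"
    and b: "\<And>s. a \<le> s \<Longrightarrow> s \<le> c \<Longrightarrow> norm (f s) \<le> C" and "a \<le> b" "b \<le> c"
  shows "(LINT s:{a..c}|lborel. f s) = (LINT s:{a..b}|lborel. f s) + (LINT s:{b..c}|lborel. f s)"
proof -
  have "set_integrable lborel {a..c} f"
    using set_integrable_bounded_Icc[OF assms(1) b] by blast
  moreover have "set_integrable lborel {a..b} f" "set_integrable lborel {b..c} f"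
    using set_integrable_bounded_Icc[OF assms(1), of _ _ C] b assms(3,4) by auto
  ultimately show ?thesis
    using Henstock_Kurzweil_Integration.integral_combine[OF assms(3,4), of f]
    by (simp add: set_borel_integral_eq_integral)
qed

text \<open>The library notion \<open>measurable_on\<close> supplies continuous approximants off a
  negligible set. Projecting them onto the ball of radius \<open>C\<close> gives the uniform bound
  that dominated convergence needs; the projection is continuous and fixes the limit.\<close>

lemma bounded_borel_approximation:
  fixes v :: "real \<Rightarrow> 'a::euclidean_space"
  assumes [measurable]: "v \<in> borel_measurable borel"
    and v: "\<And>s. a \<le> s \<Longrightarrow> s \<le> b \<Longrightarrow> norm (v s) \<le> C" and "0 \<le> C"
  obtains h :: "nat \<Rightarrow> real \<Rightarrow> 'a"
  where "\<And>n. continuous_on UNIV (h n)" "\<And>n s. norm (h n s) \<le> C"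
    "AE s in lborel. s \<in> {a..b} \<longrightarrow> (\<lambda>n. h n s) \<longlonglongrightarrow> v s"
proof -
  define vv where "vv s = indicator {a..b} s *\<^sub>R v s" for s
  have [measurable]: "vv \<in> borel_measurable borel" unfolding vv_def by measurable
  have vv: "vv s \<in> cball 0 C" for s using v[of s] \<open>0 \<le> C\<close> by (auto simp: vv_def indicator_def)
  have "vv \<in> borel_measurable (lebesgue_on UNIV)"
    unfolding lebesgue_on_UNIV_eq by (rule measurable_completion) simp
  then have "vv measurable_on UNIV"
    using lebesgue_measurable_imp_measurable_on[of vv UNIV] by (simp add: lebesgue_on_UNIV_eq)
  then obtain N g where N: "negligible N" and g: "\<And>n. continuous_on UNIV (g n)"
     and lim: "\<And>x. x \<notin> N \<Longrightarrow> (\<lambda>n. g n x) \<longlonglongrightarrow> vv x"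
    unfolding measurable_on_def by auto
  define h where "h n s = closest_point (cball 0 C) (g n s)" for n s
  have ccp: "continuous_on UNIV (closest_point (cball (0::'a) C))"
    by (rule continuous_on_closest_point) (use \<open>0 \<le> C\<close> in auto)
  show thesis
  proof
    show "continuous_on UNIV (h n)" for n
      unfolding h_def by (rule continuous_on_compose2[OF ccp g]) auto
    show "norm (h n s) \<le> C" for n s
      using closest_point_in_set[of "cball (0::'a) C" "g n s"] \<open>0 \<le> C\<close> by (auto simp: h_def)
    have "AE s in lebesgue. s \<notin> N"
      by (rule AE_not_in) (use N negligible_iff_null_sets in auto)
    then have "AE s in lborel. s \<notin> N" by (simp add: AE_completion_iff)
    then show "AE s in lborel. s \<in> {a..b} \<longrightarrow> (\<lambda>n. h n s) \<longlonglongrightarrow> v s"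
    proof (eventually_elim, intro impI)
      fix s assume s: "s \<notin> N" "s \<in> {a..b}"
      have "(\<lambda>n. h n s) \<longlonglongrightarrow> closest_point (cball 0 C) (vv s)"
        unfolding h_def
        by (rule continuous_on_tendsto_compose[OF ccp lim[OF s(1)]]) auto
      also have "closest_point (cball 0 C) (vv s) = v s"
        using closest_point_self[OF vv, of s] s by (simp add: vv_def)
      finally show "(\<lambda>n. h n s) \<longlonglongrightarrow> v s" .
    qed
  qed
qed

text \<open>Primitives of bounded Borel functions need not be differentiable, so the chain rule is obtained
  by approximating the integrand almost everywhere by continuous functions.\<close>

lemma chain_rule_primitive:
  fixes f :: "'a::euclidean_space \<Rightarrow> real" and v :: "real \<Rightarrow> 'a"
  assumes f: "\<And>x. (f has_derivative (\<lambda>h. f' x \<bullet> h)) (at x)" and cf: "continuous_on UNIV f'"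
    and v [measurable]: "v \<in> borel_measurable borel"
    and C: "\<And>s. a \<le> s \<Longrightarrow> s \<le> b \<Longrightarrow> norm (v s) \<le> C" and "a \<le> b"
    and x: "\<And>s. a \<le> s \<Longrightarrow> s \<le> b \<Longrightarrow> x s = x0 + (LINT t:{a..s}|lborel. v t)"
  shows "(LINT s:{a..b}|lborel. f' (x s) \<bullet> v s) = f (x b) - f (x a)"
proof -
  have "norm (v a) \<le> C" by (rule C) (use \<open>a \<le> b\<close> in auto)
  then have C0: "0 \<le> C" using norm_ge_zero[of "v a"] by linarith
  obtain h :: "nat \<Rightarrow> real \<Rightarrow> 'a" where h: "\<And>n. continuous_on UNIV (h n)" "\<And>n s. norm (h n s) \<le> C"
    and lim: "AE s in lborel. s \<in> {a..b} \<longrightarrow> (\<lambda>n. h n s) \<longlonglongrightarrow> v s"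
    using bounded_borel_approximation[of v a b C, OF v C C0] by blast
  have hm [measurable]: "h n \<in> borel_measurable borel" for n
    using h(1) by (rule borel_measurable_continuous_onI)
  \<comment> \<open>The primitives of the continuous approximants are C1, so the classical
    fundamental theorem applies to \<open>f\<close> along \<open>y n\<close>; dominated convergence
    then carries the identity over to \<open>x\<close>.\<close>
  define y where "y n s = x0 + (LINT t:{a..s}|lborel. h n t)" for n s
  have y_int: "y n s = x0 + integral {a..s} (h n)" for n s
  proof -
    have "set_integrable lborel {a..s} (h n)"
      by (rule set_integrable_bounded_Icc[OF hm, where C=C]) (rule h(2))
    then show ?thesis unfolding y_def by (simp add: set_borel_integral_eq_integral(2))
  qed
  have dy: "(y n has_vector_derivative h n s) (at s within {a..b})" if "s \<in> {a..b}" for n s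
    unfolding y_int[abs_def]
    by (auto intro!: derivative_eq_intros integral_has_vector_derivative that
        continuous_on_subset[OF h(1)])
  have ylim: "(\<lambda>n. y n s) \<longlonglongrightarrow> x s" if s: "a \<le> s" "s \<le> b" for s
  proof -
    have "(\<lambda>n. LINT t:{a..s}|lborel. h n t) \<longlonglongrightarrow> (LINT t:{a..s}|lborel. v t)"
      unfolding set_lebesgue_integral_def
    proof (rule integral_dominated_convergence[where w="\<lambda>t. indicator {a..s} t * C"])
      show "integrable lborel (\<lambda>t. indicator {a..s} t * C)"
        using set_integrable_bounded_Icc[of "\<lambda>_. C" a s C] C0 by (simp add: set_integrable_def)
      show "AE t in lborel. (\<lambda>n. indicator {a..s} t *\<^sub>R h n t) \<longlonglongrightarrow> indicator {a..s} t *\<^sub>R v t"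
        using lim by eventually_elim (use s in \<open>auto simp: indicator_def\<close>)
    qed (auto simp: indicator_def h(2))
    then show ?thesis unfolding y_def x[OF s] by (intro tendsto_intros)
  qed
  have ybd: "y n s \<in> cball x0 (C * (b - a))" if "a \<le> s" "s \<le> b" for n s
  proof -
    have "norm (LINT t:{a..s}|lborel. h n t) \<le> C * (s - a)"
      by (rule norm_set_integral_Icc_le) (use h that in auto)
    also have "\<dots> \<le> C * (b - a)" using that C0 by (intro mult_left_mono) auto
    finally show ?thesis by (simp add: y_def dist_norm)
  qed
  \<comment> \<open>All approximating curves stay in one ball, on which \<open>f'\<close> is
    bounded, so \<open>D * C\<close> dominates every integrand.\<close>
  obtain D where D: "\<And>z. z \<in> cball x0 (C * (b - a)) \<Longrightarrow> norm (f' z) \<le> D"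
    using continuous_bounded_on_compact[OF continuous_on_norm[OF cf] compact_cball] by (metis abs_norm_cancel)
  have yc: "continuous_on {a..b} (y n)" for n
    using dy by (meson continuous_on_eq_continuous_within has_vector_derivative_continuous)
  have cont: "continuous_on {a..b} (\<lambda>s. f' (y n s) \<bullet> h n s)" for n
    by (intro continuous_intros continuous_on_compose2[OF cf yc] continuous_on_subset[OF h(1)]) auto
  have FTC: "(LINT s:{a..b}|lborel. f' (y n s) \<bullet> h n s) = f (y n b) - f (y n a)" for n
    unfolding set_lebesgue_integral_def
  proof (rule integral_FTC_atLeastAtMost[OF \<open>a \<le> b\<close> _ cont])
    fix s assume s: "a \<le> s" "s \<le> b"
    have "(f \<circ> y n has_derivative (\<lambda>h. f' (y n s) \<bullet> h) \<circ> (\<lambda>t. t *\<^sub>R h n s)) (at s within {a..b})"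
      by (rule diff_chain_within)
        (use dy[of s n] s f in \<open>auto simp: has_vector_derivative_def intro: has_derivative_at_withinI\<close>)
    then show "((\<lambda>s. f (y n s)) has_vector_derivative f' (y n s) \<bullet> h n s) (at s within {a..b})"
      by (simp add: has_vector_derivative_def o_def)
  qed
  \<comment> \<open>\<open>x\<close> is known only through its integral formula on
    \<open>{a..b}\<close>, so the integrand inherits measurability as a pointwise limit along the
    \<open>y n\<close>.\<close>
  have xm: "set_borel_measurable lborel {a..b} (\<lambda>s. f' (x s) \<bullet> v s)"
    unfolding set_borel_measurable_def
  proof (rule borel_measurable_LIMSEQ_metric)
    show "(\<lambda>s. indicator {a..b} s *\<^sub>R (f' (y n s) \<bullet> v s)) \<in> borel_measurable lborel" for n
    proof -
      have "(\<lambda>s. indicator {a..b} s *\<^sub>R f' (y n s)) \<in> borel_measurable borel"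
        by (intro borel_measurable_continuous_on_indicator continuous_on_compose2[OF cf yc]) auto
      then have "(\<lambda>s. (indicator {a..b} s *\<^sub>R f' (y n s)) \<bullet> v s) \<in> borel_measurable borel"
        by measurable
      then show ?thesis by simp
    qed
    fix s
    have "isCont f' (x s)" using cf by (simp add: continuous_on_eq_continuous_at)
    then have "(\<lambda>n. f' (y n s)) \<longlonglongrightarrow> f' (x s)" if "s \<in> {a..b}"
      using ylim[of s] that isCont_tendsto_compose by auto
    then show "(\<lambda>n. indicator {a..b} s *\<^sub>R (f' (y n s) \<bullet> v s)) \<longlonglongrightarrow> indicator {a..b} s *\<^sub>R (f' (x s) \<bullet> v s)"
      by (auto simp: indicator_def intro!: tendsto_intros)
  qed
  have "(\<lambda>n. LINT s:{a..b}|lborel. f' (y n s) \<bullet> h n s) \<longlonglongrightarrow> (LINT s:{a..b}|lborel. f' (x s) \<bullet> v s)"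
    unfolding set_lebesgue_integral_def
  proof (rule integral_dominated_convergence[where w="\<lambda>t. indicator {a..b} t * (D * C)"])
    show "integrable lborel (\<lambda>t. indicator {a..b} t * (D * C))"
      using set_integrable_bounded_Icc[of "\<lambda>_. D * C" a b "\<bar>D * C\<bar>"] by (simp add: set_integrable_def)
    show "(\<lambda>s. indicator {a..b} s *\<^sub>R (f' (x s) \<bullet> v s)) \<in> borel_measurable lborel"
      using xm by (simp add: set_borel_measurable_def)
    show "(\<lambda>s. indicator {a..b} s *\<^sub>R (f' (y n s) \<bullet> h n s)) \<in> borel_measurable lborel" for n
      using borel_measurable_continuous_on_indicator[OF _ cont] by simp
    show "AE s in lborel. (\<lambda>n. indicator {a..b} s *\<^sub>R (f' (y n s) \<bullet> h n s))
       \<longlonglongrightarrow> indicator {a..b} s *\<^sub>R (f' (x s) \<bullet> v s)"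
      using lim
    proof eventually_elim
      fix s assume l: "s \<in> {a..b} \<longrightarrow> (\<lambda>n. h n s) \<longlonglongrightarrow> v s"
      have "isCont f' (x s)" using cf by (simp add: continuous_on_eq_continuous_at)
      then have "(\<lambda>n. f' (y n s)) \<longlonglongrightarrow> f' (x s)" if "s \<in> {a..b}"
        using ylim[of s] that isCont_tendsto_compose by auto
      with l show "(\<lambda>n. indicator {a..b} s *\<^sub>R (f' (y n s) \<bullet> h n s))
         \<longlonglongrightarrow> indicator {a..b} s *\<^sub>R (f' (x s) \<bullet> v s)"
        by (auto simp: indicator_def intro!: tendsto_intros)
    qed
    fix n
    show "AE s in lborel. norm (indicator {a..b} s *\<^sub>R (f' (y n s) \<bullet> h n s)) \<le> indicator {a..b} s * (D * C)"
    proof (rule AE_I2)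
      fix s
      have "\<bar>f' (y n s) \<bullet> h n s\<bar> \<le> D * C" if "a \<le> s" "s \<le> b"
        using mult_mono[OF D[OF ybd[OF that, of n]] h(2)[of n s]] Cauchy_Schwarz_ineq2[of "f' (y n s)" "h n s"]
          D[OF ybd[OF that, of n]] norm_ge_zero[of "f' (y n s)"] by (smt (verit) norm_ge_zero)
      then show "norm (indicator {a..b} s *\<^sub>R (f' (y n s) \<bullet> h n s)) \<le> indicator {a..b} s * (D * C)"
        by (simp add: indicator_def)
    qed
  qed
  moreover have "(\<lambda>n. f (y n b) - f (y n a)) \<longlonglongrightarrow> f (x b) - f (x a)"
  proof -
    have "isCont f z" for z using f has_derivative_continuous by blast
    then show ?thesis
      using ylim[of a] ylim[of b] \<open>a \<le> b\<close> by (intro tendsto_diff isCont_tendsto_compose[of _ f]) auto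
  qed
  ultimately show ?thesis unfolding FTC using LIMSEQ_unique by blast
qed

text \<open>The chain rule for the curve (x, t, w) in three dimensions and the function h(x, t) w.
  The weight w will be one of \<open>p\<close>, \<open>q\<close>, \<open>P\<close>,
  \<open>Q\<close>; its derivative supplies the source terms of the integral identities.\<close>

lemma chain_rule_primitive_weighted:
  fixes h hx ht :: "real \<times> real \<Rightarrow> real" and x t w x' t' w' :: "real \<Rightarrow> real"
  assumes h: "\<And>z. (h has_derivative (\<lambda>v. hx z * fst v + ht z * snd v)) (at z)"
    and c: "continuous_on UNIV hx" "continuous_on UNIV ht"
    and [measurable]: "x' \<in> borel_measurable borel" "t' \<in> borel_measurable borel"
      "w' \<in> borel_measurable borel"
    and bd: "\<And>s. a \<le> s \<Longrightarrow> s \<le> b \<Longrightarrow> \<bar>x' s\<bar> \<le> C" "\<And>s. a \<le> s \<Longrightarrow> s \<le> b \<Longrightarrow> \<bar>t' s\<bar> \<le> C"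
      "\<And>s. a \<le> s \<Longrightarrow> s \<le> b \<Longrightarrow> \<bar>w' s\<bar> \<le> C" and "a \<le> b"
    and x: "\<And>s. a \<le> s \<Longrightarrow> s \<le> b \<Longrightarrow> x s = x a + (LINT y:{a..s}|lborel. x' y)"
    and t: "\<And>s. a \<le> s \<Longrightarrow> s \<le> b \<Longrightarrow> t s = t a + (LINT y:{a..s}|lborel. t' y)"
    and w: "\<And>s. a \<le> s \<Longrightarrow> s \<le> b \<Longrightarrow> w s = w a + (LINT y:{a..s}|lborel. w' y)"
  shows "(LINT s:{a..b}|lborel. (hx (x s, t s) * x' s + ht (x s, t s) * t' s) * w s + h (x s, t s) * w' s)
    = h (x b, t b) * w b - h (x a, t a) * w a"
proof -
  let ?f = "\<lambda>z::real \<times> real \<times> real. h (fst z, fst (snd z)) * snd (snd z)"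
  let ?f' = "\<lambda>z::real \<times> real \<times> real. (hx (fst z, fst (snd z)) * snd (snd z),
     ht (fst z, fst (snd z)) * snd (snd z), h (fst z, fst (snd z)))"
  let ?v = "\<lambda>s. (x' s, t' s, w' s)"
  have hc: "continuous_on UNIV h"
    using h by (meson continuous_at_imp_continuous_on has_derivative_continuous)
  have "(LINT s:{a..b}|lborel. ?f' (x s, t s, w s) \<bullet> ?v s) = ?f (x b, t b, w b) - ?f (x a, t a, w a)"
  proof (rule chain_rule_primitive[where C="C + (C + C)" and ?x0.0="(x a, t a, w a)"])
    fix z :: "real \<times> real \<times> real"
    have "((\<lambda>z. h (fst z, fst (snd z))) has_derivative
       (\<lambda>v. hx (fst z, fst (snd z)) * fst (fst v, fst (snd v)) + ht (fst z, fst (snd z)) * snd (fst v, fst (snd v)))) (at z)"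
      by (rule has_derivative_compose[OF _ h]) (auto intro!: derivative_eq_intros)
    then show "(?f has_derivative (\<lambda>v. ?f' z \<bullet> v)) (at z)"
      by (auto intro!: derivative_eq_intros simp: inner_prod_def algebra_simps)
    show "continuous_on UNIV ?f'"
      by (intro continuous_intros continuous_on_compose2[OF hc] continuous_on_compose2[OF c(1)]
          continuous_on_compose2[OF c(2)]) auto
    show "?v \<in> borel_measurable borel" by measurable
    show nv: "norm (?v s) \<le> C + (C + C)" if "a \<le> s" "s \<le> b" for s
      using bd[OF that] norm_Pair_le[of "x' s" "(t' s, w' s)"] norm_Pair_le[of "t' s" "w' s"] by simp
    show "(x s, t s, w s) = (x a, t a, w a) + (LINT y:{a..s}|lborel. ?v y)" if s: "a \<le> s" "s \<le> b" for s
    proof -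
      have i: "integrable lborel (\<lambda>y. indicator {a..s} y *\<^sub>R ?v y)"
        using s nv by (intro set_integrable_bounded_Icc[where C="C + (C + C)", unfolded set_integrable_def]) auto
      have i': "integrable lborel (\<lambda>y. snd (indicator {a..s} y *\<^sub>R ?v y))"
        by (rule integrable_bounded_linear[OF bounded_linear_snd i])
      have "fst (LINT y:{a..s}|lborel. ?v y) = (LINT y:{a..s}|lborel. x' y)"
        "snd (LINT y:{a..s}|lborel. ?v y) = (LINT y|lborel. snd (indicator {a..s} y *\<^sub>R ?v y))"
        "fst (LINT y|lborel. snd (indicator {a..s} y *\<^sub>R ?v y)) = (LINT y:{a..s}|lborel. t' y)"
        "snd (LINT y|lborel. snd (indicator {a..s} y *\<^sub>R ?v y)) = (LINT y:{a..s}|lborel. w' y)"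
        unfolding set_lebesgue_integral_def
          integral_bounded_linear[OF bounded_linear_fst i, symmetric]
          integral_bounded_linear[OF bounded_linear_snd i, symmetric]
          integral_bounded_linear[OF bounded_linear_fst i', symmetric]
          integral_bounded_linear[OF bounded_linear_snd i', symmetric] by simp_all
      then have "(LINT y:{a..s}|lborel. ?v y) =
          (LINT y:{a..s}|lborel. x' y, LINT y:{a..s}|lborel. t' y, LINT y:{a..s}|lborel. w' y)"
        by (simp add: prod_eq_iff)
      then show ?thesis using x[OF s] t[OF s] w[OF s] by simp
    qed
  qed fact
  then show ?thesis
    by (simp add: inner_prod_def algebra_simps)
qed

subsection \<open>The Goursat problem\<close>

lemma set_integrable_bounded_set:
  fixes f :: "'a::euclidean_space \<Rightarrow> 'b::euclidean_space"
  assumes [measurable]: "f \<in> borel_measurable borel" "A \<in> sets borel" and "bounded A"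
    and b: "\<And>s. s \<in> A \<Longrightarrow> norm (f s) \<le> C"
  shows "set_integrable lborel A f"
  unfolding set_integrable_def
proof (rule integrableI_bounded_set_indicator[where B=C])
  show "emeasure lborel A < \<infinity>"
    using \<open>bounded A\<close> emeasure_bounded_finite by auto
qed (auto intro!: AE_I2 b simp: indicator_def)

lemma set_integral_tendsto_indicator:
  fixes f :: "'a::euclidean_space \<Rightarrow> real"
  assumes [measurable]: "f \<in> borel_measurable borel" "\<And>n. A n \<in> sets borel" "B \<in> sets borel"
    and K: "bounded K" "\<And>n. A n \<subseteq> K" "K \<in> sets borel" and b: "\<And>s. s \<in> K \<Longrightarrow> norm (f s) \<le> C"
    and lim: "AE z in lborel. \<forall>\<^sub>F n in sequentially. z \<in> A n \<longleftrightarrow> z \<in> B"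
  shows "(\<lambda>n. LINT z:A n|lborel. f z) \<longlonglongrightarrow> (LINT z:B|lborel. f z)"
  unfolding set_lebesgue_integral_def
proof (rule integral_dominated_convergence[where w="\<lambda>z. indicator K z *\<^sub>R \<bar>C\<bar>"])
  show "integrable lborel (\<lambda>z. indicator K z *\<^sub>R \<bar>C\<bar>)"
    using set_integrable_bounded_set[of "\<lambda>_. \<bar>C\<bar>" K "\<bar>C\<bar>"] K by (simp add: set_integrable_def)
  show "AE z in lborel. (\<lambda>n. indicator (A n) z *\<^sub>R f z) \<longlonglongrightarrow> indicator B z *\<^sub>R f z"
    using lim
  proof eventually_elim
    fix z assume "\<forall>\<^sub>F n in sequentially. z \<in> A n \<longleftrightarrow> z \<in> B"
    then show "(\<lambda>n. indicator (A n) z *\<^sub>R f z) \<longlonglongrightarrow> indicator B z *\<^sub>R f z"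
      by (intro tendsto_eventually) (auto elim!: eventually_mono simp: indicator_def)
  qed
  show "AE z in lborel. norm (indicator (A n) z *\<^sub>R f z) \<le> indicator K z *\<^sub>R \<bar>C\<bar>" for n
    using K(2)[of n] b by (intro AE_I2) (fastforce simp: indicator_def)
qed measurable

text \<open>The domain of dependence of the point with feet \<xi> and \<eta>, drawn in
  characteristic coordinates: the side on the diagonal is the piece of the initial line between the
  two feet.\<close>

definition tri :: "real \<Rightarrow> real \<Rightarrow> (real \<times> real) set" where
  "tri \<xi> \<eta> = {z. \<eta> \<le> snd z \<and> snd z \<le> fst z \<and> fst z \<le> \<xi>}"

lemma tri_borel [measurable]: "tri \<xi> \<eta> \<in> sets borel"
proof -
  have "closed (tri \<xi> \<eta>)"
    unfolding tri_def by (intro closed_Collect_conj closed_Collect_le continuous_intros)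
  then show ?thesis by simp
qed

lemma tri_subset: "tri \<xi> \<eta> \<subseteq> {\<eta>..\<xi>} \<times> {\<eta>..\<xi>}"
  by (auto simp: tri_def)

lemma bounded_tri [simp]: "bounded (tri \<xi> \<eta>)"
  by (rule bounded_subset[OF _ tri_subset]) (simp add: bounded_Times)

lemma AE_lborel_fst_snd_neq: "AE z in (lborel :: (real \<times> real) measure). fst z \<noteq> x \<and> snd z \<noteq> y"
proof -
  have "negligible ({z. (1, 0) \<bullet> z = x} \<union> {z::real \<times> real. (0, 1) \<bullet> z = y})"
    by (intro negligible_Un negligible_hyperplane) (auto simp: zero_prod_def)
  then have "AE z in lebesgue. z \<notin> {z. (1, 0) \<bullet> z = x} \<union> {z::real \<times> real. (0, 1) \<bullet> z = y}"
    by (intro AE_not_in) (simp add: negligible_iff_null_sets)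
  then show ?thesis by (simp add: AE_completion_iff inner_prod_def)
qed

lemma eventually_le_iff:
  fixes x :: real
  assumes "X \<longlonglongrightarrow> x" "s \<noteq> x"
  shows "\<forall>\<^sub>F n in sequentially. s \<le> X n \<longleftrightarrow> s \<le> x" "\<forall>\<^sub>F n in sequentially. X n \<le> s \<longleftrightarrow> x \<le> s"
proof -
  have "(\<forall>\<^sub>F n in sequentially. s \<le> X n \<longleftrightarrow> s \<le> x) \<and> (\<forall>\<^sub>F n in sequentially. X n \<le> s \<longleftrightarrow> x \<le> s)"
  proof (cases "s < x")
    case True
    from order_tendstoD(1)[OF assms(1) this] True show ?thesis
      by (auto elim: eventually_mono)
  next
    case False
    then have "x < s" using assms(2) by simp
    from order_tendstoD(2)[OF assms(1) this] this show ?thesis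
      by (auto elim: eventually_mono)
  qed
  then show "\<forall>\<^sub>F n in sequentially. s \<le> X n \<longleftrightarrow> s \<le> x" "\<forall>\<^sub>F n in sequentially. X n \<le> s \<longleftrightarrow> x \<le> s"
    by auto
qed

lemma convergent_pair_bounded:
  fixes X :: "nat \<Rightarrow> real \<times> real"
  assumes "X \<longlonglongrightarrow> x"
  obtains B where "\<And>n. \<bar>fst (X n)\<bar> \<le> B" "\<And>n. \<bar>snd (X n)\<bar> \<le> B"
proof -
  obtain B where "\<And>n. norm (X n) \<le> B"
    using convergent_imp_bounded[OF assms] unfolding bounded_iff by auto
  then have "\<bar>fst (X n)\<bar> \<le> B" "\<bar>snd (X n)\<bar> \<le> B" for n
    using norm_fst_le[of "fst (X n)" "snd (X n)"] norm_snd_le[of "snd (X n)" "fst (X n)"]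
    by (auto intro: order_trans)
  then show thesis using that by blast
qed

text \<open>Only the two sides through the corner move with it, and they lie on null lines, so the
  indicators of the triangles converge almost everywhere.\<close>

lemma continuous_tri_integral:
  fixes f :: "real \<times> real \<Rightarrow> real"
  assumes f: "f \<in> borel_measurable borel" and b: "\<And>K. compact K \<Longrightarrow> \<exists>C. \<forall>z\<in>K. \<bar>f z\<bar> \<le> C"
  shows "continuous_on UNIV (\<lambda>x. LINT z:tri (fst x) (snd x)|lborel. f z)"
  unfolding continuous_on_sequentially comp_def
proof (intro allI ballI impI, elim conjE)
  fix X :: "nat \<Rightarrow> real \<times> real" and x assume X: "X \<longlonglongrightarrow> x"
  obtain B where BB: "\<And>n. \<bar>fst (X n)\<bar> \<le> B" "\<And>n. \<bar>snd (X n)\<bar> \<le> B"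
    using convergent_pair_bounded[OF X] by blast
  let ?K = "{-B..B} \<times> {-B..B}"
  obtain C where C: "\<And>z. z \<in> ?K \<Longrightarrow> \<bar>f z\<bar> \<le> C"
    using b[of ?K] by (auto simp: compact_Times)
  show "(\<lambda>n. LINT z:tri (fst (X n)) (snd (X n))|lborel. f z) \<longlonglongrightarrow> (LINT z:tri (fst x) (snd x)|lborel. f z)"
  proof (rule set_integral_tendsto_indicator[where K="?K" and C=C])
    show "tri (fst (X n)) (snd (X n)) \<subseteq> ?K" for n
      using BB[of n] by (auto simp: tri_def)
    show "AE z in lborel. \<forall>\<^sub>F n in sequentially. z \<in> tri (fst (X n)) (snd (X n)) \<longleftrightarrow> z \<in> tri (fst x) (snd x)"
      using AE_lborel_fst_snd_neq[of "fst x" "snd x"]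
    proof eventually_elim
      fix z assume z: "fst z \<noteq> fst x \<and> snd z \<noteq> snd x"
      have "\<forall>\<^sub>F n in sequentially. fst z \<le> fst (X n) \<longleftrightarrow> fst z \<le> fst x"
        by (rule eventually_le_iff) (use z X in \<open>auto intro: tendsto_fst\<close>)
      moreover have "\<forall>\<^sub>F n in sequentially. snd (X n) \<le> snd z \<longleftrightarrow> snd x \<le> snd z"
        by (rule eventually_le_iff) (use z X in \<open>auto intro: tendsto_snd\<close>)
      ultimately show "\<forall>\<^sub>F n in sequentially. z \<in> tri (fst (X n)) (snd (X n)) \<longleftrightarrow> z \<in> tri (fst x) (snd x)"
        by eventually_elim (auto simp: tri_def)
    qed
  qed (use f C in \<open>auto intro: bounded_Times borel_closed closed_Times\<close>)
qed

lemma continuous_Icc_integral: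
  fixes f :: "real \<Rightarrow> real"
  assumes f: "f \<in> borel_measurable borel" and b: "\<And>z. \<bar>f z\<bar> \<le> C"
  shows "continuous_on UNIV (\<lambda>x. LINT z:{snd x..fst x}|lborel. f z)"
  unfolding continuous_on_sequentially comp_def
proof (intro allI ballI impI, elim conjE)
  fix X :: "nat \<Rightarrow> real \<times> real" and x assume X: "X \<longlonglongrightarrow> x"
  obtain B where BB: "\<And>n. \<bar>fst (X n)\<bar> \<le> B" "\<And>n. \<bar>snd (X n)\<bar> \<le> B"
    using convergent_pair_bounded[OF X] by blast
  show "(\<lambda>n. LINT z:{snd (X n)..fst (X n)}|lborel. f z) \<longlonglongrightarrow> (LINT z:{snd x..fst x}|lborel. f z)"
  proof (rule set_integral_tendsto_indicator[where K="{-B..B}" and C=C])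
    show "{snd (X n)..fst (X n)} \<subseteq> {-B..B}" for n
      using BB[of n] by auto
    have "AE z in lborel. z \<noteq> fst x \<and> z \<noteq> snd x"
      using AE_lborel_singleton[of "fst x"] AE_lborel_singleton[of "snd x"] by eventually_elim auto
    then show "AE z in lborel. \<forall>\<^sub>F n in sequentially. z \<in> {snd (X n)..fst (X n)} \<longleftrightarrow> z \<in> {snd x..fst x}"
    proof eventually_elim
      fix z assume z: "z \<noteq> fst x \<and> z \<noteq> snd x"
      have "\<forall>\<^sub>F n in sequentially. z \<le> fst (X n) \<longleftrightarrow> z \<le> fst x"
        by (rule eventually_le_iff) (use z X in \<open>auto intro: tendsto_fst\<close>)
      moreover have "\<forall>\<^sub>F n in sequentially. snd (X n) \<le> z \<longleftrightarrow> snd x \<le> z"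
        by (rule eventually_le_iff) (use z X in \<open>auto intro: tendsto_snd\<close>)
      ultimately show "\<forall>\<^sub>F n in sequentially. z \<in> {snd (X n)..fst (X n)} \<longleftrightarrow> z \<in> {snd x..fst x}"
        by eventually_elim auto
    qed
  qed (use f b in auto)
qed

text \<open>On the enclosing square the exponential factors into two one-dimensional integrals, each
  of which contributes 1/l. The \<open>max\<close> covers \<xi> < \<eta>, where the triangle is
  empty.\<close>

lemma tri_integral_exp_le:
  assumes "l > 0"
  shows "(LINT z:tri \<xi> \<eta>|lborel. exp (l * (fst z - snd z))) \<le> exp (l * max 0 (\<xi> - \<eta>)) / l\<^sup>2"
proof (cases "\<eta> \<le> \<xi>")
  case False
  then have "tri \<xi> \<eta> = {}" by (auto simp: tri_def)
  then show ?thesis by (simp add: set_lebesgue_integral_def)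
next
  case True
  let ?Q = "{\<eta>..\<xi>} \<times> {\<eta>..\<xi>}"
  have m: "(\<lambda>z. exp (l * (fst z - snd z))) \<in> borel_measurable (borel :: (real \<times> real) measure)"
    by (intro borel_measurable_continuous_onI continuous_intros)
  have bQ: "exp (l * (fst z - snd z)) \<le> exp (l * (\<xi> - \<eta>))" if "z \<in> ?Q" for z :: "real \<times> real"
    using that assms by auto
  have iQ: "set_integrable lborel ?Q (\<lambda>z. exp (l * (fst z - snd z)))"
    by (rule set_integrable_bounded_set[OF m]) (use bQ in \<open>auto intro: bounded_Times borel_closed closed_Times\<close>)
  have iT: "set_integrable lborel (tri \<xi> \<eta>) (\<lambda>z. exp (l * (fst z - snd z)))"
    by (rule set_integrable_subset[OF iQ _ tri_subset]) simp
  have "(LINT z:tri \<xi> \<eta>|lborel. exp (l * (fst z - snd z))) \<le> (LINT z:?Q|lborel. exp (l * (fst z - snd z)))"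
    unfolding set_lebesgue_integral_def
    using iT iQ tri_subset[of \<xi> \<eta>] unfolding set_integrable_def
    by (intro integral_mono) (auto simp: indicator_def)
  also have "\<dots> = (LINT z|(lborel \<Otimes>\<^sub>M lborel). (indicator {\<eta>..\<xi>} (fst z) * exp (l * fst z)) * (indicator {\<eta>..\<xi>} (snd z) * exp (- l * snd z)))"
    unfolding set_lebesgue_integral_def lborel_prod
    by (rule Bochner_Integration.integral_cong) (auto simp: indicator_def exp_add[symmetric] algebra_simps)
  also have "\<dots> = (LINT x|lborel. LINT y|lborel. (indicator {\<eta>..\<xi>} x * exp (l * x)) * (indicator {\<eta>..\<xi>} y * exp (- l * y)))"
  proof (subst lborel_pair.integral_fst'[symmetric])
    show "integrable (lborel \<Otimes>\<^sub>M lborel) (\<lambda>z. (indicator {\<eta>..\<xi>} (fst z) * exp (l * fst z)) * (indicator {\<eta>..\<xi>} (snd z) * exp (- l * snd z)))"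
      using iQ unfolding set_integrable_def lborel_prod
      by (rule Bochner_Integration.integrable_cong[THEN iffD1, rotated -1]) (auto simp: indicator_def exp_add[symmetric] algebra_simps)
  qed simp
  also have "\<dots> = (LINT x|lborel. exp (l * x) * indicator {\<eta>..\<xi>} x) * (LINT y|lborel. exp (- l * y) * indicator {\<eta>..\<xi>} y)"
    by (simp add: mult.commute)
  also have "(LINT x|lborel. exp (l * x) * indicator {\<eta>..\<xi>} x) = exp (l * \<xi>) / l - exp (l * \<eta>) / l"
    using True assms by (intro integral_FTC_Icc_real) (auto intro!: derivative_eq_intros continuous_intros)
  also have "(LINT y|lborel. exp (- l * y) * indicator {\<eta>..\<xi>} y) = - exp (- l * \<xi>) / l - (- exp (- l * \<eta>) / l)"
    using True assms by (intro integral_FTC_Icc_real) (auto intro!: derivative_eq_intros continuous_intros)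
  also have "(exp (l * \<xi>) / l - exp (l * \<eta>) / l) * (- exp (- l * \<xi>) / l - (- exp (- l * \<eta>) / l))
      \<le> (exp (l * \<xi>) / l) * (exp (- l * \<eta>) / l)"
    using True assms by (intro mult_mono) (auto simp: divide_le_cancel)
  also have "\<dots> = exp (l * max 0 (\<xi> - \<eta>)) / l\<^sup>2"
    using True by (simp add: exp_add[symmetric] exp_minus[symmetric] power2_eq_square right_diff_distrib exp_diff field_simps)
  finally show ?thesis .
qed

text \<open>Picard iteration in a sup norm with an exponential weight in \<xi> - \<eta>. A large
  exponent makes the integral operator a contraction on the whole plane at once, which avoids
  continuation in time.\<close>

lemma goursat_solution_exists:
  fixes T0 k :: "real \<times> real \<Rightarrow> real" and b :: "real \<Rightarrow> real"
  assumes T0: "continuous_on UNIV T0"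
    and k [measurable]: "k \<in> borel_measurable borel" and k1: "\<And>z. \<bar>k z\<bar> \<le> 1"
    and b: "\<And>t. \<bar>b t\<bar> \<le> B" and Lip: "\<And>s t. \<bar>b s - b t\<bar> \<le> K * \<bar>s - t\<bar>"
  obtains T where "continuous_on UNIV T"
    "\<And>x. T x = T0 x + (LINT z:tri (fst x) (snd x)|lborel. b (T z) * k z)"
proof -
  have K0: "0 \<le> K" using Lip[of 0 1] by simp
  have "K-lipschitz_on UNIV b"
    by (rule lipschitz_onI) (use Lip K0 in \<open>auto simp: dist_real_def\<close>)
  then have bc: "continuous_on UNIV b" by (rule lipschitz_on_continuous_on)
  then have [measurable]: "b \<in> borel_measurable borel" by (rule borel_measurable_continuous_onI)
  have B0: "0 \<le> B" using b[of 0] by simp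
  \<comment> \<open>The double integral over the triangle gains \<open>1 / l\<^sup>2\<close>, so the
    contraction constant is \<open>K / l\<^sup>2\<close>; it is at most 1/2 because 2 K \<le> (1 + 2
    K)^2.\<close>
  define l where "l = 1 + 2 * K"
  have l: "l > 0" "K / l\<^sup>2 \<le> 1 / 2"
  proof -
    show "l > 0" using K0 by (simp add: l_def)
    then have "l\<^sup>2 > 0" by simp
    moreover have "2 * K \<le> l\<^sup>2" using K0 by (simp add: l_def power2_eq_square algebra_simps)
    ultimately show "K / l\<^sup>2 \<le> 1 / 2" by (simp add: pos_divide_le_eq)
  qed
  define wt where "wt x = exp (l * max 0 (fst x - snd x))" for x :: "real \<times> real"
  have wt: "wt x > 0" "continuous_on UNIV wt" for x
    by (auto simp: wt_def[abs_def] intro!: continuous_intros)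
  \<comment> \<open>\<open>T0\<close> may be unbounded even after weighting, so the fixed point is
    sought for the weighted deviation (T - T0) / wt, which is a bounded continuous function.\<close>
  define U where "U \<sigma> x = T0 x + wt x * apply_bcontfun \<sigma> x" for \<sigma> x
  have Uc: "continuous_on UNIV (U \<sigma>)" for \<sigma>
    unfolding U_def[abs_def] by (intro continuous_intros continuous_on_apply_bcontfun T0 wt)
  have [measurable]: "U \<sigma> \<in> borel_measurable borel" for \<sigma>
    by (rule borel_measurable_continuous_onI[OF Uc])
  define F where "F \<sigma> x = (LINT z:tri (fst x) (snd x)|lborel. b (U \<sigma> z) * k z)" for \<sigma> x
  have bk: "\<bar>b (U \<sigma> z) * k z\<bar> \<le> B" for \<sigma> z
    using mult_mono[OF b k1] B0 by (simp add: abs_mult)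
  have Fc: "continuous_on UNIV (F \<sigma>)" for \<sigma>
    unfolding F_def[abs_def]
  proof (rule continuous_tri_integral)
    show "(\<lambda>z. b (U \<sigma> z) * k z) \<in> borel_measurable borel" by measurable
    show "\<exists>C. \<forall>z\<in>K. \<bar>b (U \<sigma> z) * k z\<bar> \<le> C" for K using bk by blast
  qed
  have iF: "set_integrable lborel (tri \<xi> \<eta>) (\<lambda>z. b (U \<sigma> z) * k z)" for \<sigma> \<xi> \<eta>
    by (rule set_integrable_bounded_set[where C=B]) (use bk in auto)
  have ie: "set_integrable lborel (tri \<xi> \<eta>) (\<lambda>z. D * exp (l * (fst z - snd z)))" for D \<xi> \<eta>
  proof (rule set_integrable_bounded_set[where C="\<bar>D\<bar> * exp (l * (\<xi> - \<eta>))"])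
    show "(\<lambda>z. D * exp (l * (fst z - snd z))) \<in> borel_measurable borel"
      by (intro borel_measurable_continuous_onI continuous_intros)
    show "norm (D * exp (l * (fst z - snd z))) \<le> \<bar>D\<bar> * exp (l * (\<xi> - \<eta>))" if "z \<in> tri \<xi> \<eta>" for z
      using that l(1) by (auto simp: abs_mult tri_def intro!: mult_left_mono)
  qed auto
  have est: "\<bar>LINT z:tri (fst x) (snd x)|lborel. f z\<bar> \<le> D / l\<^sup>2 * wt x"
    if f: "set_integrable lborel (tri (fst x) (snd x)) f" and D: "D \<ge> 0"
      "\<And>z. z \<in> tri (fst x) (snd x) \<Longrightarrow> \<bar>f z\<bar> \<le> D * exp (l * (fst z - snd z))" for f x D
  proof -
    have "\<bar>LINT z:tri (fst x) (snd x)|lborel. f z\<bar> \<le> (LINT z:tri (fst x) (snd x)|lborel. D * exp (l * (fst z - snd z)))"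
      unfolding set_lebesgue_integral_def real_norm_def[symmetric]
      by (rule Bochner_Integration.integral_norm_bound_integral)
        (use f ie[of "fst x" "snd x" D] D in \<open>auto simp: set_integrable_def indicator_def\<close>)
    also have "\<dots> = D * (LINT z:tri (fst x) (snd x)|lborel. exp (l * (fst z - snd z)))"
      by simp
    also have "\<dots> \<le> D * (wt x / l\<^sup>2)"
      unfolding wt_def by (intro mult_left_mono tri_integral_exp_le l D)
    finally show ?thesis by simp
  qed
  define \<Phi> where "\<Phi> \<sigma> = Bcontfun (\<lambda>x. F \<sigma> x / wt x)" for \<sigma>
  have "\<bar>F \<sigma> x / wt x\<bar> \<le> B / l\<^sup>2" for \<sigma> x
  proof -
    have "\<bar>F \<sigma> x\<bar> \<le> B / l\<^sup>2 * wt x"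
      unfolding F_def
    proof (rule est[OF iF B0])
      fix z assume "z \<in> tri (fst x) (snd x)"
      then have "1 \<le> exp (l * (fst z - snd z))" using l(1) by (auto simp: tri_def)
      then have "B \<le> B * exp (l * (fst z - snd z))" using B0 by (simp add: mult_left_le[of _ B] mult_le_cancel_left1)
      then show "\<bar>b (U \<sigma> z) * k z\<bar> \<le> B * exp (l * (fst z - snd z))"
        using bk[of \<sigma> z] by linarith
    qed
    then show ?thesis using wt(1)[of x] by (simp add: abs_of_pos pos_divide_le_eq)
  qed
  then have "(\<lambda>x. F \<sigma> x / wt x) \<in> bcontfun" for \<sigma>
    using wt(1) by (intro bcontfun_normI[where b="B / l\<^sup>2"] continuous_intros Fc wt) (auto simp: less_le)
  then have ap: "apply_bcontfun (\<Phi> \<sigma>) x = F \<sigma> x / wt x" for \<sigma> x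
    unfolding \<Phi>_def by (simp add: Bcontfun_inverse)
  have "dist (\<Phi> \<sigma>) (\<Phi> \<tau>) \<le> 1 / 2 * dist \<sigma> \<tau>" for \<sigma> \<tau>
  proof (rule dist_bound)
    fix x
    have "F \<sigma> x - F \<tau> x = (LINT z:tri (fst x) (snd x)|lborel. b (U \<sigma> z) * k z - b (U \<tau> z) * k z)"
      unfolding F_def by (rule set_integral_diff(2)[symmetric]; rule iF)
    also have "\<bar>\<dots>\<bar> \<le> K * dist \<sigma> \<tau> / l\<^sup>2 * wt x"
    proof (rule est)
      show "set_integrable lborel (tri (fst x) (snd x)) (\<lambda>z. b (U \<sigma> z) * k z - b (U \<tau> z) * k z)"
        by (rule set_integral_diff(1); rule iF)
      fix z assume z: "z \<in> tri (fst x) (snd x)"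
      have "\<bar>U \<sigma> z - U \<tau> z\<bar> = wt z * \<bar>apply_bcontfun \<sigma> z - apply_bcontfun \<tau> z\<bar>"
        using wt(1)[of z] by (simp add: U_def right_diff_distrib[symmetric] abs_mult)
      also have "\<dots> \<le> wt z * dist \<sigma> \<tau>"
        using dist_bounded[of \<sigma> z \<tau>] wt(1)[of z] by (intro mult_left_mono) (auto simp: dist_real_def)
      also have "wt z = exp (l * (fst z - snd z))"
        using z by (auto simp: wt_def tri_def max_def)
      finally have u: "K * \<bar>U \<sigma> z - U \<tau> z\<bar> \<le> K * (exp (l * (fst z - snd z)) * dist \<sigma> \<tau>)"
        using K0 by (rule mult_left_mono)
      have "\<bar>b (U \<sigma> z) * k z - b (U \<tau> z) * k z\<bar> = \<bar>b (U \<sigma> z) - b (U \<tau> z)\<bar> * \<bar>k z\<bar>"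
        by (simp add: left_diff_distrib[symmetric] abs_mult)
      also have "\<dots> \<le> \<bar>b (U \<sigma> z) - b (U \<tau> z)\<bar>"
        using k1[of z] by (simp add: mult_left_le)
      also have "\<dots> \<le> K * \<bar>U \<sigma> z - U \<tau> z\<bar>" by (rule Lip)
      also note u
      finally show "\<bar>b (U \<sigma> z) * k z - b (U \<tau> z) * k z\<bar> \<le> K * dist \<sigma> \<tau> * exp (l * (fst z - snd z))"
        by (simp only: ac_simps)
    qed (use K0 in auto)
    also have "\<dots> = (K / l\<^sup>2) * (dist \<sigma> \<tau> * wt x)" by simp
    also have "\<dots> \<le> 1 / 2 * (dist \<sigma> \<tau> * wt x)"
      using wt(1)[of x] by (intro mult_right_mono l) auto
    finally have "\<bar>F \<sigma> x - F \<tau> x\<bar> / wt x \<le> 1 / 2 * dist \<sigma> \<tau>"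
      using wt(1)[of x] by (simp add: pos_divide_le_eq)
    then show "dist (apply_bcontfun (\<Phi> \<sigma>) x) (apply_bcontfun (\<Phi> \<tau>) x) \<le> 1 / 2 * dist \<sigma> \<tau>"
      using wt(1)[of x] by (simp add: ap dist_real_def diff_divide_distrib[symmetric] abs_of_pos)
  qed
  then have "\<exists>!\<sigma>. \<Phi> \<sigma> = \<sigma>"
    by (intro banach_fix_type[where c="1/2"]) auto
  then obtain \<sigma> where s: "\<Phi> \<sigma> = \<sigma>" by blast
  show thesis
  proof (rule that[of "U \<sigma>"])
    fix x
    show "U \<sigma> x = T0 x + (LINT z:tri (fst x) (snd x)|lborel. b (U \<sigma> z) * k z)"
      using ap[of \<sigma> x] wt(1)[of x] unfolding s F_def[symmetric] by (simp add: U_def)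
  qed (rule Uc)
qed

section \<open>Iterated integrals over the triangle\<close>

lemma set_integral_singleton [simp]: "(LINT s:{a::real}|lborel. f s) = 0"
  unfolding set_lebesgue_integral_def
proof (rule integral_eq_zero_AE)
  show "AE s in lborel. indicator {a} s *\<^sub>R f s = 0"
    using AE_lborel_singleton[of a] by eventually_elim auto
qed

lemma tri_integral_iterated:
  fixes f :: "real \<times> real \<Rightarrow> real"
  assumes f: "f \<in> borel_measurable borel" and B: "\<And>z. z \<in> tri \<xi> \<eta> \<Longrightarrow> \<bar>f z\<bar> \<le> B"
  shows "(LINT z:tri \<xi> \<eta>|lborel. f z) = (LINT s:{\<eta>..\<xi>}|lborel. LINT u:{\<eta>..s}|lborel. f (s, u))" (is ?t1)
    and "(LINT z:tri \<xi> \<eta>|lborel. f z) = (LINT u:{\<eta>..\<xi>}|lborel. LINT s:{u..\<xi>}|lborel. f (s, u))" (is ?t2)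
proof -
  have int: "integrable (lborel \<Otimes>\<^sub>M lborel) (\<lambda>z. indicator (tri \<xi> \<eta>) z *\<^sub>R f z)"
    using set_integrable_bounded_set[of f "tri \<xi> \<eta>" B] f B by (simp add: set_integrable_def lborel_prod)
  have "(LINT z:tri \<xi> \<eta>|lborel. f z) = (LINT s|lborel. LINT u|lborel. indicator (tri \<xi> \<eta>) (s, u) *\<^sub>R f (s, u))"
    unfolding set_lebesgue_integral_def lborel_prod[symmetric]
    by (rule lborel_pair.integral_fst'[OF int, symmetric])
  also have "\<dots> = (LINT s:{\<eta>..\<xi>}|lborel. LINT u:{\<eta>..s}|lborel. f (s, u))"
  proof -
    have "(LINT u|lborel. indicator (tri \<xi> \<eta>) (s, u) *\<^sub>R f (s, u)) =
        indicator {\<eta>..\<xi>} s *\<^sub>R (LINT u|lborel. indicator {\<eta>..s} u *\<^sub>R f (s, u))" for s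
    proof -
      have "(\<lambda>u. indicator (tri \<xi> \<eta>) (s, u) *\<^sub>R f (s, u)) =
          (\<lambda>u. indicator {\<eta>..\<xi>} s *\<^sub>R (indicator {\<eta>..s} u *\<^sub>R f (s, u)))"
        by (auto simp: tri_def indicator_def)
      then show ?thesis by (simp only: integral_scaleR_right)
    qed
    then show ?thesis unfolding set_lebesgue_integral_def by simp
  qed
  finally show ?t1 .
  have int': "integrable (lborel \<Otimes>\<^sub>M lborel) (\<lambda>(s, u). indicator (tri \<xi> \<eta>) (s, u) *\<^sub>R f (s, u))"
    using int by (simp add: case_prod_beta')
  have "(LINT z:tri \<xi> \<eta>|lborel. f z) = (LINT u|lborel. LINT s|lborel. indicator (tri \<xi> \<eta>) (s, u) *\<^sub>R f (s, u))"
    unfolding set_lebesgue_integral_def lborel_prod[symmetric]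
    by (subst lborel_pair.integral_snd[OF int']) (simp add: case_prod_beta')
  also have "\<dots> = (LINT u:{\<eta>..\<xi>}|lborel. LINT s:{u..\<xi>}|lborel. f (s, u))"
  proof -
    have "(LINT s|lborel. indicator (tri \<xi> \<eta>) (s, u) *\<^sub>R f (s, u)) =
        indicator {\<eta>..\<xi>} u *\<^sub>R (LINT s|lborel. indicator {u..\<xi>} s *\<^sub>R f (s, u))" for u
    proof -
      have "(\<lambda>s. indicator (tri \<xi> \<eta>) (s, u) *\<^sub>R f (s, u)) =
          (\<lambda>s. indicator {\<eta>..\<xi>} u *\<^sub>R (indicator {u..\<xi>} s *\<^sub>R f (s, u)))"
        by (auto simp: tri_def indicator_def)
      then show ?thesis by (simp only: integral_scaleR_right)
    qed
    then show ?thesis unfolding set_lebesgue_integral_def by simp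
  qed
  finally show ?t2 .
qed

lemma borel_measurable_fst_snd [measurable]:
  "fst \<in> (borel :: ('a::second_countable_topology \<times> 'b::second_countable_topology) measure) \<rightarrow>\<^sub>M borel"
  "snd \<in> (borel :: ('a \<times> 'b) measure) \<rightarrow>\<^sub>M borel"
  by (intro borel_measurable_continuous_onI continuous_intros)+

lemma borel_measurable_Icc_integral:
  fixes f :: "real \<times> real \<Rightarrow> real \<Rightarrow> real"
  assumes [measurable]: "(\<lambda>w. f (fst w) (snd w)) \<in> borel_measurable borel"
  shows "(\<lambda>z. LINT s:{snd z..fst z}|lborel. f z s) \<in> borel_measurable borel"
  unfolding set_lebesgue_integral_def
proof (rule lborel.borel_measurable_lebesgue_integral)
  have eq: "(\<lambda>(x, y). indicator {snd x..fst x} y *\<^sub>R f x y) =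
     (\<lambda>w. if snd (fst w) \<le> snd w \<and> snd w \<le> fst (fst w) then f (fst w) (snd w) else 0)"
    by (auto simp: indicator_def fun_eq_iff)
  have "(\<lambda>w. if snd (fst w) \<le> snd w \<and> snd w \<le> fst (fst w) then f (fst w) (snd w) else 0)
      \<in> borel_measurable (borel :: ((real \<times> real) \<times> real) measure)"
    by measurable
  moreover have "sets (borel \<Otimes>\<^sub>M lborel) = sets (borel :: ((real \<times> real) \<times> real) measure)"
    unfolding borel_prod[symmetric] by (intro sets_pair_measure_cong) auto
  ultimately show "(\<lambda>(x, y). indicator {snd x..fst x} y *\<^sub>R f x y) \<in> borel_measurable (borel \<Otimes>\<^sub>M lborel)"
    unfolding eq by (simp cong: measurable_cong_sets)
qed

section \<open>The derivatives of time and space along the characteristics\<close>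

locale goursat =
  fixes p q r b :: "real \<Rightarrow> real" and c C :: real and T :: "real \<times> real \<Rightarrow> real"
  assumes pqrb [measurable]: "p \<in> borel_measurable borel" "q \<in> borel_measurable borel"
      "r \<in> borel_measurable borel" "b \<in> borel_measurable borel"
    and c: "0 < c" "\<And>s. c \<le> p s" "\<And>s. c \<le> q s" "\<And>s. c \<le> r s" "\<And>s. r s \<le> C" "\<And>s. p s + q s = 1"
    and b: "\<And>t. 0 \<le> b t" "\<And>t. b t \<le> C"
    and T_cont: "continuous_on UNIV T"
    and T: "\<And>\<xi> \<eta>. T (\<xi>, \<eta>) = (LINT s:{\<eta>..\<xi>}|lborel. r s)
        + (LINT z:tri \<xi> \<eta>|lborel. b (T z) * (p (fst z) * q (snd z)))"
begin

text \<open>The increments of t_\<alpha> and of -t_\<beta> from the diagonal to (\<xi>, \<eta>),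
  found by integrating t_\<alpha>\<beta> = -b. Multiplying by \<open>p\<close> and \<open>q\<close>
  passes from \<alpha>, \<beta> to the labels \<xi>, \<eta>.\<close>

definition R1 :: "real \<Rightarrow> real \<Rightarrow> real" where
  "R1 \<xi> \<eta> = (LINT s:{\<eta>..\<xi>}|lborel. b (T (\<xi>, s)) * q s)"
definition R2 :: "real \<Rightarrow> real \<Rightarrow> real" where
  "R2 \<xi> \<eta> = (LINT s:{\<eta>..\<xi>}|lborel. b (T (s, \<eta>)) * p s)"
definition P :: "real \<Rightarrow> real \<Rightarrow> real" where "P \<xi> \<eta> = r \<xi> + p \<xi> * R1 \<xi> \<eta>"
definition Q :: "real \<Rightarrow> real \<Rightarrow> real" where "Q \<xi> \<eta> = r \<eta> + q \<eta> * R2 \<xi> \<eta>"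
definition X :: "real \<Rightarrow> real \<Rightarrow> real" where "X \<xi> \<eta> = \<eta> + (LINT s:{\<eta>..\<xi>}|lborel. p s)"

lemma T_borel [measurable]: "T \<in> borel_measurable borel"
  by (rule borel_measurable_continuous_onI[OF T_cont])

lemma R1_borel [measurable]: "(\<lambda>z. R1 (fst z) (snd z)) \<in> borel_measurable borel"
  unfolding R1_def by (rule borel_measurable_Icc_integral) measurable

lemma R2_borel [measurable]: "(\<lambda>z. R2 (fst z) (snd z)) \<in> borel_measurable borel"
  unfolding R2_def by (rule borel_measurable_Icc_integral) measurable

lemma P_borel2 [measurable]: "(\<lambda>z. P (fst z) (snd z)) \<in> borel_measurable borel"
  unfolding P_def by measurable

lemma Q_borel2 [measurable]: "(\<lambda>z. Q (fst z) (snd z)) \<in> borel_measurable borel"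
  unfolding Q_def by measurable

lemma P_borel [measurable]: "(\<lambda>s. P s \<eta>) \<in> borel_measurable borel"
  using measurable_compose[OF _ P_borel2, of "\<lambda>s. (s, \<eta>)" borel] by simp

lemma Q_borel [measurable]: "(\<lambda>s. Q \<xi> s) \<in> borel_measurable borel"
  using measurable_compose[OF _ Q_borel2, of "\<lambda>s. (\<xi>, s)" borel] by simp

lemma pq1: "p s \<le> 1" "q s \<le> 1" "0 < p s" "0 < q s" "0 < r s"
  using c(1) c(2)[of s] c(3)[of s] c(4)[of s] c(6)[of s] by linarith+

lemma C_pos: "0 < C" using c(5)[of 0] pq1(5)[of 0] by linarith

lemma bp: "0 \<le> b t * p s" "b t * p s \<le> C" "0 \<le> b t * q s" "b t * q s \<le> C"
  using b[of t] pq1[of s] mult_mono[of "b t" C "p s" 1] mult_mono[of "b t" C "q s" 1] C_pos by auto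

lemma bp_abs: "\<bar>b t * p s\<bar> \<le> C" "\<bar>b t * q s\<bar> \<le> C"
  using bp by simp_all

lemma R_bounds:
  assumes "\<eta> \<le> \<xi>"
  shows "0 \<le> R1 \<xi> \<eta>" "R1 \<xi> \<eta> \<le> C * (\<xi> - \<eta>)" "0 \<le> R2 \<xi> \<eta>" "R2 \<xi> \<eta> \<le> C * (\<xi> - \<eta>)"
proof -
  show "0 \<le> R1 \<xi> \<eta>" "0 \<le> R2 \<xi> \<eta>"
    unfolding R1_def R2_def set_lebesgue_integral_def
    by (auto intro!: Bochner_Integration.integral_nonneg simp: bp)
  show "R1 \<xi> \<eta> \<le> C * (\<xi> - \<eta>)" "R2 \<xi> \<eta> \<le> C * (\<xi> - \<eta>)"
    unfolding R1_def R2_def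
    using norm_set_integral_Icc_le[of "\<lambda>s. b (T (\<xi>, s)) * q s" \<eta> \<xi> C]
      norm_set_integral_Icc_le[of "\<lambda>s. b (T (s, \<eta>)) * p s" \<eta> \<xi> C] assms bp_abs by (auto simp del: bp_abs)
qed

text \<open>The sign of \<open>b\<close> enters here: \<open>R1\<close> and \<open>R2\<close> are
  nonnegative, so \<open>P\<close> and \<open>Q\<close> never fall below their values
  \<open>r\<close> on the diagonal. This is what keeps the coordinates nondegenerate for all
  times.\<close>

lemma PQ_bounds:
  assumes "\<eta> \<le> \<xi>"
  shows "c \<le> P \<xi> \<eta>" "P \<xi> \<eta> \<le> C + C * (\<xi> - \<eta>)" "c \<le> Q \<xi> \<eta>" "Q \<xi> \<eta> \<le> C + C * (\<xi> - \<eta>)"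
proof -
  note R = R_bounds[OF assms] and P = pq1[of \<xi>] and Q = pq1[of \<eta>]
  have "0 \<le> p \<xi> * R1 \<xi> \<eta>" "p \<xi> * R1 \<xi> \<eta> \<le> C * (\<xi> - \<eta>)"
    using R P mult_mono[of "p \<xi>" 1 "R1 \<xi> \<eta>" "C * (\<xi> - \<eta>)"] by auto
  moreover have "0 \<le> q \<eta> * R2 \<xi> \<eta>" "q \<eta> * R2 \<xi> \<eta> \<le> C * (\<xi> - \<eta>)"
    using R Q mult_mono[of "q \<eta>" 1 "R2 \<xi> \<eta>" "C * (\<xi> - \<eta>)"] by auto
  ultimately show "c \<le> P \<xi> \<eta>" "P \<xi> \<eta> \<le> C + C * (\<xi> - \<eta>)" "c \<le> Q \<xi> \<eta>" "Q \<xi> \<eta> \<le> C + C * (\<xi> - \<eta>)"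
    unfolding P_def Q_def using c(4,5)[of \<xi>] c(4,5)[of \<eta>] by linarith+
qed

text \<open>Fubini on the triangle in both orders. It makes \<open>P\<close> the weak
  \<xi>-derivative and \<open>-Q\<close> the weak \<eta>-derivative of \<open>T\<close>.\<close>

lemma T_P: "T (\<xi>, \<eta>) = (LINT s:{\<eta>..\<xi>}|lborel. P s \<eta>)"
  and T_Q: "T (\<xi>, \<eta>) = (LINT s:{\<eta>..\<xi>}|lborel. Q \<xi> s)"
proof -
  let ?f = "\<lambda>z. b (T z) * (p (fst z) * q (snd z))"
  have f: "?f \<in> borel_measurable borel" by measurable
  have fb: "\<bar>?f z\<bar> \<le> C" for z
    using bp(3,4)[of "T z" "snd z"] pq1[of "fst z"]
      mult_mono[of "b (T z) * q (snd z)" C "p (fst z)" 1] C_pos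
      mult_nonneg_nonneg[of "b (T z) * q (snd z)" "p (fst z)"] by (simp add: ac_simps)
  have i: "set_integrable lborel {\<eta>..\<xi>} r"
    by (rule set_integrable_bounded_Icc[where C=C]) (use c(5) pq1(5) in \<open>auto simp: less_imp_le\<close>)
  have "(LINT z:tri \<xi> \<eta>|lborel. ?f z) = (LINT s:{\<eta>..\<xi>}|lborel. p s * R1 s \<eta>)"
    unfolding tri_integral_iterated(1)[OF f fb] R1_def
    by (simp add: set_integral_mult_right[symmetric] ac_simps del: set_integral_mult_right)
  moreover have "set_integrable lborel {\<eta>..\<xi>} (\<lambda>s. p s * R1 s \<eta>)"
  proof (rule set_integrable_bounded_Icc[where C="C * (\<xi> - \<eta>)"])
    have "(\<lambda>s. R1 s \<eta>) \<in> borel_measurable borel"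
      using measurable_compose[OF _ R1_borel, of "\<lambda>s. (s, \<eta>)" borel] by simp
    then show "(\<lambda>s. p s * R1 s \<eta>) \<in> borel_measurable borel" by measurable
    fix s assume s: "\<eta> \<le> s" "s \<le> \<xi>"
    have "R1 s \<eta> \<le> C * (\<xi> - \<eta>)" using R_bounds(2)[OF s(1)] s C_pos mult_left_mono[of "s - \<eta>" "\<xi> - \<eta>" C] by linarith
    then show "norm (p s * R1 s \<eta>) \<le> C * (\<xi> - \<eta>)"
      using R_bounds[OF s(1)] pq1[of s] mult_mono[of "p s" 1 "R1 s \<eta>" "C * (\<xi> - \<eta>)"] by auto
  qed
  ultimately show "T (\<xi>, \<eta>) = (LINT s:{\<eta>..\<xi>}|lborel. P s \<eta>)"
    unfolding T P_def using i by (simp add: set_integral_add)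
  have "(LINT z:tri \<xi> \<eta>|lborel. ?f z) = (LINT s:{\<eta>..\<xi>}|lborel. q s * R2 \<xi> s)"
    unfolding tri_integral_iterated(2)[OF f fb] R2_def
    by (simp add: set_integral_mult_right[symmetric] ac_simps del: set_integral_mult_right)
  moreover have "set_integrable lborel {\<eta>..\<xi>} (\<lambda>s. q s * R2 \<xi> s)"
  proof (rule set_integrable_bounded_Icc[where C="C * (\<xi> - \<eta>)"])
    have "(\<lambda>s. R2 \<xi> s) \<in> borel_measurable borel"
      using measurable_compose[OF _ R2_borel, of "\<lambda>s. (\<xi>, s)" borel] by simp
    then show "(\<lambda>s. q s * R2 \<xi> s) \<in> borel_measurable borel" by measurable
    fix s assume s: "\<eta> \<le> s" "s \<le> \<xi>"
    have "R2 \<xi> s \<le> C * (\<xi> - \<eta>)" using R_bounds(4)[OF s(2)] s C_pos mult_left_mono[of "\<xi> - s" "\<xi> - \<eta>" C] by linarith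
    then show "norm (q s * R2 \<xi> s) \<le> C * (\<xi> - \<eta>)"
      using R_bounds[OF s(2)] pq1[of s] mult_mono[of "q s" 1 "R2 \<xi> s" "C * (\<xi> - \<eta>)"] by auto
  qed
  ultimately show "T (\<xi>, \<eta>) = (LINT s:{\<eta>..\<xi>}|lborel. Q \<xi> s)"
    unfolding T Q_def using i by (simp add: set_integral_add)
qed

lemma T_diag [simp]: "T (\<xi>, \<xi>) = 0" and X_diag [simp]: "X \<xi> \<xi> = \<xi>"
  by (simp_all add: T_P X_def)

lemma p_int: "set_integrable lborel {a..b'} p" and q_int: "set_integrable lborel {a..b'} q"
  by (rule set_integrable_bounded_Icc[where C=1], use pq1 in \<open>auto simp: less_imp_le\<close>)+

lemma X_bounds:
  assumes "\<eta> \<le> \<xi>"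
  shows "\<eta> \<le> X \<xi> \<eta>" "X \<xi> \<eta> \<le> \<xi>"
proof -
  have "0 \<le> (LINT s:{\<eta>..\<xi>}|lborel. p s)"
    using set_integral_Icc_ge[OF p_int, of \<eta> \<xi> 0] pq1 assms by (auto simp: less_imp_le)
  moreover have "(LINT s:{\<eta>..\<xi>}|lborel. p s) \<le> \<xi> - \<eta>"
    using norm_set_integral_Icc_le[of p \<eta> \<xi> 1] pq1 assms by (auto simp: less_imp_le)
  ultimately show "\<eta> \<le> X \<xi> \<eta>" "X \<xi> \<eta> \<le> \<xi>" by (auto simp: X_def)
qed

text \<open>This is x = \<alpha> + \<beta>: because p + q = 1, \<open>X\<close> is a primitive in
  its second argument as well, with density \<open>q\<close>.\<close>

lemma X_split:
  assumes "a \<le> \<eta>" "\<eta> \<le> \<xi>"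
  shows "X \<xi> a = X \<eta> a + (LINT s:{\<eta>..\<xi>}|lborel. p s)"
    and "X \<xi> \<eta> = X \<xi> a + (LINT s:{a..\<eta>}|lborel. q s)"
proof -
  have p: "(LINT s:{a..\<xi>}|lborel. p s) = (LINT s:{a..\<eta>}|lborel. p s) + (LINT s:{\<eta>..\<xi>}|lborel. p s)"
    by (rule set_integral_Icc_combine[where C=1]) (use pq1 assms in \<open>auto simp: less_imp_le\<close>)
  have "(LINT s:{a..\<eta>}|lborel. p s) + (LINT s:{a..\<eta>}|lborel. q s) = (LINT s:{a..\<eta>}|lborel. 1)"
    by (simp add: set_integral_add(2)[OF p_int q_int, symmetric] c(6))
  also have "\<dots> = \<eta> - a" using assms by (simp add: set_lebesgue_integral_def)
  finally show "X \<xi> a = X \<eta> a + (LINT s:{\<eta>..\<xi>}|lborel. p s)"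
    "X \<xi> \<eta> = X \<xi> a + (LINT s:{a..\<eta>}|lborel. q s)"
    using p by (auto simp: X_def)
qed

lemma PQ_abs_bounds:
  assumes "a \<le> \<eta>" "\<eta> \<le> \<xi>" "\<xi> \<le> d"
  shows "\<bar>P \<xi> \<eta>\<bar> \<le> C + C * (d - a)" "\<bar>Q \<xi> \<eta>\<bar> \<le> C + C * (d - a)"
proof -
  have "C * (\<xi> - \<eta>) \<le> C * (d - a)" using assms C_pos by (intro mult_left_mono) auto
  then show "\<bar>P \<xi> \<eta>\<bar> \<le> C + C * (d - a)" "\<bar>Q \<xi> \<eta>\<bar> \<le> C + C * (d - a)"
    using PQ_bounds[OF assms(2)] c(1) by linarith+
qed

lemma X_borel [measurable]: "(\<lambda>z. X (fst z) (snd z)) \<in> borel_measurable borel"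
  unfolding X_def by (intro borel_measurable_add borel_measurable_Icc_integral) measurable

lemma P_int: "\<eta> \<le> d \<Longrightarrow> set_integrable lborel {\<eta>..d} (\<lambda>s. P s \<eta>)"
  and Q_int: "a \<le> \<xi> \<Longrightarrow> set_integrable lborel {a..\<xi>} (\<lambda>s. Q \<xi> s)"
proof -
  show "set_integrable lborel {\<eta>..d} (\<lambda>s. P s \<eta>)"
    by (rule set_integrable_bounded_Icc[where C="C + C * (d - \<eta>)"]) (use PQ_abs_bounds[of \<eta> \<eta> _ d] in auto)
  show "set_integrable lborel {a..\<xi>} (\<lambda>s. Q \<xi> s)"
    by (rule set_integrable_bounded_Icc[where C="C + C * (\<xi> - a)"]) (use PQ_abs_bounds[of a _ \<xi> \<xi>] in auto)
qed

text \<open>Time grows at least linearly with the distance of the feet, so a bounded time interval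
  confines the feet to a bounded distance from each other.\<close>

lemma T_ge: "\<eta> \<le> \<xi> \<Longrightarrow> c * (\<xi> - \<eta>) \<le> T (\<xi>, \<eta>)"
  unfolding T_P by (rule set_integral_Icc_ge) (use P_int PQ_bounds in auto)

lemma T_split:
  assumes "a \<le> \<eta>" "\<eta> \<le> \<xi>"
  shows "T (\<xi>, a) = T (\<eta>, a) + (LINT s:{\<eta>..\<xi>}|lborel. P s a)"
    and "T (\<xi>, \<eta>) = T (\<xi>, a) + (LINT s:{a..\<eta>}|lborel. - Q \<xi> s)"
proof -
  show "T (\<xi>, a) = T (\<eta>, a) + (LINT s:{\<eta>..\<xi>}|lborel. P s a)"
    unfolding T_P by (rule set_integral_Icc_combine[where C="C + C * (\<xi> - a)"])
      (use PQ_abs_bounds[of a a _ \<xi>] assms in auto)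
  have "T (\<xi>, a) = (LINT s:{a..\<eta>}|lborel. Q \<xi> s) + T (\<xi>, \<eta>)"
    unfolding T_Q by (rule set_integral_Icc_combine[where C="C + C * (\<xi> - a)"])
      (use PQ_abs_bounds[of a _ \<xi> \<xi>] assms in auto)
  then show "T (\<xi>, \<eta>) = T (\<xi>, a) + (LINT s:{a..\<eta>}|lborel. - Q \<xi> s)"
    by (simp add: set_lebesgue_integral_def)
qed

lemma T_borel1 [measurable]: "(\<lambda>s. T (s, \<eta>)) \<in> borel_measurable borel" "(\<lambda>s. T (\<xi>, s)) \<in> borel_measurable borel"
  by (auto intro!: borel_measurable_continuous_onI continuous_on_compose2[OF T_cont] continuous_intros)

text \<open>The equation t_\<xi>\<eta> = -b p q read as transport of \<open>Q\<close> = -t_\<eta>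
  along constant \<eta> and of \<open>P\<close> = t_\<xi> along constant \<xi>.\<close>

lemma PQ_split:
  assumes "a \<le> \<eta>" "\<eta> \<le> \<xi>"
  shows "Q \<xi> a = Q \<eta> a + (LINT s:{\<eta>..\<xi>}|lborel. q a * (b (T (s, a)) * p s))"
    and "P \<xi> \<eta> = P \<xi> a + (LINT s:{a..\<eta>}|lborel. - (p \<xi> * (b (T (\<xi>, s)) * q s)))"
proof -
  have "R2 \<xi> a = R2 \<eta> a + (LINT s:{\<eta>..\<xi>}|lborel. b (T (s, a)) * p s)"
    unfolding R2_def by (rule set_integral_Icc_combine[where C=C]) (use assms bp_abs in auto)
  then show "Q \<xi> a = Q \<eta> a + (LINT s:{\<eta>..\<xi>}|lborel. q a * (b (T (s, a)) * p s))"
    by (simp add: Q_def distrib_left)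
  have "R1 \<xi> a = (LINT s:{a..\<eta>}|lborel. b (T (\<xi>, s)) * q s) + R1 \<xi> \<eta>"
    unfolding R1_def by (rule set_integral_Icc_combine[where C=C]) (use assms bp_abs in auto)
  moreover have "(LINT s:{a..\<eta>}|lborel. - (p \<xi> * (b (T (\<xi>, s)) * q s))) = - (p \<xi> * (LINT s:{a..\<eta>}|lborel. b (T (\<xi>, s)) * q s))"
    by (simp add: set_lebesgue_integral_def integral_mult_right_zero[symmetric] ac_simps del: integral_mult_right_zero)
  ultimately show "P \<xi> \<eta> = P \<xi> a + (LINT s:{a..\<eta>}|lborel. - (p \<xi> * (b (T (\<xi>, s)) * q s)))"
    by (simp add: P_def distrib_left)
qed

end

section \<open>Integral identities against test functions\<close>

locale goursat_test = goursat +
  fixes h hx ht :: "real \<times> real \<Rightarrow> real" and R t1 B :: real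
  assumes h: "\<And>z. (h has_derivative (\<lambda>v. hx z * fst v + ht z * snd v)) (at z)"
    and hc: "continuous_on UNIV hx" "continuous_on UNIV ht"
    and supp: "\<And>z. R < \<bar>fst z\<bar> \<or> t1 < snd z \<Longrightarrow> h z = 0 \<and> hx z = 0 \<and> ht z = 0"
    and B: "R + t1 / c < B" "0 < t1" "0 < R"
begin

text \<open>Here the prime denotes pull-back to characteristic coordinates, not
  differentiation.\<close>

definition hx' where "hx' z = hx (X (fst z) (snd z), T z)"
definition ht' where "ht' z = ht (X (fst z) (snd z), T z)"
definition h' where "h' z = h (X (fst z) (snd z), T z)"

text \<open>Where the pull-back is nonzero, |X| \<le> R and c (\<xi> - \<eta>) \<le> T \<le> t1. As
  \<eta> \<le> X \<le> \<xi>, both feet are then within t1/c of X, hence strictly inside (-B, B) by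
  the choice of \<open>B\<close>.\<close>

lemma supp':
  assumes "snd z \<le> fst z" "z \<notin> tri B (- B) \<or> fst z = B \<or> snd z = - B"
  shows "h' z = 0" "hx' z = 0" "ht' z = 0"
proof -
  obtain \<xi> \<eta> where z: "z = (\<xi>, \<eta>)" by force
  have "R < \<bar>X \<xi> \<eta>\<bar> \<or> t1 < T (\<xi>, \<eta>)"
  proof (rule ccontr)
    assume "\<not> ?thesis"
    then have a: "\<bar>X \<xi> \<eta>\<bar> \<le> R" "T (\<xi>, \<eta>) \<le> t1" by auto
    have "c * (\<xi> - \<eta>) \<le> t1" using T_ge[of \<eta> \<xi>] assms a z by auto
    then have "\<xi> - \<eta> \<le> t1 / c" using c(1) by (simp add: pos_le_divide_eq mult.commute)
    then have "\<xi> < B" "- B < \<eta>" using X_bounds[of \<eta> \<xi>] a(1) assms(1) z B by auto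
    then show False using assms by (auto simp: z tri_def)
  qed
  then show "h' z = 0" "hx' z = 0" "ht' z = 0"
    using supp[of "(X \<xi> \<eta>, T (\<xi>, \<eta>))"] by (auto simp: h'_def hx'_def ht'_def z)
qed

lemma B_pos: "B > 0" using B c(1) by (smt (verit) divide_pos_pos)

lemma h_borel [measurable]: "h \<in> borel_measurable borel" "hx \<in> borel_measurable borel" "ht \<in> borel_measurable borel"
  using hc h by (auto intro!: borel_measurable_continuous_onI continuous_at_imp_continuous_on has_derivative_continuous)

lemma h'_borel [measurable]: "h' \<in> borel_measurable borel" "hx' \<in> borel_measurable borel" "ht' \<in> borel_measurable borel"
  unfolding h'_def[abs_def] hx'_def[abs_def] ht'_def[abs_def] by measurable

lemma h'_bounded: obtains D where "0 \<le> D"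
    "\<And>z. z \<in> tri B (- B) \<Longrightarrow> \<bar>h' z\<bar> \<le> D \<and> \<bar>hx' z\<bar> \<le> D \<and> \<bar>ht' z\<bar> \<le> D"
proof -
  let ?K = "{-B..B} \<times> {0..2 * B * (C + C * (2 * B))}"
  have K: "compact ?K" by (simp add: compact_Times)
  have XT: "(X (fst z) (snd z), T z) \<in> ?K" if "z \<in> tri B (- B)" for z
  proof -
    obtain \<xi> \<eta> where z: "z = (\<xi>, \<eta>)" by force
    have t: "- B \<le> \<eta>" "\<eta> \<le> \<xi>" "\<xi> \<le> B" using that by (auto simp: z tri_def)
    have "\<bar>T (\<xi>, \<eta>)\<bar> \<le> (C + C * (2 * B)) * (\<xi> - \<eta>)"
      unfolding T_P real_norm_def[symmetric]
      by (rule norm_set_integral_Icc_le) (use PQ_abs_bounds[of "-B" \<eta> _ B] t in auto)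
    also have "\<dots> \<le> (C + C * (2 * B)) * (2 * B)"
      using t C_pos B_pos by (intro mult_left_mono) auto
    finally have "T (\<xi>, \<eta>) \<le> 2 * B * (C + C * (2 * B))" by (simp add: algebra_simps)
    moreover have "0 \<le> T (\<xi>, \<eta>)" using T_ge[OF t(2)] t c(1) by (smt (verit) mult_nonneg_nonneg)
    ultimately show ?thesis using X_bounds[OF t(2)] t by (auto simp: z)
  qed
  have hcont: "continuous_on UNIV h"
    using h by (meson continuous_at_imp_continuous_on has_derivative_continuous)
  note bd = continuous_bounded_on_compact[OF _ K]
  from bd[OF hcont] bd[OF hc(1)] bd[OF hc(2)] obtain D1 D2 D3
    where D: "\<And>z. z \<in> ?K \<Longrightarrow> \<bar>h z\<bar> \<le> D1" "\<And>z. z \<in> ?K \<Longrightarrow> \<bar>hx z\<bar> \<le> D2" "\<And>z. z \<in> ?K \<Longrightarrow> \<bar>ht z\<bar> \<le> D3"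
    by metis
  show thesis
  proof (rule that[of "\<bar>D1\<bar> + \<bar>D2\<bar> + \<bar>D3\<bar>"])
    fix z assume "z \<in> tri B (- B)"
    from XT[OF this] show "\<bar>h' z\<bar> \<le> \<bar>D1\<bar> + \<bar>D2\<bar> + \<bar>D3\<bar> \<and> \<bar>hx' z\<bar> \<le> \<bar>D1\<bar> + \<bar>D2\<bar> + \<bar>D3\<bar> \<and> \<bar>ht' z\<bar> \<le> \<bar>D1\<bar> + \<bar>D2\<bar> + \<bar>D3\<bar>"
      using D[of "(X (fst z) (snd z), T z)"] unfolding h'_def hx'_def ht'_def by linarith
  qed simp
qed

text \<open>The integrand is the derivative of h(X, T) w along \<eta> = u. The outer end lies off
  the support, and at the diagonal end X = u and T = 0, which leaves the initial value.\<close>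

lemma line_\<xi>:
  assumes u: "- B \<le> u" "u \<le> B" and [measurable]: "w' \<in> borel_measurable borel"
    and W: "\<And>s. u \<le> s \<Longrightarrow> s \<le> B \<Longrightarrow> \<bar>w' s\<bar> \<le> W"
    and w: "\<And>s. u \<le> s \<Longrightarrow> s \<le> B \<Longrightarrow> w s = w u + (LINT y:{u..s}|lborel. w' y)"
  shows "(LINT s:{u..B}|lborel. (hx' (s, u) * p s + ht' (s, u) * P s u) * w s + h' (s, u) * w' s) = - h (u, 0) * w u"
proof -
  define C' where "C' = max W (max 1 (C + C * (2 * B)))"
  have "(LINT s:{u..B}|lborel. (hx (X s u, T (s, u)) * p s + ht (X s u, T (s, u)) * P s u) * w s + h (X s u, T (s, u)) * w' s)
    = h (X B u, T (B, u)) * w B - h (X u u, T (u, u)) * w u"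
  proof (rule chain_rule_primitive_weighted[OF h hc])
    fix s assume s: "u \<le> s" "s \<le> B"
    show "\<bar>p s\<bar> \<le> C'" "\<bar>P s u\<bar> \<le> C'" "\<bar>w' s\<bar> \<le> C'"
      using pq1[of s] PQ_abs_bounds[of "-B" u s B] W[OF s] s u by (auto simp: C'_def)
    show "X s u = X u u + (LINT y:{u..s}|lborel. p y)" "T (s, u) = T (u, u) + (LINT y:{u..s}|lborel. P y u)"
      using X_split(1)[of u u s] T_split(1)[of u u s] s by auto
    show "w s = w u + (LINT y:{u..s}|lborel. w' y)" by (rule w[OF s])
  qed (use u in simp_all)
  moreover have "h (X B u, T (B, u)) = 0"
    using supp'(1)[of "(B, u)"] u by (simp add: h'_def)
  ultimately show ?thesis by (simp add: h'_def hx'_def ht'_def)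
qed

text \<open>The mirror image along \<xi> = u, where X has density \<open>q\<close> and T has density
  \<open>-Q\<close>. The diagonal is now the upper end of integration, hence the opposite
  sign.\<close>

lemma line_\<eta>:
  assumes u: "- B \<le> u" "u \<le> B" and [measurable]: "w' \<in> borel_measurable borel"
    and W: "\<And>s. - B \<le> s \<Longrightarrow> s \<le> u \<Longrightarrow> \<bar>w' s\<bar> \<le> W"
    and w: "\<And>s. - B \<le> s \<Longrightarrow> s \<le> u \<Longrightarrow> w s = w (- B) + (LINT y:{- B..s}|lborel. w' y)"
  shows "(LINT s:{- B..u}|lborel. (hx' (u, s) * q s + ht' (u, s) * - Q u s) * w s + h' (u, s) * w' s) = h (u, 0) * w u"
proof -
  define C' where "C' = max W (max 1 (C + C * (2 * B)))"
  have "(LINT s:{- B..u}|lborel. (hx (X u s, T (u, s)) * q s + ht (X u s, T (u, s)) * - Q u s) * w s + h (X u s, T (u, s)) * w' s)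
    = h (X u u, T (u, u)) * w u - h (X u (- B), T (u, - B)) * w (- B)"
  proof (rule chain_rule_primitive_weighted[OF h hc])
    fix s assume s: "- B \<le> s" "s \<le> u"
    show "\<bar>q s\<bar> \<le> C'" "\<bar>- Q u s\<bar> \<le> C'" "\<bar>w' s\<bar> \<le> C'"
      using pq1[of s] PQ_abs_bounds[of "-B" s u B] W[OF s] s u by (auto simp: C'_def)
    show "X u s = X u (- B) + (LINT y:{- B..s}|lborel. q y)" "T (u, s) = T (u, - B) + (LINT y:{- B..s}|lborel. - Q u y)"
      using X_split(2)[of "- B" s u] T_split(2)[of "- B" s u] s by auto
    show "w s = w (- B) + (LINT y:{- B..s}|lborel. w' y)" by (rule w[OF s])
  qed (use u in simp_all)
  moreover have "h (X u (- B), T (u, - B)) = 0"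
    using supp'(1)[of "(u, - B)"] u by (simp add: h'_def)
  ultimately show ?thesis by (simp add: h'_def hx'_def ht'_def)
qed

lemma tri_integrand_bound:
  assumes D: "\<bar>h' z\<bar> \<le> D \<and> \<bar>hx' z\<bar> \<le> D \<and> \<bar>ht' z\<bar> \<le> D"
    and "\<bar>a\<bar> \<le> 1" "\<bar>d\<bar> \<le> M" "\<bar>w\<bar> \<le> W" "\<bar>w'\<bar> \<le> W"
  shows "\<bar>(hx' z * a + ht' z * d) * w + h' z * w'\<bar> \<le> (D * 1 + D * M) * W + D * W"
proof -
  have D0: "0 \<le> D" and M: "0 \<le> M" using assms by linarith+
  have 1: "\<bar>hx' z * a\<bar> \<le> D * 1" "\<bar>ht' z * d\<bar> \<le> D * M" "\<bar>h' z * w'\<bar> \<le> D * W"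
    unfolding abs_mult using assms D0 by (intro mult_mono; simp)+
  then have "\<bar>hx' z * a + ht' z * d\<bar> \<le> D * 1 + D * M" by linarith
  then have "\<bar>(hx' z * a + ht' z * d) * w\<bar> \<le> (D * 1 + D * M) * W"
    unfolding abs_mult using assms D0 M by (intro mult_mono) auto
  then show ?thesis using 1(3) by linarith
qed

text \<open>Fubini assembles the identities on single lines. Each Codazzi equation, and the area
  formula, is a combination of one instance of this lemma and one of \<open>tri_\<eta>\<close>, for
  suitable weights.\<close>

lemma tri_\<xi>:
  assumes w [measurable]: "w \<in> borel_measurable borel" "w' \<in> borel_measurable borel"
    and W: "\<And>z. z \<in> tri B (- B) \<Longrightarrow> \<bar>w z\<bar> \<le> W" "\<And>z. z \<in> tri B (- B) \<Longrightarrow> \<bar>w' z\<bar> \<le> W"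
    and prim: "\<And>u s. - B \<le> u \<Longrightarrow> u \<le> s \<Longrightarrow> s \<le> B \<Longrightarrow> w (s, u) = w (u, u) + (LINT y:{u..s}|lborel. w' (y, u))"
  defines "G \<equiv> \<lambda>z. (hx' z * p (fst z) + ht' z * P (fst z) (snd z)) * w z + h' z * w' z"
  shows "set_integrable lborel (tri B (- B)) G"
    and "(LINT z:tri B (- B)|lborel. G z) = (LINT u:{- B..B}|lborel. - h (u, 0) * w (u, u))"
proof -
  obtain D where D: "0 \<le> D" "\<And>z. z \<in> tri B (- B) \<Longrightarrow> \<bar>h' z\<bar> \<le> D \<and> \<bar>hx' z\<bar> \<le> D \<and> \<bar>ht' z\<bar> \<le> D"
    using h'_bounded by blast
  define M where "M = C + C * (2 * B)"
  have G [measurable]: "G \<in> borel_measurable borel" unfolding G_def by measurable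
  have Gb: "\<bar>G z\<bar> \<le> (D * 1 + D * M) * W + D * W" if z: "z \<in> tri B (- B)" for z
    unfolding G_def
  proof (rule tri_integrand_bound[OF D(2)[OF z] _ _ W(1)[OF z] W(2)[OF z]])
    show "\<bar>P (fst z) (snd z)\<bar> \<le> M"
      using PQ_abs_bounds[of "- B" "snd z" "fst z" B] z by (auto simp: tri_def M_def)
    show "\<bar>p (fst z)\<bar> \<le> 1" using pq1[of "fst z"] by simp
  qed
  show "set_integrable lborel (tri B (- B)) G"
    by (rule set_integrable_bounded_set) (use Gb in auto)
  have "(LINT z:tri B (- B)|lborel. G z) = (LINT u:{- B..B}|lborel. LINT s:{u..B}|lborel. G (s, u))"
    by (rule tri_integral_iterated(2)[OF G Gb])
  also have "\<dots> = (LINT u:{- B..B}|lborel. - h (u, 0) * w (u, u))"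
  proof (rule set_lebesgue_integral_cong)
    show "\<forall>u. u \<in> {- B..B} \<longrightarrow> (LINT s:{u..B}|lborel. G (s, u)) = - h (u, 0) * w (u, u)"
    proof (intro allI impI)
      fix u assume u: "u \<in> {- B..B}"
      show "(LINT s:{u..B}|lborel. G (s, u)) = - h (u, 0) * w (u, u)"
        unfolding G_def fst_conv snd_conv
      proof (rule line_\<xi>[where w="\<lambda>s. w (s, u)" and w'="\<lambda>s. w' (s, u)" and W=W])
        show "(\<lambda>s. w' (s, u)) \<in> borel_measurable borel"
          by (rule measurable_compose[OF _ w(2)]) simp
        show "w (s, u) = w (u, u) + (LINT y:{u..s}|lborel. w' (y, u))" if "u \<le> s" "s \<le> B" for s
          using that u by (intro prim) auto
      qed (use u W in \<open>auto simp: tri_def\<close>)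
    qed
  qed simp
  finally show "(LINT z:tri B (- B)|lborel. G z) = (LINT u:{- B..B}|lborel. - h (u, 0) * w (u, u))" .
qed

lemma tri_\<eta>:
  assumes w [measurable]: "w \<in> borel_measurable borel" "w' \<in> borel_measurable borel"
    and W: "\<And>z. z \<in> tri B (- B) \<Longrightarrow> \<bar>w z\<bar> \<le> W" "\<And>z. z \<in> tri B (- B) \<Longrightarrow> \<bar>w' z\<bar> \<le> W"
    and prim: "\<And>u s. - B \<le> s \<Longrightarrow> s \<le> u \<Longrightarrow> u \<le> B \<Longrightarrow>
        w (u, s) = w (u, - B) + (LINT y:{- B..s}|lborel. w' (u, y))"
  defines "G \<equiv> \<lambda>z. (hx' z * q (snd z) + ht' z * - Q (fst z) (snd z)) * w z + h' z * w' z"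
  shows "set_integrable lborel (tri B (- B)) G"
    and "(LINT z:tri B (- B)|lborel. G z) = (LINT u:{- B..B}|lborel. h (u, 0) * w (u, u))"
proof -
  obtain D where D: "0 \<le> D" "\<And>z. z \<in> tri B (- B) \<Longrightarrow> \<bar>h' z\<bar> \<le> D \<and> \<bar>hx' z\<bar> \<le> D \<and> \<bar>ht' z\<bar> \<le> D"
    using h'_bounded by blast
  define M where "M = C + C * (2 * B)"
  have G [measurable]: "G \<in> borel_measurable borel" unfolding G_def by measurable
  have Gb: "\<bar>G z\<bar> \<le> (D * 1 + D * M) * W + D * W" if z: "z \<in> tri B (- B)" for z
    unfolding G_def
  proof (rule tri_integrand_bound[OF D(2)[OF z] _ _ W(1)[OF z] W(2)[OF z]])
    show "\<bar>- Q (fst z) (snd z)\<bar> \<le> M"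
      using PQ_abs_bounds[of "- B" "snd z" "fst z" B] z by (auto simp: tri_def M_def)
    show "\<bar>q (snd z)\<bar> \<le> 1" using pq1[of "snd z"] by simp
  qed
  show "set_integrable lborel (tri B (- B)) G"
    by (rule set_integrable_bounded_set) (use Gb in auto)
  have "(LINT z:tri B (- B)|lborel. G z) = (LINT u:{- B..B}|lborel. LINT s:{- B..u}|lborel. G (u, s))"
    by (rule tri_integral_iterated(1)[OF G Gb])
  also have "\<dots> = (LINT u:{- B..B}|lborel. h (u, 0) * w (u, u))"
  proof (rule set_lebesgue_integral_cong)
    show "\<forall>u. u \<in> {- B..B} \<longrightarrow> (LINT s:{- B..u}|lborel. G (u, s)) = h (u, 0) * w (u, u)"
    proof (intro allI impI)
      fix u assume u: "u \<in> {- B..B}"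
      show "(LINT s:{- B..u}|lborel. G (u, s)) = h (u, 0) * w (u, u)"
        unfolding G_def fst_conv snd_conv
      proof (rule line_\<eta>[where w="\<lambda>s. w (u, s)" and w'="\<lambda>s. w' (u, s)" and W=W])
        show "(\<lambda>s. w' (u, s)) \<in> borel_measurable borel"
          by (rule measurable_compose[OF _ w(2)]) simp
        show "w (u, s) = w (u, - B) + (LINT y:{- B..s}|lborel. w' (u, y))" if "- B \<le> s" "s \<le> u" for s
          using that u by (intro prim) auto
      qed (use u W in \<open>auto simp: tri_def\<close>)
    qed
  qed simp
  finally show "(LINT z:tri B (- B)|lborel. G z) = (LINT u:{- B..B}|lborel. h (u, 0) * w (u, u))" .
qed

abbreviation "pz z \<equiv> p (fst z)"
abbreviation "qz z \<equiv> q (snd z)"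
abbreviation "Pz z \<equiv> P (fst z) (snd z)"
abbreviation "Qz z \<equiv> Q (fst z) (snd z)"

lemma h0_int:
  assumes [measurable]: "f \<in> borel_measurable borel" and f: "\<And>s. \<bar>f s\<bar> \<le> W"
  shows "set_integrable lborel {- B..B} (\<lambda>u. h (u, 0) * f u)"
proof -
  obtain D where D: "0 \<le> D" "\<And>z. z \<in> tri B (- B) \<Longrightarrow> \<bar>h' z\<bar> \<le> D \<and> \<bar>hx' z\<bar> \<le> D \<and> \<bar>ht' z\<bar> \<le> D"
    using h'_bounded by blast
  show ?thesis
  proof (rule set_integrable_bounded_Icc[where C="D * W"])
    have "(\<lambda>u::real. (u, 0::real)) \<in> borel_measurable borel" by simp
    then have [measurable]: "(\<lambda>u. h (u, 0)) \<in> borel_measurable borel"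
      by (rule measurable_compose) (rule h_borel)
    show "(\<lambda>u. h (u, 0) * f u) \<in> borel_measurable borel" by measurable
    fix s assume "- B \<le> s" "s \<le> B"
    then have "\<bar>h (s, 0)\<bar> \<le> D" using D(2)[of "(s, s)"] by (auto simp: tri_def h'_def)
    then show "norm (h (s, 0) * f s) \<le> D * W"
      unfolding real_norm_def abs_mult using f[of s] D by (intro mult_mono) auto
  qed
qed

lemma PQ_diag [simp]: "P u u = r u" "Q u u = r u"
  by (simp_all add: P_def Q_def R1_def R2_def)

text \<open>The weight depends only on the label of the line, so its derivative along the line is 0
  and no source term arises. The same holds for \<open>p\<close> in the mirror image
  \<open>B_p\<close>.\<close>

lemma A_q:
  "set_integrable lborel (tri B (- B)) (\<lambda>z. (hx' z * pz z + ht' z * Pz z) * qz z + h' z * 0)" (is ?t1)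
  "(LINT z:tri B (- B)|lborel. (hx' z * pz z + ht' z * Pz z) * qz z + h' z * 0) = (LINT u:{- B..B}|lborel. - h (u, 0) * q u)" (is ?t2)
proof -
  have "\<bar>qz z\<bar> \<le> 1" for z using pq1[of "snd z"] by simp
  then show ?t1 ?t2
    using tri_\<xi>[of qz "\<lambda>_. 0" 1] by auto
qed

lemma B_p:
  "set_integrable lborel (tri B (- B)) (\<lambda>z. (hx' z * qz z + ht' z * - Qz z) * pz z + h' z * 0)" (is ?t1)
  "(LINT z:tri B (- B)|lborel. (hx' z * qz z + ht' z * - Qz z) * pz z + h' z * 0) = (LINT u:{- B..B}|lborel. h (u, 0) * p u)" (is ?t2)
proof -
  have "\<bar>pz z\<bar> \<le> 1" for z using pq1[of "fst z"] by simp
  then show ?t1 ?t2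
    using tri_\<eta>[of pz "\<lambda>_. 0" 1] by auto
qed

lemma bpq_bound: "\<bar>qz z * (b (T z) * pz z)\<bar> \<le> C" "\<bar>- (pz z * (b (T z) * qz z))\<bar> \<le> C"
  using mult_mono[OF bp(2)[of "T z" "fst z"] pq1(2)[of "snd z"]] C_pos bp[of "T z" "fst z"] pq1[of "snd z"] pq1(3)[of "fst z"]
  by (auto simp: ac_simps abs_mult abs_of_pos b)

text \<open>Along constant \<eta> the weight \<open>Q\<close> has the derivative b p q, by the wave
  equation; this is the origin of the source term.\<close>

lemma A_Q:
  "set_integrable lborel (tri B (- B)) (\<lambda>z. (hx' z * pz z + ht' z * Pz z) * Qz z + h' z * (qz z * (b (T z) * pz z)))" (is ?t1)
  "(LINT z:tri B (- B)|lborel. (hx' z * pz z + ht' z * Pz z) * Qz z + h' z * (qz z * (b (T z) * pz z)))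
    = (LINT u:{- B..B}|lborel. - h (u, 0) * r u)" (is ?t2)
proof -
  have 1: "\<bar>Qz z\<bar> \<le> C + C * (2 * B)" if "z \<in> tri B (- B)" for z
    using PQ_abs_bounds[of "- B" "snd z" "fst z" B] that by (auto simp: tri_def)
  have 2: "\<bar>qz z * (b (T z) * pz z)\<bar> \<le> C + C * (2 * B)" for z
    using bpq_bound[of z] mult_pos_pos[OF C_pos B_pos] by linarith
  have 3: "Qz (s, u) = Qz (u, u) + (LINT y:{u..s}|lborel. qz (y, u) * (b (T (y, u)) * pz (y, u)))"
    if "u \<le> s" for u s
    using PQ_split(1)[of u u s] that by simp
  show ?t1 ?t2
    using tri_\<xi>[of Qz "\<lambda>z. qz z * (b (T z) * pz z)" "C + C * (2 * B)", OF _ _ 1 2 3] by auto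
qed

lemma B_P:
  "set_integrable lborel (tri B (- B)) (\<lambda>z. (hx' z * qz z + ht' z * - Qz z) * Pz z + h' z * - (pz z * (b (T z) * qz z)))" (is ?t1)
  "(LINT z:tri B (- B)|lborel. (hx' z * qz z + ht' z * - Qz z) * Pz z + h' z * - (pz z * (b (T z) * qz z)))
    = (LINT u:{- B..B}|lborel. h (u, 0) * r u)" (is ?t2)
proof -
  have 1: "\<bar>Pz z\<bar> \<le> C + C * (2 * B)" if "z \<in> tri B (- B)" for z
    using PQ_abs_bounds[of "- B" "snd z" "fst z" B] that by (auto simp: tri_def)
  have 2: "\<bar>- (pz z * (b (T z) * qz z))\<bar> \<le> C + C * (2 * B)" for z
    using bpq_bound[of z] mult_pos_pos[OF C_pos B_pos] by linarith
  have 3: "Pz (u, s) = Pz (u, - B) + (LINT y:{- B..s}|lborel. - (pz (u, y) * (b (T (u, y)) * qz (u, y))))"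
    if "- B \<le> s" "s \<le> u" for u s
    using PQ_split(2)[OF that] by simp
  show ?t1 ?t2
    using tri_\<eta>[of Pz "\<lambda>z. - (pz z * (b (T z) * qz z))" "C + C * (2 * B)", OF _ _ 1 2 3] by auto
qed

text \<open>In \<open>A_Q\<close> minus \<open>B_P\<close> the time terms and the source terms add
  up. Relative to the area element the three coefficients are multiples of M, L and N, so this
  becomes the first Codazzi equation.\<close>

lemma energy_identity:
  "(LINT z:tri B (- B)|lborel. hx' z * (pz z * Qz z - qz z * Pz z) + 2 * ht' z * (Pz z * Qz z)
      + 2 * h' z * (b (T z) * pz z * qz z)) = - 2 * (LINT u:{- B..B}|lborel. h (u, 0) * r u)"
proof -
  have "(LINT z:tri B (- B)|lborel. hx' z * (pz z * Qz z - qz z * Pz z) + 2 * ht' z * (Pz z * Qz z)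
      + 2 * h' z * (b (T z) * pz z * qz z)) = (LINT u:{- B..B}|lborel. - h (u, 0) * r u) - (LINT u:{- B..B}|lborel. h (u, 0) * r u)"
    unfolding A_Q(2)[symmetric] B_P(2)[symmetric] set_integral_diff(2)[OF A_Q(1) B_P(1), symmetric]
    by (rule arg_cong[where f="set_lebesgue_integral lborel _"]) (auto simp: fun_eq_iff algebra_simps)
  then show ?thesis by (simp add: set_lebesgue_integral_def)
qed

text \<open>In \<open>A_q\<close> plus \<open>B_p\<close> the space terms add up. Relative to the
  area element the two coefficients are multiples of N and M, so this becomes the second Codazzi
  equation.\<close>

lemma momentum_identity:
  "(LINT z:tri B (- B)|lborel. 2 * hx' z * (pz z * qz z) + ht' z * (qz z * Pz z - pz z * Qz z))
    = (LINT u:{- B..B}|lborel. h (u, 0) * (p u - q u))"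
proof -
  have "(LINT z:tri B (- B)|lborel. 2 * hx' z * (pz z * qz z) + ht' z * (qz z * Pz z - pz z * Qz z))
     = (LINT u:{- B..B}|lborel. - h (u, 0) * q u) + (LINT u:{- B..B}|lborel. h (u, 0) * p u)"
    unfolding A_q(2)[symmetric] B_p(2)[symmetric] set_integral_add(2)[OF A_q(1) B_p(1), symmetric]
    by (rule arg_cong[where f="set_lebesgue_integral lborel _"]) (auto simp: fun_eq_iff algebra_simps)
  also have "\<dots> = (LINT u:{- B..B}|lborel. h (u, 0) * p u) - (LINT u:{- B..B}|lborel. h (u, 0) * q u)"
    by (simp add: set_lebesgue_integral_def)
  also have "\<dots> = (LINT u:{- B..B}|lborel. h (u, 0) * (p u - q u))"
    using set_integral_diff(2)[OF h0_int[of p 1] h0_int[of q 1]] pq1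
    by (simp add: right_diff_distrib abs_of_pos)
  finally show ?thesis .
qed

text \<open>In \<open>A_q\<close> minus \<open>B_p\<close> the space terms cancel, and the factor
  left at \<open>ht'\<close> is the absolute Jacobian determinant of (X, T). This is the area
  formula in weak form.\<close>

lemma area_identity:
  "(LINT z:tri B (- B)|lborel. ht' z * (qz z * Pz z + pz z * Qz z)) = - (LINT u:{- B..B}|lborel. h (u, 0))"
proof -
  have "(LINT z:tri B (- B)|lborel. ht' z * (qz z * Pz z + pz z * Qz z))
     = (LINT u:{- B..B}|lborel. - h (u, 0) * q u) - (LINT u:{- B..B}|lborel. h (u, 0) * p u)"
    unfolding A_q(2)[symmetric] B_p(2)[symmetric] set_integral_diff(2)[OF A_q(1) B_p(1), symmetric]
    by (rule arg_cong[where f="set_lebesgue_integral lborel _"]) (auto simp: fun_eq_iff algebra_simps)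
  also have "\<dots> = - ((LINT u:{- B..B}|lborel. h (u, 0) * p u) + (LINT u:{- B..B}|lborel. h (u, 0) * q u))"
    by (simp add: set_lebesgue_integral_def)
  also have "(LINT u:{- B..B}|lborel. h (u, 0) * p u) + (LINT u:{- B..B}|lborel. h (u, 0) * q u)
      = (LINT u:{- B..B}|lborel. h (u, 0) * (p u + q u))"
    using set_integral_add(2)[OF h0_int[of p 1] h0_int[of q 1]] pq1
    by (simp add: distrib_left abs_of_pos)
  finally show ?thesis by (simp add: c(6))
qed

end

subsection \<open>Change of variables\<close>

lemma DERIV_max_0_power2:
  fixes s :: real
  shows "((\<lambda>s. (max 0 s)\<^sup>2) has_real_derivative 2 * max 0 s) (at s)"
proof -
  consider "s > 0" | "s < 0" | "s = 0" by linarith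
  then show ?thesis
  proof cases
    case 1
    have "((\<lambda>s. s\<^sup>2) has_real_derivative 2 * max 0 s) (at s)"
      using 1 by (auto intro!: derivative_eq_intros)
    then show ?thesis
      by (rule has_field_derivative_transform_within_open[where S="{0<..}"]) (use 1 in auto)
  next
    case 2
    have "((\<lambda>s. 0) has_real_derivative 2 * max 0 s) (at s)"
      using 2 by (auto intro!: derivative_eq_intros)
    then show ?thesis
      by (rule has_field_derivative_transform_within_open[where S="{..<0}"]) (use 2 in auto)
  next
    case 3
    have "((\<lambda>h. (max 0 h)\<^sup>2 / h) \<longlongrightarrow> 0) (at (0::real))"
    proof (rule Lim_null_comparison[where g="\<lambda>h. \<bar>h\<bar>"])
      show "\<forall>\<^sub>F h in at (0::real). norm ((max 0 h)\<^sup>2 / h) \<le> \<bar>h\<bar>"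
        by (rule always_eventually) (auto simp: max_def power2_eq_square)
      show "((\<lambda>h. \<bar>h\<bar>) \<longlongrightarrow> 0) (at (0::real))" by (auto intro!: tendsto_eq_intros)
    qed
    then show ?thesis unfolding 3 by (simp add: DERIV_def)
  qed
qed

text \<open>With m the squared positive part, which has no corner, 1 - 1/(1 + n m) is C1, vanishes
  where m = 0 and increases to 1 where m > 0, that is, on the open interval.\<close>

definition bump :: "real \<Rightarrow> real \<Rightarrow> nat \<Rightarrow> real \<Rightarrow> real" where
  "bump l u n x = 1 - 1 / (1 + real n * (max 0 ((x - l) * (u - x)))\<^sup>2)"

lemma bump_denom: "0 < 1 + real n * (max 0 s)\<^sup>2"
  by (intro add_pos_nonneg) auto

lemma bump_nonneg: "0 \<le> bump l u n x"
  using bump_denom[of n "(x - l) * (u - x)"] by (simp add: bump_def)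

lemma max_0_outside:
  fixes x :: real
  assumes "x \<notin> {l<..<u}" "l \<le> u"
  shows "max 0 ((x - l) * (u - x)) = 0"
proof -
  have "(x - l) * (u - x) \<le> 0"
    using assms by (cases "x \<le> l") (auto intro: mult_nonpos_nonneg mult_nonneg_nonpos)
  then show ?thesis by simp
qed

lemma bump_outside: "x \<notin> {l<..<u} \<Longrightarrow> l \<le> u \<Longrightarrow> bump l u n x = 0"
  unfolding bump_def by (drule (1) max_0_outside) simp

lemma bump_mono: "bump l u n x \<le> bump l u (Suc n) x"
  using bump_denom[of n "(x - l) * (u - x)"]
  by (auto simp: bump_def intro!: divide_left_mono mult_pos_pos bump_denom add_pos_nonneg)
    (simp add: distrib_right)

lemma bump_tendsto:
  assumes "l \<le> u"
  shows "(\<lambda>n. bump l u n x) \<longlonglongrightarrow> indicator {l<..<u} x"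
proof (cases "x \<in> {l<..<u}")
  case False
  then show ?thesis by (simp add: bump_outside[OF False assms])
next
  case True
  then have m: "0 < (max 0 ((x - l) * (u - x)))\<^sup>2" (is "0 < ?m") by auto
  have "(\<lambda>n. 1 - 1 / (1 + real n * ?m)) \<longlonglongrightarrow> 1 - 0"
  proof (intro tendsto_diff tendsto_const tendsto_divide_0[OF tendsto_const])
    show "filterlim (\<lambda>n. 1 + real n * ?m) at_infinity sequentially"
      by (intro filterlim_at_top_imp_at_infinity filterlim_tendsto_add_at_top[OF tendsto_const]
        filterlim_at_top_mult_tendsto_pos[OF tendsto_const m] filterlim_real_sequentially)
  qed
  then show ?thesis using True by (simp add: bump_def)
qed

definition bump' :: "real \<Rightarrow> real \<Rightarrow> nat \<Rightarrow> real \<Rightarrow> real" where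
  "bump' l u n x = real n * (2 * max 0 ((x - l) * (u - x)) * (u - x - (x - l)))
      / (1 + real n * (max 0 ((x - l) * (u - x)))\<^sup>2)\<^sup>2"

lemma DERIV_bump: "(bump l u n has_real_derivative bump' l u n x) (at x)"
proof -
  define m where "m x = (max 0 ((x - l) * (u - x)))\<^sup>2" for x
  define d where "d = 2 * max 0 ((x - l) * (u - x)) * (u - x - (x - l))"
  have 1: "(m has_real_derivative d) (at x)"
    unfolding m_def[abs_def] d_def
    by (rule DERIV_chain2[OF DERIV_max_0_power2]) (auto intro!: derivative_eq_intros)
  have "1 + real n * m x > 0"
    using bump_denom[of n "(x - l) * (u - x)"] by (simp add: m_def)
  then have "((\<lambda>x. 1 - 1 / (1 + real n * m x)) has_real_derivative real n * d / (1 + real n * m x)\<^sup>2) (at x)"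
    by (auto intro!: derivative_eq_intros 1 simp: power2_eq_square)
  then show ?thesis
    unfolding bump_def[abs_def] bump'_def m_def d_def .
qed

lemma continuous_bump: "continuous_on UNIV (bump l u n)" "continuous_on UNIV (bump' l u n)"
proof -
  show "continuous_on UNIV (bump l u n)"
    using DERIV_bump by (meson DERIV_isCont continuous_at_imp_continuous_on)
  have "(1 + real n * (max 0 ((x - l) * (u - x)))\<^sup>2)\<^sup>2 \<noteq> 0" for x
    using bump_denom[of n "(x - l) * (u - x)"] by simp
  then show "continuous_on UNIV (bump' l u n)"
    unfolding bump'_def[abs_def] by (intro continuous_intros) auto
qed

lemma bump'_outside: "x \<notin> {l<..<u} \<Longrightarrow> l \<le> u \<Longrightarrow> bump' l u n x = 0"
  unfolding bump'_def by (drule (1) max_0_outside) simp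

lemma bump_borel [measurable]: "bump l u n \<in> borel_measurable borel"
  by (rule borel_measurable_continuous_onI[OF continuous_bump(1)])

abbreviation bump2 :: "real \<Rightarrow> real \<Rightarrow> real \<Rightarrow> real \<Rightarrow> nat \<Rightarrow> real \<times> real \<Rightarrow> real" where
  "bump2 l1 u1 l2 u2 n z \<equiv> bump l1 u1 n (fst z) * bump l2 u2 n (snd z)"

text \<open>Products of cut-offs increase to indicators of open boxes, so monotone convergence gives
  equality on a generator of the Borel sets that is stable under intersection.\<close>

lemma measure_eqI_bump:
  fixes M N :: "(real \<times> real) measure"
  assumes sets: "sets M = sets borel" "sets N = sets borel"
    and fin: "\<And>l u. emeasure M (box l u) \<noteq> \<infinity>"
    and eq: "\<And>l1 u1 l2 u2 n. l1 \<le> u1 \<Longrightarrow> l2 \<le> u2 \<Longrightarrow>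
        (\<integral>\<^sup>+z. ennreal (bump2 l1 u1 l2 u2 n z) \<partial>M)
      = (\<integral>\<^sup>+z. ennreal (bump2 l1 u1 l2 u2 n z) \<partial>N)"
  shows "M = N"
proof (rule measure_eqI_generator_eq)
  let ?E = "range (\<lambda>(a, b). box a b::(real \<times> real) set)"
  show "Int_stable ?E"
    by (auto simp: Int_stable_def box_Int_box)
  show "?E \<subseteq> Pow UNIV" "sets M = sigma_sets UNIV ?E" "sets N = sigma_sets UNIV ?E"
    by (simp_all add: borel_eq_box sets)
  let ?A = "\<lambda>n::nat. box (- (real n *\<^sub>R One)) (real n *\<^sub>R One) :: (real \<times> real) set"
  show "range ?A \<subseteq> ?E" "(\<Union>i. ?A i) = UNIV"
    unfolding UN_box_eq_UNIV by auto
  show "emeasure M (?A i) \<noteq> \<infinity>" for i by (rule fin)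
  have lim: "(\<lambda>n. \<integral>\<^sup>+z. ennreal (bump2 l1 u1 l2 u2 n z) \<partial>K)
      \<longlonglongrightarrow> emeasure K (box (l1, l2) (u1, u2))"
    if lu: "l1 \<le> u1" "l2 \<le> u2" and K: "sets K = sets borel" for K l1 l2 u1 u2
  proof -
    have "(\<lambda>n. \<integral>\<^sup>+z. ennreal (bump2 l1 u1 l2 u2 n z) \<partial>K)
      \<longlonglongrightarrow> (\<integral>\<^sup>+z. indicator (box (l1, l2) (u1, u2)) z \<partial>K)"
    proof (rule nn_integral_LIMSEQ)
      show "incseq (\<lambda>n z. ennreal (bump2 l1 u1 l2 u2 n z))"
        by (intro incseq_SucI le_funI ennreal_leI mult_mono bump_mono bump_nonneg)
      show "(\<lambda>z. ennreal (bump2 l1 u1 l2 u2 n z)) \<in> borel_measurable K" for n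
        using K by (simp cong: measurable_cong_sets)
      fix z :: "real \<times> real"
      have "(\<lambda>n. bump2 l1 u1 l2 u2 n z)
          \<longlonglongrightarrow> indicator {l1<..<u1} (fst z) * indicator {l2<..<u2} (snd z)"
        by (intro tendsto_mult bump_tendsto lu)
      also have "indicator {l1<..<u1} (fst z) * indicator {l2<..<u2} (snd z) = (indicator (box (l1, l2) (u1, u2)) z :: real)"
        by (cases z) (auto simp: indicator_def box_prod)
      finally show "(\<lambda>n. ennreal (bump2 l1 u1 l2 u2 n z))
          \<longlonglongrightarrow> indicator (box (l1, l2) (u1, u2)) z"
        unfolding ennreal_indicator[symmetric] by (rule tendsto_ennrealI)
    qed
    then show ?thesis using K by simp
  qed
  show "emeasure M A = emeasure N A" if AE: "A \<in> ?E" for A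
  proof -
    obtain w :: "(real \<times> real) \<times> (real \<times> real)" where "A = (case w of (x, y) \<Rightarrow> box x y)"
      using AE by blast
    moreover obtain x y where "w = (x, y)" by (rule prod.exhaust)
    ultimately have A': "A = box x y" by simp
    obtain l1 l2 u1 u2 where "x = (l1, l2)" "y = (u1, u2)" by (metis prod.exhaust)
    with A' have A: "A = box (l1, l2) (u1, u2)" by simp
    show ?thesis
    proof (cases "l1 \<le> u1 \<and> l2 \<le> u2")
      case True
      then have "l1 \<le> u1" "l2 \<le> u2" by auto
      note l = lim[OF this sets(1)] lim[OF this sets(2)] and e = eq[OF this]
      show ?thesis unfolding A by (rule LIMSEQ_unique[OF l(1)[unfolded e] l(2)])
    next
      case False
      then have "A = {}" by (auto simp: A box_prod)
      then show ?thesis by simp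
    qed
  qed
qed

lemma bump_le_1: "bump l u n x \<le> 1"
  using bump_denom[of n "(x - l) * (u - x)"] by (simp add: bump_def)

lemma bump_set_integrable: "set_integrable lborel {a..b} (bump l u n)"
  by (rule set_integrable_bounded_Icc[where C=1]) (auto simp: bump_nonneg bump_le_1)

section \<open>The image of the characteristic area element\<close>

locale goursat_time = goursat +
  fixes Y e G :: "real \<Rightarrow> real" and y0 :: real
  assumes Y: "\<And>t. (Y has_real_derivative e t) (at t)" and e: "continuous_on UNIV e" "\<And>t. 0 < e t"
    and G: "\<And>t. G (Y t) = t" "\<And>y. Y (G y) = y" and Y0: "Y 0 = y0"
begin

lemma Y_mono: "t < s \<Longrightarrow> Y t < Y s"
  by (rule DERIV_pos_imp_increasing) (use Y e in blast)+

lemma Y_le_iff: "Y t \<le> Y s \<longleftrightarrow> t \<le> s" and Y_less_iff: "Y t < Y s \<longleftrightarrow> t < s"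
  using Y_mono[of t s] Y_mono[of s t] by (cases "t = s"; force)+

lemma Y_cont: "continuous_on UNIV Y"
  using Y by (meson DERIV_isCont continuous_at_imp_continuous_on)

lemma Y_borel [measurable]: "Y \<in> borel_measurable borel" and e_borel [measurable]: "e \<in> borel_measurable borel"
  by (rule borel_measurable_continuous_onI, rule Y_cont e)+

text \<open>The absolute Jacobian determinant of (\<xi>, \<eta>) \<mapsto> (X, T), whose matrix has
  the rows (p, q) and (P, -Q).\<close>

definition J where "J z = q (snd z) * P (fst z) (snd z) + p (fst z) * Q (fst z) (snd z)"

definition \<Delta> :: "(real \<times> real) set" where "\<Delta> = {z. snd z \<le> fst z}"

lemma \<Delta>_closed: "closed \<Delta>"
  unfolding \<Delta>_def by (intro closed_Collect_le continuous_intros)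

lemma \<Delta>_borel [measurable]: "\<Delta> \<in> sets borel"
  using \<Delta>_closed by simp

lemma J_borel [measurable]: "J \<in> borel_measurable borel"
  unfolding J_def[abs_def] by measurable

lemma J_pos: "z \<in> \<Delta> \<Longrightarrow> 0 < J z"
  using PQ_bounds[of "snd z" "fst z"] c(1) pq1[of "fst z"] pq1[of "snd z"]
  by (auto simp: \<Delta>_def J_def intro!: add_pos_pos mult_pos_pos)

text \<open>With \<open>H(x, t) = h(x) K(Y t)\<close> and \<open>K' = k\<close> vanishing for large argument, the area identity
  computes the integral of \<open>h \<otimes> k\<close> against the image of the characteristic area element.\<close>

lemma nn_integral_product:
  fixes h h1 k :: "real \<Rightarrow> real"
  assumes hh: "\<And>x. (h has_real_derivative h1 x) (at x)" "continuous_on UNIV h1" "\<And>x. 0 \<le> h x"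
      "\<And>x. R < \<bar>x\<bar> \<Longrightarrow> h x = 0 \<and> h1 x = 0" "0 < R"
    and k: "continuous_on UNIV k" "\<And>y. 0 \<le> k y" "\<And>y. m < y \<Longrightarrow> k y = 0" "y0 < m"
  shows "(\<integral>\<^sup>+z. indicator \<Delta> z * ennreal (h (X (fst z) (snd z)) * k (Y (T z)) * (e (T z) * J z)) \<partial>lborel)
    = ennreal ((LINT x|lborel. h x) * (LINT y:{y0..m}|lborel. k y))"
proof -
  have "\<exists>F. \<forall>x::real. - \<infinity> < ereal x \<longrightarrow> ereal x < \<infinity> \<longrightarrow> (F has_vector_derivative k x) (at x)"
    by (rule einterval_antiderivative) (use k(1) in \<open>auto simp: continuous_on_eq_continuous_at\<close>)
  then obtain F where F: "\<And>x. (F has_real_derivative k x) (at x)"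
    by (auto simp: has_real_derivative_iff_has_vector_derivative)
  \<comment> \<open>The constant is chosen so that the primitive vanishes from \<open>m\<close> on;
    this bounds the support of the test function in time.\<close>
  define K where "K y = F y - F m" for y
  have K: "(K has_real_derivative k x) (at x)" for x
    unfolding K_def[abs_def] by (auto intro!: derivative_eq_intros F)
  have Km: "K y = 0" if "m \<le> y" for y
  proof (cases "m = y")
    case False
    have "F y = F m"
    proof (rule DERIV_isconst_end[of m y F])
      show "m < y" using False that by simp
      show "continuous_on {m..y} F"
        using DERIV_isCont[OF F] by (simp add: continuous_at_imp_continuous_on)
      show "(F has_real_derivative 0) (at x)" if "m < x" for x
        using F[of x] k(3)[OF that] by simp
    qed
    then show ?thesis by (simp add: K_def)
  qed (simp add: K_def)
  have Kc: "continuous_on UNIV K"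
    using K by (meson DERIV_isCont continuous_at_imp_continuous_on)
  have K0: "K y0 = - (LINT y:{y0..m}|lborel. k y)"
  proof -
    have "(\<integral>x. k x * indicator {y0..m} x \<partial>lborel) = F m - F y0"
      by (rule integral_FTC_Icc_real) (use k F in \<open>auto simp: continuous_on_eq_continuous_at\<close>)
    then show ?thesis by (simp add: K_def set_lebesgue_integral_def mult.commute)
  qed
  define t1 where "t1 = G m"
  have t1: "0 < t1" using Y_less_iff[of 0 t1] k(4) by (simp add: t1_def G Y0)
  have Yt1: "m < Y t" if "t1 < t" for t using Y_mono[OF that] by (simp add: t1_def G)
  define H where "H z = h (fst z) * K (Y (snd z))" for z :: "real \<times> real"
  define Hx where "Hx z = h1 (fst z) * K (Y (snd z))" for z :: "real \<times> real"
  define Ht where "Ht z = h (fst z) * (k (Y (snd z)) * e (snd z))" for z :: "real \<times> real"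
  define B where "B = R + t1 / c + 1"
  have hc: "continuous_on UNIV h"
    using hh(1) by (meson DERIV_isCont continuous_at_imp_continuous_on)
  interpret goursat_test p q r b c C T H Hx Ht R t1 B
  proof
    fix z :: "real \<times> real"
    have 1: "((\<lambda>z. h (fst z)) has_derivative (\<lambda>v. fst v * h1 (fst z))) (at z)"
      using has_derivative_compose[OF has_derivative_fst[OF has_derivative_ident] hh(1)[unfolded has_field_derivative_def]]
      by (simp add: mult.commute)
    have "((\<lambda>t. K (Y t)) has_real_derivative k (Y (snd z)) * e (snd z)) (at (snd z))"
      by (rule DERIV_chain2[OF K Y])
    from has_derivative_compose[OF has_derivative_snd[OF has_derivative_ident] this[unfolded has_field_derivative_def]]
    have 2: "((\<lambda>z. K (Y (snd z))) has_derivative (\<lambda>v. snd v * (k (Y (snd z)) * e (snd z)))) (at z)"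
      by (simp add: ac_simps)
    show "(H has_derivative (\<lambda>v. Hx z * fst v + Ht z * snd v)) (at z)"
      unfolding H_def[abs_def] Hx_def Ht_def
      by (rule has_derivative_eq_rhs[OF has_derivative_mult[OF 1 2]]) (auto simp: fun_eq_iff algebra_simps)
    show "H z = 0 \<and> Hx z = 0 \<and> Ht z = 0" if "R < \<bar>fst z\<bar> \<or> t1 < snd z"
      using that hh(4)[of "fst z"] Yt1[of "snd z"] Km[of "Y (snd z)"] k(3)[of "Y (snd z)"]
      by (auto simp: H_def Hx_def Ht_def)
  next
    show "continuous_on UNIV Hx" "continuous_on UNIV Ht"
      unfolding Hx_def[abs_def] Ht_def[abs_def]
      by (auto intro!: continuous_intros continuous_on_compose2[OF hh(2)] continuous_on_compose2[OF hc]
        continuous_on_compose2[OF Kc] continuous_on_compose2[OF k(1)] continuous_on_compose2[OF Y_cont] continuous_on_compose2[OF e(1)])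
  qed (use t1 hh(5) in \<open>auto simp: B_def\<close>)
  define g where "g z = ht' z * (qz z * Pz z + pz z * Qz z)" for z
  have g: "g z = h (X (fst z) (snd z)) * k (Y (T z)) * (e (T z) * J z)" for z
    by (simp add: g_def ht'_def Ht_def J_def)
  have gi: "set_integrable lborel (tri B (- B)) g"
    using set_integral_diff(1)[OF A_q(1) B_p(1)]
    by (rule set_integrable_cong[THEN iffD1, rotated -1]) (auto simp: g_def algebra_simps)
  have gpos: "0 \<le> g z" if "z \<in> \<Delta>" for z
    unfolding g using J_pos[OF that] e(2)[of "T z"] hh(3) k(2) by simp
  have tD: "tri B (- B) \<subseteq> \<Delta>" by (auto simp: tri_def \<Delta>_def)
  have "(\<integral>\<^sup>+z. indicator \<Delta> z * ennreal (g z) \<partial>lborel) = (\<integral>\<^sup>+z. ennreal (indicator (tri B (- B)) z *\<^sub>R g z) \<partial>lborel)"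
  proof (rule nn_integral_cong)
    fix z :: "real \<times> real"
    have "g z = 0" if "z \<in> \<Delta>" "z \<notin> tri B (- B)"
      using supp'(3)[of z] that by (simp add: g_def \<Delta>_def)
    then show "indicator \<Delta> z * ennreal (g z) = ennreal (indicator (tri B (- B)) z *\<^sub>R g z)"
      using tD by (auto simp: indicator_def)
  qed
  also have "\<dots> = ennreal (LINT z:tri B (- B)|lborel. g z)"
    unfolding set_lebesgue_integral_def
  proof (rule nn_integral_eq_integral)
    show "integrable lborel (\<lambda>z. indicator (tri B (- B)) z *\<^sub>R g z)"
      using gi by (simp add: set_integrable_def)
    show "AE z in lborel. 0 \<le> indicator (tri B (- B)) z *\<^sub>R g z"
      using gpos[OF subsetD[OF tD]] by (intro AE_I2) (simp add: indicator_def)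
  qed
  also have "(LINT z:tri B (- B)|lborel. g z) = - (LINT u:{- B..B}|lborel. H (u, 0))"
    unfolding g_def by (rule area_identity)
  also have "\<dots> = (LINT x|lborel. h x) * (LINT y:{y0..m}|lborel. k y)"
  proof -
    have "indicator {- B..B} u *\<^sub>R H (u, 0) = h u * K y0" for u
    proof -
      have "0 < t1 / c" using t1 c(1) by simp
      then have "R < B" by (simp add: B_def)
      then show ?thesis using hh(4)[of u] by (cases "u \<in> {- B..B}") (auto simp: H_def Y0)
    qed
    then have "(LINT u:{- B..B}|lborel. H (u, 0)) = (LINT u|lborel. h u) * K y0"
      unfolding set_lebesgue_integral_def by simp
    then show ?thesis by (simp add: K0)
  qed
  finally show ?thesis by (simp add: g)
qed

text \<open>The expansion estimate holds in the coordinates (x, t), the weak equations live in (x,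
  y); hence the two versions.\<close>

definition \<Psi> :: "real \<times> real \<Rightarrow> real \<times> real" where "\<Psi> z = (X (fst z) (snd z), T z)"
definition \<Psi>Y :: "real \<times> real \<Rightarrow> real \<times> real" where "\<Psi>Y z = (X (fst z) (snd z), Y (T z))"

lemma \<Psi>Y_borel [measurable]: "\<Psi>Y \<in> borel_measurable borel"
  unfolding \<Psi>Y_def[abs_def] by measurable

lemma upper_borel [measurable]: "{w :: real \<times> real. y0 \<le> snd w} \<in> sets borel"
  by (intro borel_closed closed_Collect_le continuous_intros)

text \<open>\<open>nn_integral_product\<close> evaluates both measures on products of cut-offs, and
  these determine them. This stands in for a pointwise Jacobian formula, as the map has only weak
  derivatives. The factor e(T) accounts for dy = e dt.\<close>

lemma pushforward:
  "density lborel (indicator {w. y0 \<le> snd w}) =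
    distr (density lborel (\<lambda>z. indicator \<Delta> z * ennreal (e (T z) * J z))) borel \<Psi>Y" (is "?M = ?N")
proof (rule measure_eqI_bump)
  show "emeasure ?M (box l u) \<noteq> \<infinity>" for l u
  proof -
    have "emeasure ?M (box l u) = (\<integral>\<^sup>+w. indicator {w. y0 \<le> snd w} w * indicator (box l u) w \<partial>lborel)"
      by (rule emeasure_density) auto
    also have "\<dots> \<le> (\<integral>\<^sup>+w. indicator (box l u) w \<partial>lborel)"
      by (rule nn_integral_mono) (auto simp: indicator_def)
    also have "\<dots> = emeasure lborel (box l u)" by simp
    also have "\<dots> < \<infinity>" using emeasure_lborel_box_finite by auto
    finally show ?thesis by simp
  qed
  fix l1 u1 l2 u2 :: real and n :: nat
  assume lu: "l1 \<le> u1" "l2 \<le> u2"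
  let ?b1 = "bump l1 u1 n" and ?b2 = "bump l2 u2 n"
  define R where "R = max \<bar>l1\<bar> \<bar>u1\<bar> + 1"
  define m where "m = max u2 y0 + 1"
  have b1: "?b1 x = 0 \<and> bump' l1 u1 n x = 0" if "R < \<bar>x\<bar>" for x
    using that lu by (intro conjI bump_outside bump'_outside) (auto simp: R_def)
  have b2: "?b2 y = 0" if "m < y" for y
    using that lu by (intro bump_outside) (auto simp: m_def)
  have b1_ind: "(\<lambda>x. indicator {- R..R} x *\<^sub>R ?b1 x) = ?b1"
  proof
    show "indicator {- R..R} x *\<^sub>R ?b1 x = ?b1 x" for x
      using b1[of x] by (cases "x \<in> {- R..R}") auto
  qed
  have i1: "integrable lborel ?b1"
    using bump_set_integrable[of "-R" R l1 u1 n] unfolding set_integrable_def b1_ind .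
  have "(\<integral>\<^sup>+w. ennreal (?b1 (fst w) * ?b2 (snd w)) \<partial>?M)
      = (\<integral>\<^sup>+w. ennreal (?b1 (fst w)) * ennreal (indicator {y0..m} (snd w) *\<^sub>R ?b2 (snd w)) \<partial>(lborel \<Otimes>\<^sub>M lborel))"
    unfolding lborel_prod
  proof (subst nn_integral_density)
    show "(\<integral>\<^sup>+w. indicator {w. y0 \<le> snd w} w * ennreal (?b1 (fst w) * ?b2 (snd w)) \<partial>lborel)
       = (\<integral>\<^sup>+w. ennreal (?b1 (fst w)) * ennreal (indicator {y0..m} (snd w) *\<^sub>R ?b2 (snd w)) \<partial>lborel)"
    proof (rule nn_integral_cong)
      fix w :: "real \<times> real"
      show "indicator {w. y0 \<le> snd w} w * ennreal (?b1 (fst w) * ?b2 (snd w)) =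
          ennreal (?b1 (fst w)) * ennreal (indicator {y0..m} (snd w) *\<^sub>R ?b2 (snd w))"
        using b2[of "snd w"] by (auto simp: indicator_def ennreal_mult bump_nonneg)
    qed
  qed measurable
  also have "\<dots> = (\<integral>\<^sup>+x. \<integral>\<^sup>+y. ennreal (?b1 x) * ennreal (indicator {y0..m} y *\<^sub>R ?b2 y) \<partial>lborel \<partial>lborel)"
    by (subst lborel.nn_integral_fst[symmetric]) auto
  also have "\<dots> = (\<integral>\<^sup>+x. ennreal (?b1 x) \<partial>lborel) * (\<integral>\<^sup>+y. ennreal (indicator {y0..m} y *\<^sub>R ?b2 y) \<partial>lborel)"
    by (simp add: nn_integral_cmult nn_integral_multc del: real_scaleR_def)
  also have "(\<integral>\<^sup>+x. ennreal (?b1 x) \<partial>lborel) = ennreal (LINT x|lborel. ?b1 x)"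
    by (rule nn_integral_eq_integral[OF i1]) (simp add: bump_nonneg)
  also have "(\<integral>\<^sup>+y. ennreal (indicator {y0..m} y *\<^sub>R ?b2 y) \<partial>lborel) = ennreal (LINT y:{y0..m}|lborel. ?b2 y)"
    unfolding set_lebesgue_integral_def
    by (rule nn_integral_eq_integral) (use bump_set_integrable[of y0 m l2 u2 n] in \<open>auto simp: set_integrable_def bump_nonneg\<close>)
  also have "ennreal (LINT x|lborel. ?b1 x) * ennreal (LINT y:{y0..m}|lborel. ?b2 y)
      = ennreal ((LINT x|lborel. ?b1 x) * (LINT y:{y0..m}|lborel. ?b2 y))"
    by (rule ennreal_mult[symmetric])
      (auto simp: set_lebesgue_integral_def bump_nonneg intro!: Bochner_Integration.integral_nonneg)
  also have "\<dots> = (\<integral>\<^sup>+z. indicator \<Delta> z * ennreal (?b1 (X (fst z) (snd z)) * ?b2 (Y (T z)) * (e (T z) * J z)) \<partial>lborel)"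
    by (rule nn_integral_product[symmetric, where ?h1.0="bump' l1 u1 n" and R=R])
      (use b1 b2 in \<open>auto simp: DERIV_bump continuous_bump bump_nonneg R_def m_def\<close>)
  also have "\<dots> = (\<integral>\<^sup>+z. (indicator \<Delta> z * ennreal (e (T z) * J z)) * ennreal (?b1 (X (fst z) (snd z)) * ?b2 (Y (T z))) \<partial>lborel)"
    by (rule nn_integral_cong)
      (auto simp: indicator_def ennreal_mult''[symmetric] bump_nonneg mult.commute)
  also have "\<dots> = (\<integral>\<^sup>+z. ennreal (?b1 (fst (\<Psi>Y z)) * ?b2 (snd (\<Psi>Y z))) \<partial>density lborel (\<lambda>z. indicator \<Delta> z * ennreal (e (T z) * J z)))"
    by (subst nn_integral_density) (auto simp: \<Psi>Y_def)
  also have "\<dots> = (\<integral>\<^sup>+w. ennreal (?b1 (fst w) * ?b2 (snd w)) \<partial>?N)"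
    by (subst nn_integral_distr) auto
  finally show "(\<integral>\<^sup>+w. ennreal (?b1 (fst w) * ?b2 (snd w)) \<partial>?M) = (\<integral>\<^sup>+w. ennreal (?b1 (fst w) * ?b2 (snd w)) \<partial>?N)" .
qed auto

lemma change_of_variables:
  fixes f :: "real \<times> real \<Rightarrow> real"
  assumes [measurable]: "f \<in> borel_measurable borel"
  shows "(LINT w:{w. y0 \<le> snd w}|lborel. f w) = (LINT z:\<Delta>|lborel. f (\<Psi>Y z) * (e (T z) * J z))"
proof -
  have "(LINT w:{w. y0 \<le> snd w}|lborel. f w) = (LINT w|density lborel (\<lambda>w. ennreal (indicator {w. y0 \<le> snd w} w)). f w)"
    unfolding set_lebesgue_integral_def by (subst integral_density) auto
  also have "density lborel (\<lambda>w::real\<times>real. ennreal (indicator {w. y0 \<le> snd w} w)) =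
      distr (density lborel (\<lambda>z. indicator \<Delta> z * ennreal (e (T z) * J z))) borel \<Psi>Y"
    using pushforward by (simp add: ennreal_indicator)
  also have "(\<lambda>z. indicator \<Delta> z * ennreal (e (T z) * J z)) = (\<lambda>z. ennreal (indicator \<Delta> z * (e (T z) * J z)))"
    by (auto simp: fun_eq_iff indicator_def)
  also have "(LINT w|distr (density lborel \<dots>) borel \<Psi>Y. f w)
      = (LINT z:\<Delta>|lborel. f (\<Psi>Y z) * (e (T z) * J z))"
  proof (subst integral_distr)
    have pos: "0 \<le> indicator \<Delta> z * (e (T z) * J z)" for z
      using J_pos[of z] e(2)[of "T z"] by (auto simp: indicator_def)
    show "(LINT z|density lborel (\<lambda>z. ennreal (indicator \<Delta> z * (e (T z) * J z))). f (\<Psi>Y z))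
       = (LINT z:\<Delta>|lborel. f (\<Psi>Y z) * (e (T z) * J z))"
      unfolding set_lebesgue_integral_def
      by (subst integral_density) (use pos in \<open>auto simp: ac_simps\<close>)
  qed auto
  finally show ?thesis .
qed

text \<open>If both feet move the same way, the increments of X add up, as \<open>p\<close> and
  \<open>q\<close> are at least \<open>c\<close>. If they move in opposite directions, those of T
  add up, as \<open>P\<close> and \<open>Q\<close> are at least \<open>c\<close>. So one of the two
  coordinates always separates the points.\<close>

lemma \<Psi>_expanding:
  assumes "z \<in> \<Delta>" "w \<in> \<Delta>"
  shows "c * dist z w \<le> 2 * dist (\<Psi> z) (\<Psi> w)"
proof -
  have *: "c * (\<bar>\<xi>1 - \<xi>2\<bar> + \<bar>\<eta>1 - \<eta>2\<bar>) \<le> max \<bar>X \<xi>1 \<eta>1 - X \<xi>2 \<eta>2\<bar> \<bar>T (\<xi>1, \<eta>1) - T (\<xi>2, \<eta>2)\<bar>"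
    if o: "\<eta>1 \<le> \<xi>1" "\<eta>2 \<le> \<xi>2" "\<xi>1 \<le> \<xi>2" for \<xi>1 \<xi>2 \<eta>1 \<eta>2
  proof (cases "\<eta>1 \<le> \<eta>2")
    case True
    have "X \<xi>2 \<eta>2 - X \<xi>1 \<eta>1 = (LINT s:{\<eta>1..\<eta>2}|lborel. q s) + (LINT s:{\<xi>1..\<xi>2}|lborel. p s)"
      using X_split(2)[OF True o(2)] X_split(1)[OF o(1,3)] by simp
    moreover have "c * (\<eta>2 - \<eta>1) \<le> (LINT s:{\<eta>1..\<eta>2}|lborel. q s)"
      "c * (\<xi>2 - \<xi>1) \<le> (LINT s:{\<xi>1..\<xi>2}|lborel. p s)"
      using True o c by (auto intro!: set_integral_Icc_ge p_int q_int)
    ultimately show ?thesis using True o by (simp add: distrib_left)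
  next
    case False
    have "T (\<xi>2, \<eta>2) - T (\<xi>1, \<eta>1) = (LINT s:{\<xi>1..\<xi>2}|lborel. P s \<eta>2) - (LINT s:{\<eta>2..\<eta>1}|lborel. - Q \<xi>1 s)"
      using T_split(1)[of \<eta>2 \<xi>1 \<xi>2] T_split(2)[of \<eta>2 \<eta>1 \<xi>1] o False by simp
    moreover have "c * (\<xi>2 - \<xi>1) \<le> (LINT s:{\<xi>1..\<xi>2}|lborel. P s \<eta>2)"
      by (rule set_integral_Icc_ge) (use PQ_bounds o False in
          \<open>auto intro!: set_integrable_subset[OF P_int[of \<eta>2 \<xi>2]]\<close>)
    moreover have "c * (\<eta>1 - \<eta>2) \<le> (LINT s:{\<eta>2..\<eta>1}|lborel. Q \<xi>1 s)"
      by (rule set_integral_Icc_ge) (use PQ_bounds o False in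
          \<open>auto intro!: set_integrable_subset[OF Q_int[of \<eta>2 \<xi>1]]\<close>)
    ultimately show ?thesis using False o by (simp add: distrib_left set_lebesgue_integral_def)
  qed
  obtain \<xi>1 \<eta>1 \<xi>2 \<eta>2 where zw: "z = (\<xi>1, \<eta>1)" "w = (\<xi>2, \<eta>2)" by (metis prod.exhaust)
  have "c * (\<bar>\<xi>1 - \<xi>2\<bar> + \<bar>\<eta>1 - \<eta>2\<bar>) \<le> max \<bar>X \<xi>1 \<eta>1 - X \<xi>2 \<eta>2\<bar> \<bar>T (\<xi>1, \<eta>1) - T (\<xi>2, \<eta>2)\<bar>"
    using *[of \<eta>1 \<xi>1 \<eta>2 \<xi>2] *[of \<eta>2 \<xi>2 \<eta>1 \<xi>1] assms
    by (cases "\<xi>1 \<le> \<xi>2") (auto simp: \<Delta>_def zw abs_minus_commute)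
  moreover have "dist z w \<le> \<bar>\<xi>1 - \<xi>2\<bar> + \<bar>\<eta>1 - \<eta>2\<bar>"
    using norm_Pair_le[of "\<xi>1 - \<xi>2" "\<eta>1 - \<eta>2"] by (simp add: zw dist_norm)
  then have "c * dist z w \<le> c * (\<bar>\<xi>1 - \<xi>2\<bar> + \<bar>\<eta>1 - \<eta>2\<bar>)"
    using c(1) by (simp add: mult_left_mono)
  moreover have "max \<bar>X \<xi>1 \<eta>1 - X \<xi>2 \<eta>2\<bar> \<bar>T (\<xi>1, \<eta>1) - T (\<xi>2, \<eta>2)\<bar> \<le> dist (\<Psi> z) (\<Psi> w)"
    using norm_fst_le[of "X \<xi>1 \<eta>1 - X \<xi>2 \<eta>2" "T (\<xi>1, \<eta>1) - T (\<xi>2, \<eta>2)"]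
      norm_snd_le[of "T (\<xi>1, \<eta>1) - T (\<xi>2, \<eta>2)" "X \<xi>1 \<eta>1 - X \<xi>2 \<eta>2"]
    by (simp add: zw \<Psi>_def dist_norm)
  ultimately show ?thesis using zero_le_dist[of "\<Psi> z" "\<Psi> w"] by linarith
qed

lemma \<Psi>_cont: "continuous_on UNIV \<Psi>"
  unfolding \<Psi>_def[abs_def] X_def
  by (intro continuous_intros T_cont continuous_Icc_integral[where C=1] continuous_on_compose2[OF T_cont])
    (use pq1 in \<open>auto simp: less_imp_le\<close>)

lemma \<Psi>_inj: "inj_on \<Psi> \<Delta>"
proof (rule inj_onI)
  fix z w assume "z \<in> \<Delta>" "w \<in> \<Delta>" "\<Psi> z = \<Psi> w"
  then have "c * dist z w \<le> 0" using \<Psi>_expanding[of z w] by simp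
  then show "z = w" using c(1) by (simp add: mult_le_0_iff)
qed

text \<open>Surjectivity of \<open>\<Psi>\<close> is not needed: by the change of variables its image has full measure in
  the half plane, so any element of \<open>\<Delta>\<close> serves as the value of the inverse elsewhere.\<close>

definition \<Theta> :: "real \<times> real \<Rightarrow> real \<times> real" where
  "\<Theta> w = (if w \<in> \<Psi> ` \<Delta> then inv_into \<Delta> \<Psi> w else 0)"

lemma \<Theta>_\<Psi>: "z \<in> \<Delta> \<Longrightarrow> \<Theta> (\<Psi> z) = z"
  by (simp add: \<Theta>_def \<Psi>_inj)

lemma \<Theta>_cases: "\<Theta> w \<in> \<Delta>" "\<Theta> w = 0 \<or> \<Psi> (\<Theta> w) = w"
  by (auto simp: \<Theta>_def \<Psi>_inj inv_into_into f_inv_into_f) (auto simp: \<Delta>_def)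

text \<open>The image of \<Delta> is a countable union of compact sets, hence Borel, and the inverse
  is Lipschitz on it by \<open>\<Psi>_expanding\<close>.\<close>

lemma \<Theta>_borel [measurable]: "\<Theta> \<in> borel_measurable borel"
  unfolding \<Theta>_def[abs_def]
proof (rule borel_measurable_continuous_on_if)
  have "\<Psi> ` \<Delta> = (\<Union>n::nat. \<Psi> ` (\<Delta> \<inter> cball 0 n))"
    using real_arch_simple by (fastforce simp: image_iff)
  moreover have "compact (\<Psi> ` (\<Delta> \<inter> cball 0 n))" for n :: nat
    by (intro compact_continuous_image continuous_on_subset[OF \<Psi>_cont] closed_Int_compact \<Delta>_closed) auto
  ultimately show "\<Psi> ` \<Delta> \<in> sets borel"
    by (auto simp: compact_imp_closed)
  have "(2 / c)-lipschitz_on (\<Psi> ` \<Delta>) (inv_into \<Delta> \<Psi>)"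
  proof (rule lipschitz_onI)
    fix x y assume xy: "x \<in> \<Psi> ` \<Delta>" "y \<in> \<Psi> ` \<Delta>"
    have "c * dist (inv_into \<Delta> \<Psi> x) (inv_into \<Delta> \<Psi> y) \<le> 2 * dist x y"
      using \<Psi>_expanding[OF inv_into_into[OF xy(1)] inv_into_into[OF xy(2)]] xy by (simp add: f_inv_into_f)
    then show "dist (inv_into \<Delta> \<Psi> x) (inv_into \<Delta> \<Psi> y) \<le> 2 / c * dist x y"
      using c(1) by (simp add: field_simps)
  qed (use c(1) in simp)
  then show "continuous_on (\<Psi> ` \<Delta>) (inv_into \<Delta> \<Psi>)" by (rule lipschitz_on_continuous_on)
qed auto

end

subsection \<open>Weak solutions of the Gauss--Codazzi equations\<close>

locale gauss_codazzi_goursat = goursat_time +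
  fixes E E' :: "real \<Rightarrow> real" and D y1 :: real
  assumes E: "\<And>y. 0 < E y" "\<And>y. (E has_real_derivative E' y) (at y)" "continuous_on UNIV E'"
    and D: "0 < D" and y01: "y0 < y1"
    and e_E: "\<And>t. 0 \<le> t \<Longrightarrow> Y t \<le> y1 \<Longrightarrow> e t = E (Y t)"
    and b_E: "\<And>t. 0 \<le> t \<Longrightarrow> Y t \<le> y1 \<Longrightarrow> b t = - E' (Y t) / (2 * E (Y t))"
begin

lemma E_cont: "continuous_on UNIV E"
  using E(2) by (meson DERIV_isCont continuous_at_imp_continuous_on)

lemma E_borel [measurable]: "E \<in> borel_measurable borel" "E' \<in> borel_measurable borel"
  by (rule borel_measurable_continuous_onI, rule E_cont E(3))+

lemma G_mono: "y \<le> y' \<Longrightarrow> G y \<le> G y'"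
  using Y_le_iff[of "G y" "G y'"] by (simp add: G(2))

lemma G_borel [measurable]: "G \<in> borel_measurable borel"
  using G_mono by (intro borel_measurable_mono monoI)

text \<open>For \<open>w\<close> in the image of \<Delta>, the labels of the two characteristics
  through \<open>w\<close>; the height is first converted from y to t = G y.\<close>

definition foot :: "real \<times> real \<Rightarrow> real \<times> real" where "foot w = \<Theta> (fst w, G (snd w))"

lemma foot_borel [measurable]: "foot \<in> borel_measurable borel"
  unfolding foot_def[abs_def] by measurable

lemma foot_\<Delta>: "foot w \<in> \<Delta>" by (simp add: foot_def \<Theta>_cases)

lemma foot_\<Psi>Y: "z \<in> \<Delta> \<Longrightarrow> foot (\<Psi>Y z) = z"
  using \<Theta>_\<Psi>[of z] by (simp add: foot_def \<Psi>Y_def \<Psi>_def G)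

text \<open>These are \<open>\<gamma>/v\<close>, \<open>-\<gamma>u/v\<close>, \<open>\<gamma>(u\<^sup>2 - v\<^sup>2)/v\<close> for \<open>\<gamma> = \<surd>D/(2E)\<close>, \<open>E(u + v) = p/P\<close>, \<open>E(u - v) = -q/Q\<close>.\<close>

definition L :: "real \<times> real \<Rightarrow> real" where
  "L w = (let z = foot w in sqrt D * (P (fst z) (snd z) * Q (fst z) (snd z)) / J z)"
definition M :: "real \<times> real \<Rightarrow> real" where
  "M w = (let z = foot w in - sqrt D / (2 * E (snd w))
      * (p (fst z) * Q (fst z) (snd z) - q (snd z) * P (fst z) (snd z)) / J z)"
definition N :: "real \<times> real \<Rightarrow> real" where
  "N w = (let z = foot w in - sqrt D / (E (snd w))\<^sup>2 * (p (fst z) * q (snd z)) / J z)"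

lemma P_borel_foot [measurable]: "(\<lambda>w. P (fst (foot w)) (snd (foot w))) \<in> borel_measurable borel"
  and Q_borel_foot [measurable]: "(\<lambda>w. Q (fst (foot w)) (snd (foot w))) \<in> borel_measurable borel"
  using measurable_compose[OF foot_borel P_borel2] measurable_compose[OF foot_borel Q_borel2] by simp_all

lemma LMN_borel [measurable]: "L \<in> borel_measurable borel" "M \<in> borel_measurable borel" "N \<in> borel_measurable borel"
  unfolding L_def[abs_def] M_def[abs_def] N_def[abs_def] Let_def by measurable

lemma PQ_\<Delta>: "z \<in> \<Delta> \<Longrightarrow> 0 < P (fst z) (snd z)" "z \<in> \<Delta> \<Longrightarrow> 0 < Q (fst z) (snd z)"
  using PQ_bounds[of "snd z" "fst z"] c(1) by (auto simp: \<Delta>_def)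

lemma L_pos: "0 < L w"
  using PQ_\<Delta>[OF foot_\<Delta>[of w]] J_pos[OF foot_\<Delta>[of w]] D by (simp add: L_def Let_def)

text \<open>The identity 4 P Q p q + (p Q - q P)^2 = J^2. It is algebraic in the four values at
  \<open>foot w\<close>, so it holds also where \<open>foot\<close> takes its default value.\<close>

lemma gauss_equation: "L w * N w - (M w)\<^sup>2 = - D / (4 * (E (snd w))\<^sup>2)"
proof -
  define z where "z = foot w"
  define PP QQ pp qq j y where defs: "PP = P (fst z) (snd z)" "QQ = Q (fst z) (snd z)" "pp = p (fst z)" "qq = q (snd z)"
    "j = J z" "y = E (snd w)"
  have j: "j = qq * PP + pp * QQ" "0 < j" using J_pos[OF foot_\<Delta>[of w]] by (auto simp: defs J_def z_def)
  have y: "0 < y" using E(1) by (simp add: defs)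
  have s: "sqrt D * sqrt D = D" using D by simp
  have "L w * N w - (M w)\<^sup>2 = (sqrt D * (PP * QQ) / j) * (- sqrt D / y\<^sup>2 * (pp * qq) / j)
     - (- sqrt D / (2 * y) * (pp * QQ - qq * PP) / j)\<^sup>2"
    by (simp add: L_def M_def N_def Let_def defs z_def)
  also have "\<dots> = - (sqrt D * sqrt D) * (4 * (PP * QQ * pp * qq) + (pp * QQ - qq * PP)\<^sup>2) / (4 * y\<^sup>2 * j\<^sup>2)"
    using y j(2) by (simp add: power2_eq_square field_simps)
  also have "4 * (PP * QQ * pp * qq) + (pp * QQ - qq * PP)\<^sup>2 = j\<^sup>2"
    by (simp add: j(1) power2_eq_square algebra_simps)
  also have "- (sqrt D * sqrt D) * j\<^sup>2 / (4 * y\<^sup>2 * j\<^sup>2) = - D / (4 * y\<^sup>2)"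
    using j(2) s by simp
  finally show ?thesis by (simp add: defs)
qed

text \<open>On the strip the time is at most \<open>G y1\<close>, and \<open>T_ge\<close> bounds the
  distance of the feet by it. The default value 0 has equal feet.\<close>

lemma foot_bound:
  assumes "snd w \<le> y1"
  shows "c * (fst (foot w) - snd (foot w)) \<le> G y1"
proof -
  define z where "z = (fst w, G (snd w))"
  have G0: "0 \<le> G y1" using G_mono[of y0 y1] y01 G(1)[of 0] Y0 by simp
  have "\<Theta> z = 0 \<or> \<Psi> (\<Theta> z) = z" by (rule \<Theta>_cases)
  then show ?thesis
  proof
    assume "\<Theta> z = 0"
    then show ?thesis using G0 by (simp add: foot_def z_def)
  next
    assume a: "\<Psi> (\<Theta> z) = z"
    have "c * (fst (\<Theta> z) - snd (\<Theta> z)) \<le> T (\<Theta> z)"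
      using T_ge[of "snd (\<Theta> z)" "fst (\<Theta> z)"] \<Theta>_cases(1)[of z] by (simp add: \<Delta>_def)
    also have "T (\<Theta> z) = G (snd w)" using a by (simp add: \<Psi>_def z_def prod_eq_iff)
    also have "\<dots> \<le> G y1" by (rule G_mono[OF assms])
    finally show ?thesis by (simp add: foot_def z_def)
  qed
qed

lemma LMN_bounded:
  obtains K where "0 \<le> K" "\<And>w. y0 \<le> snd w \<Longrightarrow> snd w \<le> y1 \<Longrightarrow> \<bar>L w\<bar> \<le> K \<and> \<bar>M w\<bar> \<le> K \<and> \<bar>N w\<bar> \<le> K"
proof -
  obtain m where m: "m \<in> {y0..y1}" "\<And>y. y \<in> {y0..y1} \<Longrightarrow> E m \<le> E y"
    using continuous_attains_inf[of "{y0..y1}" E] continuous_on_subset[OF E_cont] y01 by force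
  define Em where "Em = E m"
  have Em: "0 < Em" using E(1) by (simp add: Em_def)
  define Pm where "Pm = C + C * (G y1 / c)"
  define K where "K = sqrt D * Pm / c + sqrt D / (2 * Em) + sqrt D / (Em\<^sup>2 * c)"
  have Pm: "0 \<le> Pm"
    using C_pos c(1) G_mono[of y0 y1] y01 G(1)[of 0] Y0 by (simp add: Pm_def)
  have K0: "0 \<le> sqrt D * Pm / c" "0 \<le> sqrt D / (2 * Em)" "0 \<le> sqrt D / (Em\<^sup>2 * c)"
    using Pm Em D c(1) by auto
  have "\<bar>L w\<bar> \<le> K \<and> \<bar>M w\<bar> \<le> K \<and> \<bar>N w\<bar> \<le> K" if w: "y0 \<le> snd w" "snd w \<le> y1" for w
  proof -
    define z where "z = foot w"
    have z: "z \<in> \<Delta>" by (simp add: z_def foot_\<Delta>)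
    define PP QQ pp qq j y where defs: "PP = P (fst z) (snd z)" "QQ = Q (fst z) (snd z)" "pp = p (fst z)" "qq = q (snd z)"
      "j = J z" "y = E (snd w)"
    have j: "j = qq * PP + pp * QQ" "0 < j" using J_pos[OF z] by (auto simp: defs J_def)
    have y: "Em \<le> y" using m(2) w by (simp add: defs Em_def)
    have "fst z - snd z \<le> G y1 / c" using foot_bound[OF w(2)] c(1) by (simp add: z_def pos_le_divide_eq mult.commute)
    then have "C * (fst z - snd z) \<le> C * (G y1 / c)" using C_pos by (intro mult_left_mono) auto
    then have P: "c \<le> PP" "PP \<le> Pm" "c \<le> QQ"
      using PQ_bounds[of "snd z" "fst z"] z by (auto simp: defs \<Delta>_def Pm_def)
    have p: "c \<le> pp" "c \<le> qq" "pp \<le> 1" "qq \<le> 1" using c(2)[of "fst z"] c(3)[of "snd z"] pq1[of "fst z"] pq1[of "snd z"] by (auto simp: defs)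
    have pos: "0 < PP" "0 < QQ" "0 < pp" "0 < qq" using P p c(1) by auto
    \<comment> \<open>J is the sum of the positive terms q P and p Q. Keeping only the second gives
      J \<ge> c Q, used here for L; keeping only the first gives J \<ge> c q, used below for N. For
      M the whole of J is needed.\<close>
    have "PP * QQ / j \<le> Pm / c"
    proof -
      have "PP * QQ * c \<le> Pm * (pp * QQ)"
        using mult_mono[OF mult_mono[OF P(2) p(1)] order_refl[of QQ]] pos c(1) Pm by (simp add: ac_simps)
      also have "\<dots> \<le> Pm * j" using Pm pos by (intro mult_left_mono) (auto simp: j(1))
      finally show ?thesis using j(2) c(1) by (simp add: frac_le_eq field_simps)
    qed
    then have "sqrt D * (PP * QQ / j) \<le> sqrt D * (Pm / c)" using D by (intro mult_left_mono) auto
    moreover have "0 \<le> sqrt D * (PP * QQ / j)" using D pos j(2) by auto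
    ultimately have 1: "\<bar>L w\<bar> \<le> sqrt D * Pm / c" by (simp add: L_def Let_def defs z_def)
    have "\<bar>(pp * QQ - qq * PP) / j\<bar> \<le> 1" using j pos by (simp add: abs_le_iff field_simps)
    moreover have "\<bar>- sqrt D / (2 * y)\<bar> \<le> sqrt D / (2 * Em)" using y Em D by (simp add: frac_le)
    ultimately have "\<bar>- sqrt D / (2 * y)\<bar> * \<bar>(pp * QQ - qq * PP) / j\<bar> \<le> sqrt D / (2 * Em) * 1"
      using K0 by (intro mult_mono) auto
    then have 2: "\<bar>M w\<bar> \<le> sqrt D / (2 * Em)" by (simp add: M_def Let_def defs z_def abs_mult abs_divide)
    have "pp * qq / j \<le> 1 / c"
    proof -
      have "pp * qq * c \<le> 1 * (qq * PP)"
        using mult_mono[OF mult_mono[OF p(3) P(1)] order_refl[of qq]] pos c(1) by (simp add: ac_simps)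
      also have "\<dots> \<le> j" using pos by (simp add: j(1))
      finally show ?thesis using j(2) c(1) by (simp add: field_simps)
    qed
    moreover have "sqrt D / y\<^sup>2 \<le> sqrt D / Em\<^sup>2" using y Em D by (intro divide_left_mono power_mono) auto
    ultimately have "sqrt D / y\<^sup>2 * (pp * qq / j) \<le> sqrt D / Em\<^sup>2 * (1 / c)"
      using D pos j(2) by (intro mult_mono) auto
    moreover have "\<bar>N w\<bar> = sqrt D / y\<^sup>2 * (pp * qq / j)"
      using D pos j(2) by (simp add: N_def Let_def defs[symmetric] z_def[symmetric] abs_mult abs_divide)
    ultimately have 3: "\<bar>N w\<bar> \<le> sqrt D / (Em\<^sup>2 * c)" by simp
    show ?thesis using 1 2 3 K0 unfolding K_def by linarith
  qed
  then show thesis using K0 by (intro that[of K]) (auto simp: K_def)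
qed

end

section \<open>Pairing L, M and N with test functions\<close>

locale gauss_codazzi_test = gauss_codazzi_goursat +
  fixes \<phi> \<phi>x \<phi>y :: "real \<times> real \<Rightarrow> real" and K :: "(real \<times> real) set"
  assumes \<phi>: "\<And>w. (\<phi> has_derivative (\<lambda>v. \<phi>x w * fst v + \<phi>y w * snd v)) (at w)"
    and \<phi>c: "continuous_on UNIV \<phi>x" "continuous_on UNIV \<phi>y"
    and K: "compact K" "K \<subseteq> UNIV \<times> {..<y1}" "\<And>w. w \<notin> K \<Longrightarrow> \<phi> w = 0"
begin

lemma \<phi>_cont: "continuous_on UNIV \<phi>"
  using \<phi> by (meson continuous_at_imp_continuous_on has_derivative_continuous)

lemma \<phi>_zero: "w \<notin> K \<Longrightarrow> \<phi> w = 0 \<and> \<phi>x w = 0 \<and> \<phi>y w = 0"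
proof -
  assume w: "w \<notin> K"
  have "((\<lambda>_. 0) has_derivative (\<lambda>v. 0)) (at w)" by simp
  then have "(\<phi> has_derivative (\<lambda>v. 0)) (at w)"
    by (rule has_derivative_transform_within_open[where s="- K"])
      (use w K(3) open_Compl[OF compact_imp_closed[OF K(1)]] in auto)
  from has_derivative_unique[OF \<phi>[of w] this]
  have "\<phi>x w * fst v + \<phi>y w * snd v = 0" for v by (simp add: fun_eq_iff)
  from this[of "(1, 0)"] this[of "(0, 1)"] show ?thesis using K(3)[OF w] by simp
qed

lemma \<phi>_zero': "y1 \<le> snd w \<Longrightarrow> \<phi> w = 0 \<and> \<phi>x w = 0 \<and> \<phi>y w = 0"
proof -
  assume "y1 \<le> snd w"
  then have "w \<notin> K" using K(2) by auto
  then show ?thesis by (rule \<phi>_zero)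
qed

lemma \<phi>_borel [measurable]: "\<phi> \<in> borel_measurable borel" "\<phi>x \<in> borel_measurable borel" "\<phi>y \<in> borel_measurable borel"
  by (rule borel_measurable_continuous_onI, rule \<phi>_cont \<phi>c)+

lemma product_integrable:
  fixes f g :: "real \<times> real \<Rightarrow> real"
  assumes [measurable]: "f \<in> borel_measurable borel" "g \<in> borel_measurable borel"
    and f: "continuous_on UNIV f" "\<And>w. w \<notin> K \<Longrightarrow> f w = 0"
    and g: "\<And>w. y0 \<le> snd w \<Longrightarrow> snd w \<le> y1 \<Longrightarrow> \<bar>g w\<bar> \<le> W"
  shows "set_integrable lborel {w. y0 \<le> snd w} (\<lambda>w. g w * f w)"
proof -
  have [measurable]: "K \<in> sets borel" using compact_imp_closed[OF K(1)] by (rule borel_closed)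
  obtain F where F: "\<And>w. w \<in> K \<Longrightarrow> \<bar>f w\<bar> \<le> F"
    using continuous_bounded_on_compact[OF f(1) K(1)] by blast
  have "set_integrable lborel ({w. y0 \<le> snd w} \<inter> K) (\<lambda>w. g w * f w)"
  proof (rule set_integrable_bounded_set[where C="\<bar>W\<bar> * F"])
    show "bounded ({w. y0 \<le> snd w} \<inter> K)" using K(1) compact_imp_bounded by (auto intro: bounded_Int)
    fix w assume w: "w \<in> {w. y0 \<le> snd w} \<inter> K"
    then have "snd w \<le> y1" using K(2) by auto
    then show "norm (g w * f w) \<le> \<bar>W\<bar> * F"
      unfolding real_norm_def abs_mult using g[of w] F[of w] w by (intro mult_mono) auto
  qed measurable
  moreover have "(\<lambda>w. indicator ({w. y0 \<le> snd w} \<inter> K) w *\<^sub>R (g w * f w)) = (\<lambda>w. indicator {w. y0 \<le> snd w} w *\<^sub>R (g w * f w))"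
    using f(2) by (auto simp: indicator_def fun_eq_iff)
  ultimately show ?thesis by (simp add: set_integrable_def)
qed

lemma LMN_integrable:
  assumes "f \<in> {\<phi>, \<phi>x, \<phi>y}" "g \<in> {L, M, N}" and k: "continuous_on UNIV k"
  shows "set_integrable lborel {w. y0 \<le> snd w} (\<lambda>w. k (snd w) * g w * f w)"
proof -
  obtain W where W: "0 \<le> W" "\<And>w. y0 \<le> snd w \<Longrightarrow> snd w \<le> y1 \<Longrightarrow> \<bar>L w\<bar> \<le> W \<and> \<bar>M w\<bar> \<le> W \<and> \<bar>N w\<bar> \<le> W"
    using LMN_bounded by blast
  obtain k1 where k1: "\<And>y. y \<in> {y0..y1} \<Longrightarrow> \<bar>k y\<bar> \<le> k1"
    using continuous_bounded_on_compact[OF k compact_Icc] by blast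
  have [measurable]: "k \<in> borel_measurable borel" using k by (rule borel_measurable_continuous_onI)
  show ?thesis
  proof (rule product_integrable)
    show "\<bar>k (snd w) * g w\<bar> \<le> k1 * W" if "y0 \<le> snd w" "snd w \<le> y1" for w
    proof -
      have a: "\<bar>k (snd w)\<bar> \<le> k1" using k1[of "snd w"] that by simp
      have b: "\<bar>g w\<bar> \<le> W" using W(2)[OF that] assms(2) by auto
      have "0 \<le> k1" using a by linarith
      with a b show ?thesis unfolding abs_mult by (intro mult_mono) auto
    qed
    show "f w = 0" if "w \<notin> K" for w using \<phi>_zero[OF that] assms(1) by auto
    show "continuous_on UNIV f" using assms(1) \<phi>c \<phi>_cont by auto
    show "f \<in> borel_measurable borel" using assms(1) by auto
    show "(\<lambda>w. k (snd w) * g w) \<in> borel_measurable borel" using assms(2) by auto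
  qed
qed

lemma supp_R: obtains R where "0 < R" "\<And>w :: real \<times> real. R < \<bar>fst w\<bar> \<Longrightarrow> w \<notin> K"
proof -
  obtain R where R: "\<And>w. w \<in> K \<Longrightarrow> norm w \<le> R" using compact_imp_bounded[OF K(1)] by (auto simp: bounded_iff)
  show thesis
  proof (rule that[of "\<bar>R\<bar> + 1"])
    fix w :: "real \<times> real" assume "\<bar>R\<bar> + 1 < \<bar>fst w\<bar>"
    then show "w \<notin> K" using R[of w] norm_fst_le[of "fst w" "snd w"] by auto
  qed simp
qed

definition "t1 = G y1"

lemma t1: "0 < t1" "t1 < t \<Longrightarrow> y1 < Y t"
  using Y_less_iff[of 0 t1] Y_less_iff[of t1 t] y01 Y0 by (auto simp: t1_def G)

lemma T_nonneg: "z \<in> \<Delta> \<Longrightarrow> 0 \<le> T z"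
  using T_ge[of "snd z" "fst z"] c(1) by (simp add: \<Delta>_def) (smt (verit) mult_nonneg_nonneg)

text \<open>The two Codazzi equations become the energy and momentum identities after the change of variables,
  for the test functions \<open>\<phi>(x, Y t)\<close> and \<open>\<phi>(x, Y t) / E(Y t)\<close> respectively.\<close>

lemma change_of_variables_tri:
  assumes f [measurable]: "f \<in> borel_measurable borel"
    and eq: "\<And>z. z \<in> \<Delta> \<Longrightarrow> Y (T z) \<le> y1 \<Longrightarrow> f (\<Psi>Y z) * (e (T z) * J z) = g z"
    and f0: "\<And>w. y1 < snd w \<Longrightarrow> f w = 0"
    and g0: "\<And>z. z \<in> \<Delta> \<Longrightarrow> y1 < Y (T z) \<Longrightarrow> g z = 0"
      "\<And>z. z \<in> \<Delta> \<Longrightarrow> z \<notin> tri B (- B) \<Longrightarrow> g z = 0"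
  shows "(LINT w:{w. y0 \<le> snd w}|lborel. f w) = (LINT z:tri B (- B)|lborel. g z)"
proof -
  have "(LINT w:{w. y0 \<le> snd w}|lborel. f w) = (LINT z:\<Delta>|lborel. f (\<Psi>Y z) * (e (T z) * J z))"
    by (rule change_of_variables[OF f])
  also have "\<dots> = (LINT z:tri B (- B)|lborel. g z)"
    unfolding set_lebesgue_integral_def
  proof (rule Bochner_Integration.integral_cong)
    fix z :: "real \<times> real"
    have t: "tri B (- B) \<subseteq> \<Delta>" by (auto simp: tri_def \<Delta>_def)
    have "f (\<Psi>Y z) * (e (T z) * J z) = g z" if "z \<in> \<Delta>"
      using eq[OF that] g0(1)[OF that] f0[of "\<Psi>Y z"] by (cases "Y (T z) \<le> y1") (auto simp: \<Psi>Y_def)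
    then show "indicator \<Delta> z *\<^sub>R (f (\<Psi>Y z) * (e (T z) * J z)) = indicator (tri B (- B)) z *\<^sub>R g z"
      using g0(2)[of z] t by (cases "z \<in> \<Delta>"; cases "z \<in> tri B (- B)") auto
  qed simp
  finally show ?thesis .
qed

text \<open>Formulated for any C1 function with support in \<open>K\<close>, because the first
  Codazzi equation takes \<phi> and the second takes \<phi> / E.\<close>

lemma goursat_test_compose:
  fixes \<psi> \<psi>x \<psi>y :: "real \<times> real \<Rightarrow> real"
  assumes \<psi>: "\<And>w. (\<psi> has_derivative (\<lambda>v. \<psi>x w * fst v + \<psi>y w * snd v)) (at w)"
    and c: "continuous_on UNIV \<psi>x" "continuous_on UNIV \<psi>y"
    and zero: "\<And>w. w \<notin> K \<Longrightarrow> \<psi> w = 0 \<and> \<psi>x w = 0 \<and> \<psi>y w = 0"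
    and R: "0 < R" "\<And>w :: real \<times> real. R < \<bar>fst w\<bar> \<Longrightarrow> w \<notin> K"
  shows "goursat_test p q r b c C T (\<lambda>z. \<psi> (fst z, Y (snd z))) (\<lambda>z. \<psi>x (fst z, Y (snd z)))
    (\<lambda>z. \<psi>y (fst z, Y (snd z)) * e (snd z)) R t1 (R + t1 / c + 1)"
proof
  fix z :: "real \<times> real"
  have 1: "((\<lambda>z. (fst z, Y (snd z))) has_derivative (\<lambda>v. (fst v, e (snd z) * snd v))) (at z)"
    using has_derivative_compose[OF has_derivative_snd[OF has_derivative_ident] Y[unfolded has_field_derivative_def]]
    by (intro has_derivative_Pair has_derivative_fst has_derivative_ident)
  show "((\<lambda>z. \<psi> (fst z, Y (snd z))) has_derivative
      (\<lambda>v. \<psi>x (fst z, Y (snd z)) * fst v + \<psi>y (fst z, Y (snd z)) * e (snd z) * snd v)) (at z)"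
    by (rule has_derivative_eq_rhs[OF has_derivative_compose[OF 1 \<psi>]]) (auto simp: fun_eq_iff)
  assume "R < \<bar>fst z\<bar> \<or> t1 < snd z"
  then have "(fst z, Y (snd z)) \<notin> K" using R(2)[of "(fst z, Y (snd z))"] t1(2)[of "snd z"] K(2) by auto
  from zero[OF this] show "\<psi> (fst z, Y (snd z)) = 0 \<and> \<psi>x (fst z, Y (snd z)) = 0 \<and> \<psi>y (fst z, Y (snd z)) * e (snd z) = 0"
    by simp
next
  show "continuous_on UNIV (\<lambda>z. \<psi>x (fst z, Y (snd z)))" "continuous_on UNIV (\<lambda>z. \<psi>y (fst z, Y (snd z)) * e (snd z))"
    by (auto intro!: continuous_intros continuous_on_compose2[OF c(1)] continuous_on_compose2[OF c(2)]
      continuous_on_compose2[OF Y_cont] continuous_on_compose2[OF e(1)])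
qed (use t1 R in auto)

lemma initial_integral:
  fixes \<psi> :: "real \<times> real \<Rightarrow> real"
  assumes "\<And>w. w \<notin> K \<Longrightarrow> \<psi> w = 0" "\<And>w :: real \<times> real. R < \<bar>fst w\<bar> \<Longrightarrow> w \<notin> K"
  shows "(LINT u:{- (R + t1 / c + 1)..R + t1 / c + 1}|lborel. \<psi> (u, Y 0) * f u) = (LINT x|lborel. \<psi> (x, y0) * f x)"
  unfolding set_lebesgue_integral_def
proof (rule Bochner_Integration.integral_cong)
  fix x :: real
  have "0 < t1 / c" using t1(1) c(1) by simp
  moreover have "\<psi> (x, y0) = 0" if "R < \<bar>x\<bar>" using assms that by simp
  ultimately show "indicator {- (R + t1 / c + 1)..R + t1 / c + 1} x *\<^sub>R (\<psi> (x, Y 0) * f x) = \<psi> (x, y0) * f x"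
    by (cases "R < \<bar>x\<bar>") (auto simp: Y0 indicator_def)
qed simp

lemma weak_codazzi_1:
  "(LINT w:{w. y0 \<le> snd w}|lborel. L w * \<phi>y w - M w * \<phi>x w) + (LINT x|lborel. sqrt D * r x * \<phi> (x, y0))
    = (LINT w:{w. y0 \<le> snd w}|lborel. - E' (snd w) / 2 * N w * \<phi> w)"
proof -
  obtain R where R: "0 < R" "\<And>w :: real \<times> real. R < \<bar>fst w\<bar> \<Longrightarrow> w \<notin> K" using supp_R by blast
  define H where "H z = \<phi> (fst z, Y (snd z))" for z :: "real \<times> real"
  define Hx where "Hx z = \<phi>x (fst z, Y (snd z))" for z :: "real \<times> real"
  define Ht where "Ht z = \<phi>y (fst z, Y (snd z)) * e (snd z)" for z :: "real \<times> real"
  define B where "B = R + t1 / c + 1"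
  interpret goursat_test p q r b c C T H Hx Ht R t1 B
    unfolding H_def Hx_def Ht_def B_def
    by (rule goursat_test_compose[OF \<phi> \<phi>c \<phi>_zero R])
  let ?g = "\<lambda>z. hx' z * (pz z * Qz z - qz z * Pz z) + 2 * ht' z * (Pz z * Qz z) + 2 * h' z * (b (T z) * pz z * qz z)"
  let ?U = "{w :: real \<times> real. y0 \<le> snd w}"
  have "continuous_on UNIV (\<lambda>y. - E' y / 2)"
    by (intro continuous_intros E(3)) auto
  then have i: "set_integrable lborel ?U (\<lambda>w. L w * \<phi>y w - M w * \<phi>x w)"
    "set_integrable lborel ?U (\<lambda>w. - E' (snd w) / 2 * N w * \<phi> w)"
    using set_integral_diff(1)[OF LMN_integrable[of \<phi>y L "\<lambda>_. 1"] LMN_integrable[of \<phi>x M "\<lambda>_. 1"]]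
      LMN_integrable[of \<phi> N "\<lambda>y. - E' y / 2"] by auto
  have "(LINT w:?U|lborel. L w * \<phi>y w - M w * \<phi>x w) - (LINT w:?U|lborel. - E' (snd w) / 2 * N w * \<phi> w)
     = (LINT w:?U|lborel. (L w * \<phi>y w - M w * \<phi>x w) - (- E' (snd w) / 2 * N w * \<phi> w))"
    by (rule set_integral_diff(2)[OF i, symmetric])
  also have "\<dots> = (LINT z:tri B (- B)|lborel. sqrt D / 2 * ?g z)"
  proof (rule change_of_variables_tri)
    fix z assume z: "z \<in> \<Delta>"
    show "sqrt D / 2 * ?g z = 0" if "z \<notin> tri B (- B)"
      using supp'[of z] that z by (simp add: \<Delta>_def)
    show "sqrt D / 2 * ?g z = 0" if "y1 < Y (T z)"
      using \<phi>_zero'[of "(X (fst z) (snd z), Y (T z))"] that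
      by (simp add: h'_def hx'_def ht'_def H_def Hx_def Ht_def)
    \<comment> \<open>\<open>e\<close> and \<open>b\<close> have their geometric values only up to
      the height \<open>y1\<close>; above it the test function vanishes, which the preceding case
      settles.\<close>
    assume y: "Y (T z) \<le> y1"
    define EE where "EE = E (Y (T z))"
    have EE: "EE > 0" using E(1) by (simp add: EE_def)
    have j: "0 < J z" by (rule J_pos[OF z])
    have e': "e (T z) = EE" using e_E[OF T_nonneg[OF z] y] by (simp add: EE_def)
    have b': "E' (Y (T z)) = - 2 * EE * b (T z)" using b_E[OF T_nonneg[OF z] y] EE by (simp add: EE_def field_simps)
    have L': "L (\<Psi>Y z) * (EE * J z) = sqrt D * EE * (Pz z * Qz z)"
      using j by (simp add: L_def Let_def foot_\<Psi>Y[OF z])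
    have M': "M (\<Psi>Y z) * (EE * J z) = - (sqrt D / 2) * (pz z * Qz z - qz z * Pz z)"
      using j EE unfolding M_def Let_def foot_\<Psi>Y[OF z] by (simp add: \<Psi>Y_def EE_def[symmetric])
    \<comment> \<open>Here b = -E'/(2E) turns the Christoffel term into the source term b p q of the
      energy identity.\<close>
    have N': "- E' (Y (T z)) / 2 * (N (\<Psi>Y z) * (EE * J z)) = - sqrt D * (b (T z) * pz z * qz z)"
      using j EE unfolding N_def Let_def foot_\<Psi>Y[OF z] b' by (simp add: \<Psi>Y_def EE_def[symmetric] power2_eq_square)
    define fx where "fx = \<phi>x (\<Psi>Y z)"
    define fy where "fy = \<phi>y (\<Psi>Y z)"
    define ff where "ff = \<phi> (\<Psi>Y z)"
    have h: "hx' z = fx" "ht' z = fy * EE" "h' z = ff"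
      by (simp_all add: fx_def fy_def ff_def h'_def hx'_def ht'_def H_def Hx_def Ht_def \<Psi>Y_def e')
    have "(L (\<Psi>Y z) * fy - M (\<Psi>Y z) * fx - (- E' (Y (T z)) / 2 * N (\<Psi>Y z) * ff)) * (EE * J z)
        = (L (\<Psi>Y z) * (EE * J z)) * fy - (M (\<Psi>Y z) * (EE * J z)) * fx - (- E' (Y (T z)) / 2 * (N (\<Psi>Y z) * (EE * J z))) * ff"
      by (simp only: left_diff_distrib right_diff_distrib ac_simps)
    also have "\<dots> = sqrt D / 2 * ?g z"
      unfolding L' M' N' h by (simp add: algebra_simps)
    finally show "(L (\<Psi>Y z) * \<phi>y (\<Psi>Y z) - M (\<Psi>Y z) * \<phi>x (\<Psi>Y z) - - E' (snd (\<Psi>Y z)) / 2 * N (\<Psi>Y z) * \<phi> (\<Psi>Y z)) * (e (T z) * J z)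
        = sqrt D / 2 * ?g z"
      by (simp add: e' fx_def fy_def ff_def \<Psi>Y_def)
  qed (use \<phi>_zero' in auto)
  also have "\<dots> = sqrt D / 2 * (- 2 * (LINT u:{- B..B}|lborel. H (u, 0) * r u))"
    unfolding set_integral_mult_right energy_identity ..
  also have "\<dots> = - (LINT x|lborel. sqrt D * r x * \<phi> (x, y0))"
    using initial_integral[of \<phi> R r] \<phi>_zero R(2) by (simp add: H_def B_def ac_simps)
  finally show ?thesis by simp
qed

text \<open>The t-derivative brings a factor E, which has to be cancelled to match M and N against
  the momentum identity; hence the test function \<phi> / E. The y-derivative of 1/E then produces
  the Christoffel term E'/E M, for which the momentum identity itself has no counterpart.\<close>

lemma weak_codazzi_2:
  "(LINT w:{w. y0 \<le> snd w}|lborel. M w * \<phi>y w - N w * \<phi>x w)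
     + (LINT x|lborel. - (sqrt D / (2 * E y0)) * (p x - q x) * \<phi> (x, y0))
    = (LINT w:{w. y0 \<le> snd w}|lborel. E' (snd w) / E (snd w) * M w * \<phi> w)"
proof -
  obtain R where R: "0 < R" "\<And>w :: real \<times> real. R < \<bar>fst w\<bar> \<Longrightarrow> w \<notin> K" using supp_R by blast
  define H where "H z = \<phi> (fst z, Y (snd z)) / E (Y (snd z))" for z :: "real \<times> real"
  define Hx where "Hx z = \<phi>x (fst z, Y (snd z)) / E (Y (snd z))" for z :: "real \<times> real"
  define Ht where "Ht z = (\<phi>y (fst z, Y (snd z)) * E (Y (snd z)) - \<phi> (fst z, Y (snd z)) * E' (Y (snd z)))
      / (E (Y (snd z)))\<^sup>2 * e (snd z)" for z :: "real \<times> real"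
  define B where "B = R + t1 / c + 1"
  have Enz: "E y \<noteq> 0" for y using E(1)[of y] by simp
  define \<psi> where "\<psi> w = \<phi> w / E (snd w)" for w
  have \<psi>: "(\<psi> has_derivative (\<lambda>v. \<phi>x w / E (snd w) * fst v
      + (\<phi>y w * E (snd w) - \<phi> w * E' (snd w)) / (E (snd w))\<^sup>2 * snd v)) (at w)" for w
  proof -
    note 1 = has_derivative_compose[OF has_derivative_snd[OF has_derivative_ident] E(2)[unfolded has_field_derivative_def]]
    show ?thesis
      unfolding \<psi>_def[abs_def]
      by (rule has_derivative_eq_rhs[OF has_derivative_divide'[OF \<phi> 1 Enz]])
        (use Enz in \<open>auto simp: fun_eq_iff power2_eq_square field_simps\<close>)
  qed
  have "continuous_on UNIV (\<lambda>w. \<phi>x w / E (snd w))"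
    "continuous_on UNIV (\<lambda>w. (\<phi>y w * E (snd w) - \<phi> w * E' (snd w)) / (E (snd w))\<^sup>2)"
    by (auto intro!: continuous_intros \<phi>c \<phi>_cont continuous_on_compose2[OF E_cont] continuous_on_compose2[OF E(3)]
      simp: Enz)
  from goursat_test_compose[OF \<psi> this _ R]
  interpret goursat_test p q r b c C T H Hx Ht R t1 B
    unfolding H_def Hx_def Ht_def B_def \<psi>_def by (simp add: \<phi>_zero)
  let ?g = "\<lambda>z. 2 * hx' z * (pz z * qz z) + ht' z * (qz z * Pz z - pz z * Qz z)"
  let ?U = "{w :: real \<times> real. y0 \<le> snd w}"
  have i: "set_integrable lborel ?U (\<lambda>w. M w * \<phi>y w - N w * \<phi>x w)"
    "set_integrable lborel ?U (\<lambda>w. E' (snd w) / E (snd w) * M w * \<phi> w)"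
    using set_integral_diff(1)[OF LMN_integrable[of \<phi>y M "\<lambda>_. 1"] LMN_integrable[of \<phi>x N "\<lambda>_. 1"]]
      LMN_integrable[of \<phi> M "\<lambda>y. E' y / E y"] E(3) E_cont Enz by (auto intro!: continuous_intros)
  have "(LINT w:?U|lborel. M w * \<phi>y w - N w * \<phi>x w) - (LINT w:?U|lborel. E' (snd w) / E (snd w) * M w * \<phi> w)
     = (LINT w:?U|lborel. (M w * \<phi>y w - N w * \<phi>x w) - (E' (snd w) / E (snd w) * M w * \<phi> w))"
    by (rule set_integral_diff(2)[OF i, symmetric])
  also have "\<dots> = (LINT z:tri B (- B)|lborel. sqrt D / 2 * ?g z)"
  proof (rule change_of_variables_tri)
    fix z assume z: "z \<in> \<Delta>"
    show "sqrt D / 2 * ?g z = 0" if "z \<notin> tri B (- B)"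
      using supp'[of z] that z by (simp add: \<Delta>_def)
    show "sqrt D / 2 * ?g z = 0" if "y1 < Y (T z)"
      using \<phi>_zero'[of "(X (fst z) (snd z), Y (T z))"] that
      by (simp add: h'_def hx'_def ht'_def H_def Hx_def Ht_def)
    assume y: "Y (T z) \<le> y1"
    define EE where "EE = E (Y (T z))"
    define ED where "ED = E' (Y (T z))"
    have EE: "EE > 0" using E(1) by (simp add: EE_def)
    have j: "0 < J z" by (rule J_pos[OF z])
    have e': "e (T z) = EE" using e_E[OF T_nonneg[OF z] y] by (simp add: EE_def)
    have M': "M (\<Psi>Y z) * (EE * J z) = - (sqrt D / 2) * (pz z * Qz z - qz z * Pz z)"
      using j EE unfolding M_def Let_def foot_\<Psi>Y[OF z] by (simp add: \<Psi>Y_def EE_def[symmetric])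
    have N': "N (\<Psi>Y z) * (EE * J z) = - sqrt D / EE * (pz z * qz z)"
      using j EE unfolding N_def Let_def foot_\<Psi>Y[OF z] by (simp add: \<Psi>Y_def EE_def[symmetric] power2_eq_square)
    define fx where "fx = \<phi>x (\<Psi>Y z)"
    define fy where "fy = \<phi>y (\<Psi>Y z)"
    define ff where "ff = \<phi> (\<Psi>Y z)"
    have h: "hx' z = fx / EE" "ht' z = fy - ff * (ED / EE)"
      using EE by (simp_all add: fx_def fy_def ff_def hx'_def ht'_def Hx_def Ht_def \<Psi>Y_def e' EE_def[symmetric] ED_def[symmetric]
         power2_eq_square field_simps)
    have "(M (\<Psi>Y z) * fy - N (\<Psi>Y z) * fx - (ED / EE * M (\<Psi>Y z) * ff)) * (EE * J z)
        = (M (\<Psi>Y z) * (EE * J z)) * fy - (N (\<Psi>Y z) * (EE * J z)) * fx - ED / EE * (M (\<Psi>Y z) * (EE * J z)) * ff"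
      by (simp only: left_diff_distrib right_diff_distrib ac_simps)
    also have "\<dots> = sqrt D / 2 * ?g z"
      unfolding M' N' h by (simp add: algebra_simps)
    finally show "(M (\<Psi>Y z) * \<phi>y (\<Psi>Y z) - N (\<Psi>Y z) * \<phi>x (\<Psi>Y z) - E' (snd (\<Psi>Y z)) / E (snd (\<Psi>Y z)) * M (\<Psi>Y z) * \<phi> (\<Psi>Y z)) * (e (T z) * J z)
        = sqrt D / 2 * ?g z"
      by (simp add: e' fx_def fy_def ff_def \<Psi>Y_def EE_def ED_def)
  qed (use \<phi>_zero' in auto)
  also have "\<dots> = sqrt D / 2 * (LINT u:{- B..B}|lborel. H (u, 0) * (p u - q u))"
    unfolding set_integral_mult_right momentum_identity ..
  also have "\<dots> = - (LINT x|lborel. - (sqrt D / (2 * E y0)) * (p x - q x) * \<phi> (x, y0))"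
  proof -
    have "(LINT u:{- B..B}|lborel. H (u, 0) * (p u - q u)) = (LINT x|lborel. \<phi> (x, y0) / E y0 * (p x - q x))"
      using initial_integral[of \<psi> R "\<lambda>u. p u - q u"] \<phi>_zero R(2) by (simp add: H_def B_def \<psi>_def)
    also have "\<dots> = (LINT x|lborel. (p x - q x) * \<phi> (x, y0)) / E y0" by (simp add: mult.commute)
    finally show ?thesis by (simp add: mult.assoc)
  qed
  finally show ?thesis by simp
qed

end

subsection \<open>The isometric immersion\<close>

text \<open>\<open>K\<close> may fail to be convex, so the mean value inequality is applied on a
  ball that contains it.\<close>

lemma C1_lipschitz_on_compact:
  fixes g gx gy :: "real \<times> real \<Rightarrow> real"
  assumes g: "\<And>p. (g has_derivative (\<lambda>v. gx p * fst v + gy p * snd v)) (at p)"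
    and c: "continuous_on UNIV gx" "continuous_on UNIV gy" and K: "compact K"
  shows "\<exists>l. l-lipschitz_on K g"
proof -
  obtain r where r: "K \<subseteq> cball 0 r"
    using compact_imp_bounded[OF K] by (auto simp: bounded_iff subset_iff)
  note bd = continuous_bounded_on_compact[OF _ compact_cball[of 0 r]]
  obtain b1 b2 where b: "\<And>x. x \<in> cball 0 r \<Longrightarrow> \<bar>gx x\<bar> \<le> b1" "\<And>x. x \<in> cball 0 r \<Longrightarrow> \<bar>gy x\<bar> \<le> b2"
    using bd[OF c(1)] bd[OF c(2)] by blast
  have "(\<bar>b1\<bar> + \<bar>b2\<bar>)-lipschitz_on K g"
  proof (rule lipschitz_onI)
    fix x y assume xy: "x \<in> K" "y \<in> K"
    have "norm (g x - g y) \<le> (\<bar>b1\<bar> + \<bar>b2\<bar>) * norm (x - y)"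
    proof (rule differentiable_bound[of "cball 0 r" g "\<lambda>p v. gx p * fst v + gy p * snd v"])
      fix p assume p: "p \<in> cball (0 :: real \<times> real) r"
      show "onorm (\<lambda>v. gx p * fst v + gy p * snd v) \<le> \<bar>b1\<bar> + \<bar>b2\<bar>"
      proof (rule onorm_le)
        fix v :: "real \<times> real"
        have "\<bar>gx p * fst v\<bar> \<le> \<bar>b1\<bar> * norm v" "\<bar>gy p * snd v\<bar> \<le> \<bar>b2\<bar> * norm v"
          unfolding abs_mult using b[OF p] norm_fst_le[of "fst v" "snd v"] norm_snd_le[of "snd v" "fst v"]
          by (auto intro!: mult_mono)
        then show "norm (gx p * fst v + gy p * snd v) \<le> (\<bar>b1\<bar> + \<bar>b2\<bar>) * norm v"
          by (simp add: distrib_right)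
      qed
    qed (use g xy r in \<open>auto intro: has_derivative_at_withinI\<close>)
    then show "dist (g x) (g y) \<le> (\<bar>b1\<bar> + \<bar>b2\<bar>) * dist x y" by (simp add: dist_norm)
  qed simp
  then show ?thesis ..
qed

lemma product_lipschitz_on_compact:
  fixes s s1 m m1 :: "real \<Rightarrow> real"
  assumes s: "\<And>x. (s has_real_derivative s1 x) (at x)" "continuous_on UNIV s1"
    and m: "\<And>x. (m has_real_derivative m1 x) (at x)" "continuous_on UNIV m1" and K: "compact K"
  shows "\<exists>l. l-lipschitz_on K (\<lambda>p. s (fst p) * m (snd p))"
proof (rule C1_lipschitz_on_compact[OF _ _ _ K])
  have sc: "continuous_on UNIV s" "continuous_on UNIV m"
    using s(1) m(1) by (meson DERIV_isCont continuous_at_imp_continuous_on)+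
  show "continuous_on UNIV (\<lambda>p. s1 (fst p) * m (snd p))" "continuous_on UNIV (\<lambda>p. s (fst p) * m1 (snd p))"
    by (auto intro!: continuous_intros continuous_on_compose2[OF s(2)] continuous_on_compose2[OF m(2)]
      continuous_on_compose2[OF sc(1)] continuous_on_compose2[OF sc(2)])
  fix p :: "real \<times> real"
  note 1 = has_derivative_compose[OF has_derivative_fst[OF has_derivative_ident] s(1)[unfolded has_field_derivative_def]]
  note 2 = has_derivative_compose[OF has_derivative_snd[OF has_derivative_ident] m(1)[unfolded has_field_derivative_def]]
  show "((\<lambda>p. s (fst p) * m (snd p)) has_derivative
      (\<lambda>v. s1 (fst p) * m (snd p) * fst v + s (fst p) * m1 (snd p) * snd v)) (at p)"
    by (rule has_derivative_eq_rhs[OF has_derivative_mult[OF 1 2]]) (auto simp: fun_eq_iff algebra_simps)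
qed

lemma lipschitz_on_scaleR_const:
  fixes v :: "'b::real_normed_vector"
  assumes "l-lipschitz_on K (a :: 'a::metric_space \<Rightarrow> real)"
  shows "\<exists>l'. l'-lipschitz_on K (\<lambda>p. a p *\<^sub>R v)"
proof
  show "(l * norm v)-lipschitz_on K (\<lambda>p. a p *\<^sub>R v)"
  proof (rule lipschitz_onI)
    fix x y assume "x \<in> K" "y \<in> K"
    then have "\<bar>a x - a y\<bar> \<le> l * dist x y" using lipschitz_onD[OF assms] by (simp add: dist_real_def)
    then have "\<bar>a x - a y\<bar> * norm v \<le> l * dist x y * norm v" by (intro mult_right_mono) auto
    then show "dist (a x *\<^sub>R v) (a y *\<^sub>R v) \<le> l * norm v * dist x y"
      by (simp add: dist_norm scaleR_left_diff_distrib[symmetric] ac_simps)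
  qed (use lipschitz_on_nonneg[OF assms] in simp)
qed

text \<open>The metric is, up to the covering of the angular variable, that of a surface of revolution
  with profile curve \<open>y \<mapsto> (\<surd>(E/A), \<surd>D/(2A) \<sqdot> arsinh (E'/\<surd>D))\<close>, where \<open>D = 4AC - B\<^sup>2\<close>;
  it has unit speed since \<open>E'\<^sup>2 + D = 4AE\<close>.\<close>

lemma quadratic_warped_metric_immersion:
  fixes A B C :: real
  assumes A: "0 < A" and D: "B\<^sup>2 - 4 * A * C < 0"
  shows "\<exists>f. C11_isometric_immersion (warped_metric (\<lambda>y. A * y\<^sup>2 + B * y + C)) S f"
proof -
  define D where "D = 4 * A * C - B\<^sup>2"
  define E where "E y = A * y\<^sup>2 + B * y + C" for y
  define E' where "E' y = 2 * A * y + B" for y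
  define k where "k = sqrt A"
  define s where "s y = sqrt (E y)" for y
  have D0: "0 < D" using assms by (simp add: D_def)
  have k: "0 < k" "k * k = A" using A by (simp_all add: k_def)
  have 4: "4 * A * E y = (E' y)\<^sup>2 + D" for y
    by (simp add: E_def E'_def D_def power2_eq_square algebra_simps)
  have E0: "0 < E y" for y
  proof -
    have "0 < 4 * A * E y" unfolding 4 using D0 by (simp add: add_nonneg_pos)
    then show ?thesis using A by (simp add: zero_less_mult_iff)
  qed
  have s: "0 < s y" "s y * s y = E y" for y using E0[of y] by (simp_all add: s_def)
  have dE: "(E has_real_derivative E' y) (at y)" for y
    unfolding E_def[abs_def] E'_def by (auto intro!: derivative_eq_intros simp: power2_eq_square)
  have dE': "(E' has_real_derivative 2 * A) (at y)" for y
    unfolding E'_def[abs_def] by (auto intro!: derivative_eq_intros)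
  have ds: "(s has_real_derivative E' y / (2 * s y)) (at y)" for y
    using DERIV_chain2[OF DERIV_real_sqrt[OF E0] dE, of y] by (simp add: s_def[abs_def] field_simps)
  define \<zeta> where "\<zeta> y = sqrt D / (2 * A) * arsinh (E' y / sqrt D)" for y
  define \<rho>' where "\<rho>' y = E' y / (2 * k * s y)" for y
  define \<zeta>' where "\<zeta>' y = sqrt D / (2 * k * s y)" for y
  have d\<zeta>: "(\<zeta> has_real_derivative \<zeta>' y) (at y)" for y
  proof -
    \<comment> \<open>The relation E'^2 + D = 4 A E evaluates the square root in the derivative of
      arsinh.\<close>
    have "(2 * k * s y)\<^sup>2 = 4 * (k * k) * (s y * s y)" by (simp add: power2_eq_square)
    also have "\<dots> = (E' y)\<^sup>2 + D" unfolding k(2) s(2) 4 ..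
    finally have "sqrt ((E' y / sqrt D)\<^sup>2 + 1) = sqrt ((2 * k * s y)\<^sup>2 / D)"
      using D0 by (simp add: power_divide add_divide_distrib)
    also have "\<dots> = 2 * k * s y / sqrt D" using k(1) s(1)[of y] by (simp add: real_sqrt_divide)
    finally have sq: "sqrt ((E' y / sqrt D)\<^sup>2 + 1) = 2 * k * s y / sqrt D" .
    have "((\<lambda>y. arsinh (E' y / sqrt D)) has_real_derivative 1 / sqrt ((E' y / sqrt D)\<^sup>2 + 1) * (2 * A / sqrt D)) (at y)"
      by (rule DERIV_chain2[OF arsinh_real_has_field_derivative DERIV_cdivide[OF dE']])
    from DERIV_cmult[OF this, of "sqrt D / (2 * A)"] show ?thesis
      unfolding sq using A D0 by (simp add: \<zeta>_def[abs_def] \<zeta>'_def mult.assoc)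
  qed
  have unit: "\<rho>' y * \<rho>' y + \<zeta>' y * \<zeta>' y = 1" for y
  proof -
    have "\<rho>' y * \<rho>' y + \<zeta>' y * \<zeta>' y = (E' y * E' y + sqrt D * sqrt D) / (4 * (k * k) * (s y * s y))"
      by (simp add: \<rho>'_def \<zeta>'_def add_divide_distrib ac_simps)
    also have "E' y * E' y + sqrt D * sqrt D = 4 * (k * k) * (s y * s y)"
      using 4[of y] D0 by (simp add: k(2) s(2) power2_eq_square)
    finally show ?thesis using k(1) s(1)[of y] by simp
  qed
  define e1 e2 e3 :: "real^3" where "e1 = axis 1 1" and "e2 = axis 2 1" and "e3 = axis 3 1"
  have e: "e1 \<bullet> e1 = 1" "e2 \<bullet> e2 = 1" "e3 \<bullet> e3 = 1" "e1 \<bullet> e2 = 0" "e1 \<bullet> e3 = 0" "e2 \<bullet> e3 = 0"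
    "e2 \<bullet> e1 = 0" "e3 \<bullet> e1 = 0" "e3 \<bullet> e2 = 0"
    by (simp_all add: e1_def e2_def e3_def inner_axis_axis)
  define F1 F2 :: "real^3 \<Rightarrow> (real \<times> real) \<Rightarrow>\<^sub>L (real^3)"
    where "F1 v = Blinfun (\<lambda>h. fst h *\<^sub>R v)" and "F2 v = Blinfun (\<lambda>h. snd h *\<^sub>R v)" for v
  have F: "blinfun_apply (F1 v) h = fst h *\<^sub>R v" "blinfun_apply (F2 v) h = snd h *\<^sub>R v" for v h
  proof -
    have "bounded_linear (\<lambda>h::real \<times> real. fst h *\<^sub>R v)" "bounded_linear (\<lambda>h::real \<times> real. snd h *\<^sub>R v)"
      by (intro bounded_linear_intros)+
    then show "blinfun_apply (F1 v) h = fst h *\<^sub>R v" "blinfun_apply (F2 v) h = snd h *\<^sub>R v"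
      by (simp_all add: F1_def F2_def bounded_linear_Blinfun_apply)
  qed
  define f :: "real \<times> real \<Rightarrow> real^3" where
    "f p = (cos (k * fst p) * (s (snd p) / k)) *\<^sub>R e1 + (sin (k * fst p) * (s (snd p) / k)) *\<^sub>R e2 + \<zeta> (snd p) *\<^sub>R e3" for p
  \<comment> \<open>A sum of scalar functions, each a function of x times a function of y,
    multiplying fixed linear maps: Lipschitz continuity then follows summand by summand from
    \<open>product_lipschitz_on_compact\<close>. The factor 1 puts the last summand into this
    form.\<close>
  define f' :: "real \<times> real \<Rightarrow> (real \<times> real) \<Rightarrow>\<^sub>L (real^3)" where
    "f' p = (- sin (k * fst p) * s (snd p)) *\<^sub>R F1 e1 + (cos (k * fst p) * s (snd p)) *\<^sub>R F1 e2
      + (cos (k * fst p) * \<rho>' (snd p)) *\<^sub>R F2 e1 + (sin (k * fst p) * \<rho>' (snd p)) *\<^sub>R F2 e2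
      + (1 * \<zeta>' (snd p)) *\<^sub>R F2 e3" for p
  have app: "blinfun_apply (f' p) h =
      (- sin (k * fst p) * s (snd p) * fst h + cos (k * fst p) * \<rho>' (snd p) * snd h) *\<^sub>R e1
      + (cos (k * fst p) * s (snd p) * fst h + sin (k * fst p) * \<rho>' (snd p) * snd h) *\<^sub>R e2
      + (\<zeta>' (snd p) * snd h) *\<^sub>R e3" for p h
    by (simp add: f'_def blinfun.add_left blinfun.diff_left blinfun.scaleR_left F scaleR_add_left scaleR_diff_left)
  have inner: "blinfun_apply (f' p) h \<bullet> blinfun_apply (f' p) h' = E (snd p) * (fst h * fst h') + snd h * snd h'" for p h h'
  proof -
    define a b c d z where abbr: "a = sin (k * fst p)" "b = cos (k * fst p)" "c = s (snd p)" "d = \<rho>' (snd p)" "z = \<zeta>' (snd p)"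
    have 1: "a * a + b * b = 1" using sin_cos_squared_add[of "k * fst p"] by (simp add: abbr power2_eq_square)
    have 2: "d * d + z * z = 1" "c * c = E (snd p)" using unit s(2) by (simp_all add: abbr)
    have "blinfun_apply (f' p) h \<bullet> blinfun_apply (f' p) h' =
       (a * a + b * b) * (c * c) * (fst h * fst h') + ((a * a + b * b) * (d * d) + z * z) * (snd h * snd h')"
      unfolding app abbr[symmetric] by (simp add: inner_add_left inner_add_right e algebra_simps)
    then show ?thesis unfolding 1 2(2) using 2(1) by simp
  qed
  have dcos: "((\<lambda>x. cos (k * x)) has_real_derivative - sin (k * x) * k) (at x)"
    and dsin: "((\<lambda>x. sin (k * x)) has_real_derivative cos (k * x) * k) (at x)" for x
    by (auto intro!: derivative_eq_intros)
  have dsk: "((\<lambda>y. s y / k) has_real_derivative \<rho>' y) (at y)" for y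
    using DERIV_cdivide[OF ds, of k y] by (simp add: \<rho>'_def ac_simps)
  have deriv: "(f has_derivative blinfun_apply (f' p)) (at p)" for p
  proof -
    note fst' = has_derivative_compose[OF has_derivative_fst[OF has_derivative_ident]]
    note snd' = has_derivative_compose[OF has_derivative_snd[OF has_derivative_ident]]
    have "((\<lambda>p. cos (k * fst p) * (s (snd p) / k)) has_derivative
        (\<lambda>h. - sin (k * fst p) * s (snd p) * fst h + cos (k * fst p) * \<rho>' (snd p) * snd h)) (at p)"
      by (rule has_derivative_eq_rhs[OF has_derivative_mult[OF fst'[OF dcos[unfolded has_field_derivative_def]]
            snd'[OF dsk[unfolded has_field_derivative_def]]]])
        (use k(1) in \<open>auto simp: fun_eq_iff\<close>)
    moreover have "((\<lambda>p. sin (k * fst p) * (s (snd p) / k)) has_derivative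
        (\<lambda>h. cos (k * fst p) * s (snd p) * fst h + sin (k * fst p) * \<rho>' (snd p) * snd h)) (at p)"
      by (rule has_derivative_eq_rhs[OF has_derivative_mult[OF fst'[OF dsin[unfolded has_field_derivative_def]]
            snd'[OF dsk[unfolded has_field_derivative_def]]]])
        (use k(1) in \<open>auto simp: fun_eq_iff\<close>)
    moreover have "((\<lambda>p. \<zeta> (snd p)) has_derivative (\<lambda>h. \<zeta>' (snd p) * snd h)) (at p)"
      by (rule snd'[OF d\<zeta>[unfolded has_field_derivative_def]])
    ultimately show ?thesis
      unfolding f_def[abs_def] app by (intro has_derivative_add has_derivative_scaleR_left)
  qed
  have nz: "s y \<noteq> 0" for y using s(1)[of y] by simp
  have cont: "continuous_on UNIV s" "continuous_on UNIV E'"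
    using ds dE' by (meson DERIV_isCont continuous_at_imp_continuous_on)+
  have lip: "\<exists>c. c-lipschitz_on K f'" if K: "compact K" for K
  proof -
    define s1 where "s1 y = E' y / (2 * s y)" for y
    have s1: "(s has_real_derivative s1 y) (at y)" "continuous_on UNIV s1" for y
      using ds cont nz by (auto simp: s1_def[abs_def] intro!: continuous_intros)
    define \<rho>1 where "\<rho>1 y = (2 * A * (2 * k * s y) - E' y * (2 * k * s1 y)) / ((2 * k * s y) * (2 * k * s y))" for y
    have \<rho>1: "(\<rho>' has_real_derivative \<rho>1 y) (at y)" "continuous_on UNIV \<rho>1" for y
      unfolding \<rho>'_def[abs_def] \<rho>1_def[abs_def] using nz k(1) s1 cont
      by (auto intro!: derivative_eq_intros dE' s1(1) continuous_intros)
    define \<zeta>1 where "\<zeta>1 y = - (sqrt D * (2 * k * s1 y)) / ((2 * k * s y) * (2 * k * s y))" for y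
    have \<zeta>1: "(\<zeta>' has_real_derivative \<zeta>1 y) (at y)" "continuous_on UNIV \<zeta>1" for y
      unfolding \<zeta>'_def[abs_def] \<zeta>1_def[abs_def] using nz k(1) s1 cont
      by (auto intro!: derivative_eq_intros s1(1) continuous_intros)
    have dnsin: "((\<lambda>x. - sin (k * x)) has_real_derivative - (cos (k * x) * k)) (at x)"
      and d1: "((\<lambda>x. 1) has_real_derivative 0) (at x)" for x :: real
      by (auto intro!: derivative_eq_intros)
    have ct: "continuous_on UNIV (\<lambda>x. - (cos (k * x) * k))" "continuous_on UNIV (\<lambda>x. cos (k * x) * k)"
      "continuous_on UNIV (\<lambda>x. - sin (k * x) * k)" "continuous_on UNIV (\<lambda>x::real. 0 :: real)"
      by (intro continuous_intros)+
    note l = product_lipschitz_on_compact[OF _ _ _ _ K]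
    obtain l1 l2 l3 l4 l5 where
      "l1-lipschitz_on K (\<lambda>p. - sin (k * fst p) * s (snd p))"
      "l2-lipschitz_on K (\<lambda>p. cos (k * fst p) * s (snd p))"
      "l3-lipschitz_on K (\<lambda>p. cos (k * fst p) * \<rho>' (snd p))"
      "l4-lipschitz_on K (\<lambda>p. sin (k * fst p) * \<rho>' (snd p))"
      "l5-lipschitz_on K (\<lambda>p. 1 * \<zeta>' (snd p))"
      using l[OF dnsin ct(1) s1] l[OF dcos ct(3) s1] l[OF dcos ct(3) \<rho>1] l[OF dsin ct(2) \<rho>1] l[OF d1 ct(4) \<zeta>1]
      by blast
    note L = this[THEN lipschitz_on_scaleR_const]
    show ?thesis
      using L(1)[of "F1 e1"] L(2)[of "F1 e2"] L(3)[of "F2 e1"] L(4)[of "F2 e2"] L(5)[of "F2 e3"]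
      unfolding f'_def[abs_def] by (elim exE) (rule exI, (rule lipschitz_on_add)+, assumption+)
  qed
  \<comment> \<open>A vector in the kernel of the difference has length zero in the metric, which is
    positive definite because E > 0.\<close>
  have inj: "inj (blinfun_apply (f' p))" for p
  proof (rule injI)
    fix x y assume "blinfun_apply (f' p) x = blinfun_apply (f' p) y"
    then have "blinfun_apply (f' p) (x - y) = 0" by (simp add: blinfun.diff_right)
    then have "E (snd p) * (fst (x - y) * fst (x - y)) + snd (x - y) * snd (x - y) = 0"
      using inner[of p "x - y" "x - y"] by simp
    moreover have "0 \<le> E (snd p) * (fst (x - y) * fst (x - y))" "0 \<le> snd (x - y) * snd (x - y)"
      using E0[of "snd p"] by simp_all
    ultimately have "E (snd p) * (fst (x - y) * fst (x - y)) = 0" "snd (x - y) * snd (x - y) = 0" by linarith+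
    then show "x = y" using E0[of "snd p"] by (simp add: prod_eq_iff)
  qed
  have metric: "blinfun_apply (f' p) (coord_vec i) \<bullet> blinfun_apply (f' p) (coord_vec j) = warped_metric E p $ i $ j" for p i j
    using exhaust_2[of i] exhaust_2[of j] by (auto simp: inner coord_vec_def)
  have "C11_isometric_immersion (warped_metric E) S f"
    unfolding C11_isometric_immersion_def
    using deriv lip inj metric by (intro exI[of _ f']) (auto intro: has_derivative_at_withinI)
  then show ?thesis unfolding E_def[abs_def] by blast
qed

subsection \<open>The quadratic metric\<close>

text \<open>\<open>Y\<close> inverts the primitive \<open>G\<close> of 1/g. As 1/g \<ge> 1/M,
  \<open>G\<close> expands distances at least by the factor 1/M; so \<open>G\<close> is a bijection
  of the line and its inverse is Lipschitz with constant \<open>M\<close>.\<close>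

lemma autonomous_ode_global_solution:
  fixes g :: "real \<Rightarrow> real"
  assumes g: "continuous_on UNIV g" "\<And>y. m \<le> g y" "\<And>y. g y \<le> M" "0 < m"
  obtains Y G where "\<And>t. (Y has_real_derivative g (Y t)) (at t)" "\<And>t. G (Y t) = t" "\<And>y. Y (G y) = y"
    "Y 0 = y0" "\<And>s t. \<bar>Y s - Y t\<bar> \<le> M * \<bar>s - t\<bar>"
proof -
  have gpos: "0 < g y" for y using g(2)[of y] g(4) by linarith
  have M: "0 < M" using gpos[of 0] g(3)[of 0] by linarith
  have "isCont (\<lambda>y. 1 / g y) x" for x
    using g(1) gpos[of x] by (auto simp: continuous_on_eq_continuous_at intro!: continuous_intros)
  then have "\<exists>F. \<forall>x::real. - \<infinity> < ereal x \<longrightarrow> ereal x < \<infinity> \<longrightarrow> (F has_vector_derivative 1 / g x) (at x)"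
    by (intro einterval_antiderivative) auto
  then obtain F where F: "\<And>x. (F has_real_derivative 1 / g x) (at x)"
    by (auto simp: has_real_derivative_iff_has_vector_derivative)
  define G where "G y = F y - F y0" for y
  have dG: "(G has_real_derivative 1 / g y) (at y)" for y
    unfolding G_def[abs_def] by (auto intro!: derivative_eq_intros F)
  have Gc: "continuous_on S G" for S
    using dG by (meson DERIV_isCont continuous_at_imp_continuous_on)
  have exp: "(y' - y) / M \<le> G y' - G y" if "y \<le> y'" for y y'
  proof (cases "y = y'")
    case False
    with that have "y < y'" by simp
    from MVT2[OF this dG] obtain z where z: "G y' - G y = (y' - y) * (1 / g z)" by auto
    have "1 / M \<le> 1 / g z" using g(3)[of z] gpos[of z] by (intro divide_left_mono) (auto simp: M)
    then have "(y' - y) * (1 / M) \<le> (y' - y) * (1 / g z)" using that by (intro mult_left_mono) auto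
    then show ?thesis using z by simp
  qed simp
  have le: "y' \<le> y" if "G y = G y'" "y \<le> y'" for y y'
  proof -
    have "(y' - y) / M \<le> 0" using exp[OF that(2)] that(1) by simp
    then show ?thesis using M by (simp add: pos_divide_le_eq)
  qed
  have inj: "y = y'" if "G y = G y'" for y y'
    using le[OF that] le[OF that[symmetric]] by linarith
  have surj: "\<exists>y. G y = t" for t
  proof -
    define d where "d = M * \<bar>t\<bar>"
    have d: "d / M = \<bar>t\<bar>" "0 \<le> d" using M by (auto simp: d_def)
    have "t \<le> G (y0 + d)" "G (y0 - d) \<le> t"
      using exp[of y0 "y0 + d"] exp[of "y0 - d" y0] d by (auto simp: G_def)
    then show ?thesis using IVT'[of G "y0 - d" t "y0 + d"] d Gc by auto
  qed
  define Y where "Y t = (SOME y. G y = t)" for t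
  have GY: "G (Y t) = t" for t unfolding Y_def using surj by (rule someI_ex)
  have YG: "Y (G y) = y" for y by (rule inj) (rule GY)
  have lip: "\<bar>Y s - Y t\<bar> \<le> M * \<bar>s - t\<bar>" for s t
  proof -
    have a: "M * (t - s) \<le> M * \<bar>s - t\<bar>" "M * (s - t) \<le> M * \<bar>s - t\<bar>"
      using M by (auto intro!: mult_left_mono)
    show ?thesis
    proof (cases "Y s \<le> Y t")
      case True
      then have "Y t - Y s \<le> M * (t - s)"
        using exp[OF True] M unfolding GY by (simp add: pos_divide_le_eq mult.commute)
      then show ?thesis using a(1) True by linarith
    next
      case False
      then have "Y s - Y t \<le> M * (s - t)"
        using exp[of "Y t" "Y s"] M unfolding GY by (simp add: pos_divide_le_eq mult.commute)
      then show ?thesis using a(2) False by linarith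
    qed
  qed
  have "M-lipschitz_on UNIV Y"
    by (rule lipschitz_onI) (use lip M in \<open>auto simp: dist_real_def\<close>)
  then have Yc: "isCont Y t" for t
    using lipschitz_on_continuous_on[of M UNIV Y] by (simp add: continuous_on_eq_continuous_at)
  show thesis
  proof (rule that[of Y G])
    fix t
    have "(Y has_real_derivative inverse (1 / g (Y t))) (at t)"
      by (rule DERIV_inverse_function[OF dG, where a="t - 1" and b="t + 1"]) (use gpos[of "Y t"] GY Yc in auto)
    then show "(Y has_real_derivative g (Y t)) (at t)" by simp
    show "G (Y t) = t" by (rule GY)
    have "G y0 = 0" by (simp add: G_def)
    then show "Y 0 = y0" using YG[of y0] by simp
  qed (rule YG lip)+
qed

section \<open>Coordinate derivatives, integrals over the strip, Borel representatives\<close>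

lemma pd_has_derivative:
  assumes "(f has_derivative F) (at p)"
  shows "pd i f p = F (coord_vec i)"
proof -
  interpret bounded_linear F by (rule has_derivative_bounded_linear[OF assms])
  have "((\<lambda>t. p + t *\<^sub>R coord_vec i) has_derivative (\<lambda>t. t *\<^sub>R coord_vec i)) (at 0)"
    by (auto intro!: derivative_eq_intros)
  moreover have "(f has_derivative F) (at (p + 0 *\<^sub>R coord_vec i))" using assms by simp
  ultimately have "((\<lambda>t. f (p + t *\<^sub>R coord_vec i)) has_derivative (\<lambda>t. F (t *\<^sub>R coord_vec i))) (at 0)"
    by (rule has_derivative_compose)
  then have "((\<lambda>t. f (p + t *\<^sub>R coord_vec i)) has_real_derivative F (coord_vec i)) (at 0)"
    unfolding has_field_derivative_def by (rule has_derivative_eq_rhs) (simp add: fun_eq_iff scale)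
  then show ?thesis by (simp add: pd_def DERIV_imp_deriv)
qed

lemma has_derivative_pd:
  assumes "f differentiable (at p)"
  shows "(f has_derivative (\<lambda>v. pd 1 f p * fst v + pd 2 f p * snd v)) (at p)"
proof -
  from assms obtain F where F: "(f has_derivative F) (at p)" by (auto simp: differentiable_def)
  interpret bounded_linear F by (rule has_derivative_bounded_linear[OF F])
  have "F v = pd 1 f p * fst v + pd 2 f p * snd v" for v
  proof -
    have "v = fst v *\<^sub>R coord_vec 1 + snd v *\<^sub>R coord_vec 2"
      by (cases v) (simp add: coord_vec_def)
    then have "F v = fst v * F (coord_vec 1) + snd v * F (coord_vec 2)"
      by (metis add scale real_scaleR_def)
    then show ?thesis by (simp add: pd_has_derivative[OF F] mult.commute)
  qed
  then show ?thesis using F by (metis (no_types, lifting) ext)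
qed

lemma strip_borel [measurable]: "strip a b \<in> sets borel"
  unfolding strip_def by (intro borel_closed closed_Times) auto

text \<open>The change of variables fills a half-plane rather than a strip. Integrands that carry a
  test function vanish above the strip, so the two domains give the same integral.\<close>

lemma integral_lebesgue_on_strip:
  fixes f :: "real \<times> real \<Rightarrow> real"
  assumes [measurable]: "f \<in> borel_measurable borel" and f: "\<And>w. b < snd w \<Longrightarrow> f w = 0"
  shows "(LINT w|lebesgue_on (strip a b). f w) = (LINT w:{w. a \<le> snd w}|lborel. f w)"
proof -
  have "(LINT w|lebesgue_on (strip a b). f w) = (LINT w|lebesgue. indicator (strip a b) w *\<^sub>R f w)"
    by (rule integral_restrict_space) auto
  also have "\<dots> = (LINT w|lborel. indicator (strip a b) w *\<^sub>R f w)"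
    by (rule integral_completion) measurable
  also have "(\<lambda>w. indicator (strip a b) w *\<^sub>R f w) = (\<lambda>w. indicator {w. a \<le> snd w} w *\<^sub>R f w)"
  proof
    show "indicator (strip a b) w *\<^sub>R f w = indicator {w. a \<le> snd w} w *\<^sub>R f w" for w
      using f[of w] by (cases w) (auto simp: strip_def indicator_def not_le)
  qed
  finally show ?thesis by (simp add: set_lebesgue_integral_def)
qed

lemma borel_measurable_lebesgue_on:
  "f \<in> borel_measurable borel \<Longrightarrow> f \<in> borel_measurable (lebesgue_on S)"
  by (intro measurable_restrict_space1 measurable_completion) simp

lemma Linfty_onI:
  assumes "f \<in> borel_measurable borel" "\<And>w. w \<in> S \<Longrightarrow> \<bar>f w\<bar> \<le> K"
  shows "Linfty_on S f"
  unfolding Linfty_on_def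
proof
  show "\<exists>K. AE p in lebesgue_on S. \<bar>f p\<bar> \<le> K"
    by (intro exI[of _ K] AE_I2) (use assms(2) in auto)
qed (rule borel_measurable_lebesgue_on[OF assms(1)])

lemma gauss_curvature_quadratic:
  fixes A B C :: real
  defines "E \<equiv> \<lambda>y. A * y\<^sup>2 + B * y + C"
  assumes "\<And>y. E y \<noteq> 0"
  shows "gauss_curvature (warped_metric E) p = - (4 * A * C - B\<^sup>2) / (4 * (E (snd p))\<^sup>2)"
proof -
  define E' where "E' y = 2 * A * y + B" for y
  have E': "(E has_real_derivative E' y) (at y)" "(E' has_real_derivative 2 * A) (at y)" for y
    unfolding E_def E'_def[abs_def] by (auto intro!: derivative_eq_intros simp: power2_eq_square)
  have "gauss_curvature (warped_metric E) p = - (2 * A) / (2 * E (snd p)) + (E' (snd p))\<^sup>2 / (4 * (E (snd p))\<^sup>2)"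
    by (rule gauss_curvature_warped_metric[OF assms(2) E'])
  also have "\<dots> = ((E' (snd p))\<^sup>2 - 4 * A * E (snd p)) / (4 * (E (snd p))\<^sup>2)"
    using assms(2)[of "snd p"] by (simp add: power2_eq_square field_simps)
  also have "(E' (snd p))\<^sup>2 - 4 * A * E (snd p) = - (4 * A * C - B\<^sup>2)"
    by (simp add: E_def E'_def power2_eq_square algebra_simps)
  finally show ?thesis .
qed

lemma Lipschitz_on_Icc:
  fixes f f' :: "real \<Rightarrow> real"
  assumes f: "\<And>y. (f has_real_derivative f' y) (at y)" and c: "continuous_on UNIV f'"
  obtains K where "0 \<le> K" "\<And>x y. x \<in> {a..b} \<Longrightarrow> y \<in> {a..b} \<Longrightarrow> \<bar>f x - f y\<bar> \<le> K * \<bar>x - y\<bar>"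
proof -
  obtain K where K: "\<And>y. y \<in> {a..b} \<Longrightarrow> \<bar>f' y\<bar> \<le> K"
    using continuous_bounded_on_compact[OF c compact_Icc] by blast
  have "norm (f x - f y) \<le> \<bar>K\<bar> * norm (x - y)" if "x \<in> {a..b}" "y \<in> {a..b}" for x y
  proof (rule field_differentiable_bound[of "{a..b}" f f'])
    show "(f has_real_derivative f' z) (at z within {a..b})" for z
      by (rule has_field_derivative_at_within[OF f])
    show "norm (f' z) \<le> \<bar>K\<bar>" if "z \<in> {a..b}" for z using K[OF that] by simp
  qed (use that in auto)
  then show thesis by (intro that[of "\<bar>K\<bar>"]) auto
qed

text \<open>The Goursat problem asks for Borel data with bounds at every point, while a Borel
  representative agrees with the given data only almost everywhere; truncation restores the bounds
  on the exceptional set.\<close>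

lemma lebesgue_bounded_borel_representative:
  fixes f :: "real \<Rightarrow> real"
  assumes "f \<in> borel_measurable lebesgue" "\<And>x. a \<le> f x" "\<And>x. f x \<le> b"
  obtains g where "g \<in> borel_measurable borel" "\<And>x. a \<le> g x" "\<And>x. g x \<le> b" "AE x in lborel. f x = g x"
proof -
  obtain h where h: "h \<in> borel_measurable lborel" "AE x in lborel. f x = h x"
    using completion_ex_borel_measurable_real[OF assms(1)] by blast
  have ab: "a \<le> b" using assms(2,3)[of 0] by linarith
  show thesis
  proof (rule that[of "\<lambda>x. max a (min b (h x))"])
    show "(\<lambda>x. max a (min b (h x))) \<in> borel_measurable borel" using h(1) by measurable
    show "AE x in lborel. f x = max a (min b (h x))"
      using h(2)
    proof eventually_elim
      fix x assume "f x = h x"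
      then show "f x = max a (min b (h x))" using assms(2,3)[of x] by simp
    qed
  qed (use ab in auto)
qed

lemma integral_lebesgue_eq_lborel:
  fixes f g :: "'a::euclidean_space \<Rightarrow> real"
  assumes f: "f \<in> borel_measurable lebesgue" and g: "g \<in> borel_measurable borel"
    and eq: "AE x in lebesgue. f x = g x"
  shows "(LINT x|lebesgue. f x) = (LINT x|lborel. g x)"
proof -
  have "(LINT x|lebesgue. f x) = (LINT x|lebesgue. g x)"
    by (rule integral_cong_AE[OF f _ eq]) (use g in \<open>simp add: measurable_completion\<close>)
  also have "\<dots> = (LINT x|lborel. g x)" by (rule integral_completion) (use g in simp)
  finally show ?thesis .
qed

text \<open>The height \<open>y1\<close> is the vertex of the parabola \<open>E\<close>. Up to there
  E' \<le> 0, which is the sign b \<ge> 0 on which the Goursat problem depends.\<close>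

lemma quadratic_gauss_codazzi_solution:
  fixes A B C y0 :: real and u0 v0 :: "real \<Rightarrow> real"
  defines "E \<equiv> \<lambda>y. A * y\<^sup>2 + B * y + C" and "y1 \<equiv> - B / (2 * A)"
  assumes A: "A > 0" and disc: "B\<^sup>2 - 4 * A * C < 0" and y01: "y0 < y1"
    and uv: "u0 \<in> borel_measurable lebesgue" "v0 \<in> borel_measurable lebesgue"
    and bd: "bounded (range (\<lambda>x. u0 x + v0 x))" "bounded (range (\<lambda>x. u0 x - v0 x))"
    and sign: "(INF x. u0 x + v0 x) > 0" "(SUP x. u0 x - v0 x) < 0"
  shows "\<exists>L M N. gauss_codazzi_weak_solution_uv (warped_metric E) y0 y1 u0 v0 L M N"
proof -
  let ?g = "warped_metric E"
  define D where "D = 4 * A * C - B\<^sup>2"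
  define E' where "E' y = 2 * A * y + B" for y
  have D0: "0 < D" using disc by (simp add: D_def)
  have 4: "4 * A * E y = (E' y)\<^sup>2 + D" for y
    by (simp add: E_def E'_def D_def power2_eq_square algebra_simps)
  \<comment> \<open>Completing the square: the minimum of the parabola is D/(4A) > 0.\<close>
  have Em: "D / (4 * A) \<le> E y" for y
  proof -
    have "D \<le> 4 * A * E y" unfolding 4 by simp
    then show ?thesis using A by (simp add: pos_divide_le_eq mult.commute)
  qed
  have m0: "0 < D / (4 * A)" using D0 A by simp
  have E0: "0 < E y" for y using Em[of y] m0 by linarith
  have Enz: "E y \<noteq> 0" for y using E0[of y] by simp
  have dE: "(E has_real_derivative E' y) (at y)" and dE': "(E' has_real_derivative 2 * A) (at y)" for y
    unfolding E_def E'_def[abs_def] by (auto intro!: derivative_eq_intros simp: power2_eq_square)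
  have Ec: "continuous_on UNIV E" "continuous_on UNIV E'"
    using dE dE' by (meson DERIV_isCont continuous_at_imp_continuous_on)+
  have E'neg: "E' y \<le> 0" if "y \<le> y1" for y
  proof -
    have "y * (2 * A) \<le> - B"
      using that pos_le_divide_eq[of "2 * A" y "- B"] A unfolding y1_def by simp
    then show ?thesis by (simp add: E'_def algebra_simps)
  qed
  obtain Mx where Mx: "\<And>y. y \<in> {y0..y1} \<Longrightarrow> \<bar>E y\<bar> \<le> Mx"
    using continuous_bounded_on_compact[OF Ec(1) compact_Icc] by blast
  \<comment> \<open>Clamping the height to the strip makes the right-hand side of dY/dt = g(Y)
    bounded above and away from 0, so that time is defined globally, and it keeps \<open>b\<close>
    nonnegative, bounded and Lipschitz on the whole line. On the strip nothing changes.\<close>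
  define cl where "cl y = max y0 (min y1 y)" for y
  have cl: "cl y \<in> {y0..y1}" "\<bar>cl x - cl y\<bar> \<le> \<bar>x - y\<bar>" for x y
    using y01 by (auto simp: cl_def max_def min_def)
  have cl_id: "cl y = y" if "y \<in> {y0..y1}" for y using that by (simp add: cl_def)
  have cl_cont: "continuous_on UNIV cl" unfolding cl_def[abs_def] by (intro continuous_intros)
  define g where "g y = E (cl y)" for y
  have g: "continuous_on UNIV g" "D / (4 * A) \<le> g y" "g y \<le> Mx" for y
    unfolding g_def[abs_def] using continuous_on_compose2[OF Ec(1) cl_cont] Em Mx[OF cl(1)[of y]]
    by (auto simp: abs_le_iff)
  obtain Y G where Y: "\<And>t. (Y has_real_derivative g (Y t)) (at t)" "\<And>t. G (Y t) = t" "\<And>y. Y (G y) = y"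
    "Y 0 = y0" "\<And>s t. \<bar>Y s - Y t\<bar> \<le> Mx * \<bar>s - t\<bar>"
    using autonomous_ode_global_solution[OF g m0, of y0] by metis
  have Yc: "continuous_on UNIV Y" using Y(1) by (meson DERIV_isCont continuous_at_imp_continuous_on)
  define e where "e t = g (Y t)" for t
  have e: "continuous_on UNIV e" "0 < e t" for t
    unfolding e_def[abs_def] using continuous_on_compose2[OF g(1) Yc] g(2)[of "Y t"] m0 by auto
  define k where "k y = - E' y / (2 * E y)" for y
  define k' where "k' y = ((E' y)\<^sup>2 - 2 * A * E y) / (2 * (E y)\<^sup>2)" for y
  have dk: "(k has_real_derivative k' y) (at y)" for y
    unfolding k_def[abs_def] k'_def using Enz[of y]
    by (auto intro!: derivative_eq_intros dE dE' simp: power2_eq_square field_simps)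
  have k'c: "continuous_on UNIV k'" unfolding k'_def[abs_def] using Enz by (intro continuous_intros Ec) auto
  obtain K where K: "0 \<le> K" "\<And>x y. x \<in> {y0..y1} \<Longrightarrow> y \<in> {y0..y1} \<Longrightarrow> \<bar>k x - k y\<bar> \<le> K * \<bar>x - y\<bar>"
    using Lipschitz_on_Icc[OF dk k'c, of y0 y1] by blast
  have kc: "continuous_on UNIV k" using dk by (meson DERIV_isCont continuous_at_imp_continuous_on)
  obtain Cb where Cb: "\<And>y. y \<in> {y0..y1} \<Longrightarrow> \<bar>k y\<bar> \<le> Cb"
    using continuous_bounded_on_compact[OF kc compact_Icc] by blast
  define b where "b t = k (cl (Y t))" for t
  have b0: "0 \<le> b t" for t
    using E'neg[of "cl (Y t)"] cl(1)[of "Y t"] E0[of "cl (Y t)"] by (simp add: b_def k_def divide_nonpos_pos)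
  have bC: "\<bar>b t\<bar> \<le> Cb" for t unfolding b_def by (rule Cb[OF cl(1)])
  have bLip: "\<bar>b s - b t\<bar> \<le> K * Mx * \<bar>s - t\<bar>" for s t
  proof -
    have "\<bar>b s - b t\<bar> \<le> K * \<bar>cl (Y s) - cl (Y t)\<bar>" unfolding b_def by (rule K(2)[OF cl(1) cl(1)])
    also have "\<dots> \<le> K * (Mx * \<bar>s - t\<bar>)"
      using order_trans[OF cl(2) Y(5)] K(1) by (rule mult_left_mono)
    finally show ?thesis by simp
  qed
  have [measurable]: "b \<in> borel_measurable borel"
    unfolding b_def[abs_def]
    by (intro borel_measurable_continuous_onI continuous_on_compose2[OF kc] continuous_on_compose2[OF cl_cont] Yc) auto

  obtain c2 where c2: "\<And>x. \<bar>u0 x + v0 x\<bar> \<le> c2" using bd(1) by (auto simp: bounded_iff)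
  obtain c4 where c4: "\<And>x. \<bar>u0 x - v0 x\<bar> \<le> c4" using bd(2) by (auto simp: bounded_iff)
  define c1 where "c1 = (INF x. u0 x + v0 x)"
  define c3 where "c3 = - (SUP x. u0 x - v0 x)"
  have c13: "0 < c1" "0 < c3" using sign by (simp_all add: c1_def c3_def)
  have c1: "c1 \<le> u0 x + v0 x" for x
    unfolding c1_def by (rule cINF_lower[OF bounded_imp_bdd_below[OF bd(1)]]) simp
  have c3: "c3 \<le> v0 x - u0 x" for x
    using cSUP_upper[OF _ bounded_imp_bdd_above[OF bd(2)], of x] by (simp add: c3_def)
  have c24: "u0 x + v0 x \<le> c2" "v0 x - u0 x \<le> c4" for x using c2[of x] c4[of x] by linarith+
  have m: "(\<lambda>x. u0 x + v0 x) \<in> borel_measurable lebesgue" "(\<lambda>x. v0 x - u0 x) \<in> borel_measurable lebesgue"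
    using uv by measurable
  obtain W where [measurable]: "W \<in> borel_measurable borel"
    and W: "\<And>x. c1 \<le> W x" "\<And>x. W x \<le> c2" "AE x in lborel. u0 x + v0 x = W x"
    using lebesgue_bounded_borel_representative[OF m(1) c1 c24(1)] by metis
  obtain Z where [measurable]: "Z \<in> borel_measurable borel"
    and Z: "\<And>x. c3 \<le> Z x" "\<And>x. Z x \<le> c4" "AE x in lborel. v0 x - u0 x = Z x"
    using lebesgue_bounded_borel_representative[OF m(2) c3 c24(2)] by metis
  \<comment> \<open>Here \<open>W\<close> and \<open>Z\<close> represent u0 + v0 and v0 - u0.
    Compared with the overview they lack the factor E, and \<open>Z\<close> has the opposite sign,
    so both are positive; the factor cancels in \<open>p\<close> and \<open>q\<close> and survives
    in \<open>r\<close>.\<close>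
  define p where "p x = W x / (W x + Z x)" for x
  define q where "q x = Z x / (W x + Z x)" for x
  define r where "r x = 1 / (E y0 * (W x + Z x))" for x
  have WZ: "0 < W x" "0 < Z x" "0 < W x + Z x" "W x + Z x \<le> c2 + c4" "c1 + c3 \<le> W x + Z x" for x
    using W(1,2)[of x] Z(1,2)[of x] c13 by linarith+
  have c24': "0 < c2 + c4" using WZ(3,4)[of 0] by linarith
  \<comment> \<open>A common lower bound for \<open>p\<close>, \<open>q\<close> and
    \<open>r\<close>: the sign conditions bound the numerators of \<open>p\<close> and
    \<open>q\<close> below by \<open>c1\<close> and \<open>c3\<close>, and boundedness of the data
    bounds W + Z above by \<open>c2 + c4\<close>.\<close>
  define c where "c = min (c1 / (c2 + c4)) (min (c3 / (c2 + c4)) (1 / (E y0 * (c2 + c4))))"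
  define C' where "C' = max Cb (1 / (E y0 * (c1 + c3)))"
  have c: "0 < c" using c13 c24' E0[of y0] by (simp add: c_def)
  have cp: "c \<le> p x" "c \<le> q x" "c \<le> r x" "r x \<le> C'" "p x + q x = 1" for x
  proof -
    have "c1 / (c2 + c4) \<le> p x" "c3 / (c2 + c4) \<le> q x"
      unfolding p_def q_def using W(1)[of x] Z(1)[of x] WZ[of x] c13 by (auto intro!: frac_le)
    moreover have "1 / (E y0 * (c2 + c4)) \<le> r x"
      unfolding r_def using WZ[of x] E0[of y0] c24' by (intro divide_left_mono mult_left_mono mult_pos_pos) auto
    ultimately show "c \<le> p x" "c \<le> q x" "c \<le> r x" by (auto simp: c_def)
    have "r x \<le> 1 / (E y0 * (c1 + c3))"
      unfolding r_def using WZ[of x] E0[of y0] c13 by (intro divide_left_mono mult_left_mono mult_pos_pos) auto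
    then show "r x \<le> C'" by (simp add: C'_def)
    show "p x + q x = 1" using WZ(3)[of x] by (simp add: p_def q_def add_divide_distrib[symmetric])
  qed
  have [measurable]: "p \<in> borel_measurable borel" "q \<in> borel_measurable borel" "r \<in> borel_measurable borel"
    unfolding p_def[abs_def] q_def[abs_def] r_def[abs_def] by measurable
  have rb: "\<bar>r x\<bar> \<le> C'" for x using cp(3,4)[of x] c by simp
  have pq: "\<bar>p (fst z) * q (snd z)\<bar> \<le> 1" for z
    using cp(1,2,5)[of "fst z"] cp(1,2,5)[of "snd z"] c by (simp add: abs_mult mult_le_one)
  obtain T where T: "continuous_on UNIV T"
    "\<And>x. T x = (LINT z:{snd x..fst x}|lborel. r z) + (LINT z:tri (fst x) (snd x)|lborel. b (T z) * (p (fst z) * q (snd z)))"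
  proof (rule goursat_solution_exists[of "\<lambda>x. LINT z:{snd x..fst x}|lborel. r z" "\<lambda>z. p (fst z) * q (snd z)" b Cb "K * Mx"])
    show "continuous_on UNIV (\<lambda>x. LINT z:{snd x..fst x}|lborel. r z)"
      by (rule continuous_Icc_integral[where C=C']) (use rb in auto)
    show "(\<lambda>z. p (fst z) * q (snd z)) \<in> borel_measurable borel" by measurable
  qed (rule pq bC bLip that; assumption)+
  interpret gauss_codazzi_goursat p q r b c C' T Y e G y0 E E' D y1
  proof
    show "b t \<le> C'" for t using bC[of t] by (simp add: C'_def)
    show "T (\<xi>, \<eta>) = (LINT s:{\<eta>..\<xi>}|lborel. r s) + (LINT z:tri \<xi> \<eta>|lborel. b (T z) * (p (fst z) * q (snd z)))" for \<xi> \<eta>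
      using T(2)[of "(\<xi>, \<eta>)"] by simp
    have Ymono: "y0 \<le> Y t" if "0 \<le> t" for t
      using DERIV_nonneg_imp_nondecreasing[OF that, of Y] Y(1,4) e(2) by (metis e_def less_imp_le)
    show "e t = E (Y t)" if "0 \<le> t" "Y t \<le> y1" for t
      using cl_id[of "Y t"] Ymono[OF that(1)] that by (simp add: e_def g_def)
    show "b t = - E' (Y t) / (2 * E (Y t))" if "0 \<le> t" "Y t \<le> y1" for t
      using cl_id[of "Y t"] Ymono[OF that(1)] that by (simp add: b_def k_def)
    show "(Y has_real_derivative e t) (at t)" for t using Y(1) by (simp add: e_def)
  qed (use c cp b0 T(1) e Y E0 dE Ec D0 y01 in auto)
  have ch: "christoffel ?g 1 1 1 w = 0" "christoffel ?g 1 1 2 w = E' (snd w) / (2 * E (snd w))"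
    "christoffel ?g 1 2 2 w = 0" "christoffel ?g 2 1 1 w = - E' (snd w) / 2"
    "christoffel ?g 2 1 2 w = 0" "christoffel ?g 2 2 2 w = 0" for w
    by (rule christoffel_warped_metric[of E w E', OF Enz dE])+
  have curv: "gauss_curvature ?g w = - D / (4 * (E (snd w))\<^sup>2)" for w
    unfolding E_def D_def by (rule gauss_curvature_quadratic) (use Enz in \<open>simp add: E_def\<close>)
  have gm: "gam ?g (x, y0) = sqrt D / (2 * E y0)" for x
  proof -
    have "sqrt (D / (4 * (E y0)\<^sup>2)) = sqrt D / sqrt ((2 * E y0)\<^sup>2)" by (simp add: real_sqrt_divide power2_eq_square)
    also have "sqrt ((2 * E y0)\<^sup>2) = 2 * E y0" using E0[of y0] by (intro real_sqrt_unique) auto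
    finally show ?thesis by (simp add: gam_def curv)
  qed
  \<comment> \<open>On the diagonal P = Q = J = r, so the right-hand sides are the initial values of
    the constructed L and M. They match the prescribed data because W + Z = 2 v0 and W - Z = 2 u0
    almost everywhere.\<close>
  have init: "AE x in lebesgue. gam ?g (x, y0) / v0 x = sqrt D * r x
      \<and> - gam ?g (x, y0) * u0 x / v0 x = - (sqrt D / (2 * E y0)) * (p x - q x)"
  proof -
    have "AE x in lborel. gam ?g (x, y0) / v0 x = sqrt D * r x
      \<and> - gam ?g (x, y0) * u0 x / v0 x = - (sqrt D / (2 * E y0)) * (p x - q x)"
      using W(3) Z(3)
    proof eventually_elim
      fix x assume "u0 x + v0 x = W x" "v0 x - u0 x = Z x"
      then have s: "W x + Z x = 2 * v0 x" "W x - Z x = 2 * u0 x" by linarith+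
      have v: "0 < v0 x" using WZ(3)[of x] s(1) by simp
      have "p x - q x = u0 x / v0 x"
        using v by (simp add: p_def q_def diff_divide_distrib[symmetric] s)
      moreover have "r x = 1 / (2 * E y0 * v0 x)" by (simp add: r_def s)
      ultimately show "gam ?g (x, y0) / v0 x = sqrt D * r x
        \<and> - gam ?g (x, y0) * u0 x / v0 x = - (sqrt D / (2 * E y0)) * (p x - q x)"
        by (simp add: gm)
    qed
    then show ?thesis by (simp add: AE_completion_iff)
  qed
  obtain Kb where Kb: "\<And>w. y0 \<le> snd w \<Longrightarrow> snd w \<le> y1 \<Longrightarrow> \<bar>L w\<bar> \<le> Kb \<and> \<bar>M w\<bar> \<le> Kb \<and> \<bar>N w\<bar> \<le> Kb"
    using LMN_bounded by metis
  have codazzi: "(LINT w|lebesgue_on (strip y0 y1). L w * pd 2 \<phi> w - M w * pd 1 \<phi> w)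
      + (LINT x|lebesgue. gam ?g (x, y0) / v0 x * \<phi> (x, y0))
      = (LINT w|lebesgue_on (strip y0 y1). (christoffel ?g 2 2 2 w * L w
          - 2 * christoffel ?g 2 1 2 w * M w + christoffel ?g 2 1 1 w * N w) * \<phi> w)" (is ?eq1)
    "(LINT w|lebesgue_on (strip y0 y1). M w * pd 2 \<phi> w - N w * pd 1 \<phi> w)
      + (LINT x|lebesgue. - gam ?g (x, y0) * u0 x / v0 x * \<phi> (x, y0))
      = (LINT w|lebesgue_on (strip y0 y1). (- christoffel ?g 1 2 2 w * L w
          + 2 * christoffel ?g 1 1 2 w * M w - christoffel ?g 1 1 1 w * N w) * \<phi> w)" (is ?eq2)
    if \<phi>: "test_function y1 \<phi>" for \<phi>
  proof -
    obtain S where S: "compact S" "S \<subseteq> UNIV \<times> {..<y1}" "\<And>w. w \<notin> S \<Longrightarrow> \<phi> w = 0"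
      using \<phi> by (auto simp: test_function_def)
    have "Ck (Suc 0) \<phi>" using \<phi> by (simp only: test_function_def)
    then have "\<And>w. \<phi> differentiable (at w)" "\<And>i. continuous_on UNIV (pd i \<phi>)" by auto
    then interpret gauss_codazzi_test p q r b c C' T Y e G y0 E E' D y1 \<phi> "pd 1 \<phi>" "pd 2 \<phi>" S
      by unfold_locales (use S in \<open>auto intro: has_derivative_pd\<close>)
    have "(\<lambda>x::real. (x, y0)) \<in> borel_measurable borel" by simp
    then have \<phi>0 [measurable]: "(\<lambda>x. \<phi> (x, y0)) \<in> borel_measurable borel"
      by (rule measurable_compose) (rule \<phi>_borel)
    then have \<phi>0l: "(\<lambda>x. \<phi> (x, y0)) \<in> borel_measurable lebesgue" by (intro measurable_completion) simp
    have zero: "\<phi> w = 0" "pd 1 \<phi> w = 0" "pd 2 \<phi> w = 0" if "y1 < snd w" for w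
      using \<phi>_zero'[of w] that by auto
    have i1: "(LINT x|lebesgue. gam ?g (x, y0) / v0 x * \<phi> (x, y0))
        = (LINT x|lborel. sqrt D * r x * \<phi> (x, y0))"
    proof (rule integral_lebesgue_eq_lborel)
      show "(\<lambda>x. gam ?g (x, y0) / v0 x * \<phi> (x, y0)) \<in> borel_measurable lebesgue"
        unfolding gm using uv \<phi>0l by measurable
      show "(\<lambda>x. sqrt D * r x * \<phi> (x, y0)) \<in> borel_measurable borel" by measurable
      show "AE x in lebesgue. gam ?g (x, y0) / v0 x * \<phi> (x, y0) = sqrt D * r x * \<phi> (x, y0)"
        using init by eventually_elim simp
    qed
    have i2: "(LINT x|lebesgue. - gam ?g (x, y0) * u0 x / v0 x * \<phi> (x, y0))
        = (LINT x|lborel. - (sqrt D / (2 * E y0)) * (p x - q x) * \<phi> (x, y0))"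
    proof (rule integral_lebesgue_eq_lborel)
      show "(\<lambda>x. - gam ?g (x, y0) * u0 x / v0 x * \<phi> (x, y0)) \<in> borel_measurable lebesgue"
        unfolding gm using uv \<phi>0l by measurable
      show "(\<lambda>x. - (sqrt D / (2 * E y0)) * (p x - q x) * \<phi> (x, y0)) \<in> borel_measurable borel" by measurable
      show "AE x in lebesgue. - gam ?g (x, y0) * u0 x / v0 x * \<phi> (x, y0) = - (sqrt D / (2 * E y0)) * (p x - q x) * \<phi> (x, y0)"
        using init by eventually_elim simp
    qed
    note strip = integral_lebesgue_on_strip[where a=y0 and b=y1]
    show ?eq1
      using weak_codazzi_1 unfolding i1 ch by (subst (1 2) strip) (auto simp: zero)
    show ?eq2
      using weak_codazzi_2 unfolding i2 ch by (subst (1 2) strip) (auto simp: zero)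
  qed
  have "gauss_codazzi_weak_solution_uv ?g y0 y1 u0 v0 L M N"
    unfolding gauss_codazzi_weak_solution_uv_def gauss_codazzi_weak_solution_def
  proof (intro conjI allI impI)
    show "AE w in lebesgue_on (strip y0 y1). L w \<noteq> 0" using L_pos by (intro AE_I2) (metis less_irrefl)
    show "AE w in lebesgue_on (strip y0 y1). L w * N w - (M w)\<^sup>2 = gauss_curvature ?g w"
      by (intro AE_I2) (simp add: gauss_equation curv)
    show "Linfty_on (strip y0 y1) L" "Linfty_on (strip y0 y1) M" "Linfty_on (strip y0 y1) N"
      using Kb by (auto intro!: Linfty_onI[where K=Kb] simp: strip_def)
  qed (rule codazzi; assumption)+
  then show ?thesis by blast
qed

theorem theorem5p2:
  fixes A B C y0 :: real and u0 v0 :: "real \<Rightarrow> real"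
  assumes "A > 0" and "B \<le> 0" and "B\<^sup>2 - 4 * A * C < 0"
    and "y0 > 0" and "y0 < - B / (2 * A)"
    and "u0 \<in> borel_measurable lebesgue" and "v0 \<in> borel_measurable lebesgue"
    and "bounded (range (\<lambda>x. u0 x + v0 x))" and "bounded (range (\<lambda>x. u0 x - v0 x))"
    and "(INF x. u0 x + v0 x) > 0" and "(SUP x. u0 x - v0 x) < 0"
  shows "(\<exists>L M N. gauss_codazzi_weak_solution_uv
            (warped_metric (\<lambda>y. A * y\<^sup>2 + B * y + C)) y0 (- B / (2 * A)) u0 v0 L M N) \<and>
         (\<exists>f. C11_isometric_immersion
            (warped_metric (\<lambda>y. A * y\<^sup>2 + B * y + C)) (strip y0 (- B / (2 * A))) f)"
proof
  show "\<exists>L M N. gauss_codazzi_weak_solution_uv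
      (warped_metric (\<lambda>y. A * y\<^sup>2 + B * y + C)) y0 (- B / (2 * A)) u0 v0 L M N"
    using assms by (intro quadratic_gauss_codazzi_solution)
  show "\<exists>f. C11_isometric_immersion
      (warped_metric (\<lambda>y. A * y\<^sup>2 + B * y + C)) (strip y0 (- B / (2 * A))) f"
    using assms by (intro quadratic_warped_metric_immersion)
qed

end
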